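(* Let $c$ be the all-different constraint on $n$ variables $v_1,\dots,v_n$ with domain $[1,d]$. Unit-propagation on the program consisting, for each interval $[l,u]\subseteq[1,d]$, of the rule $$violate(c)\leftarrow (u-l+2)\,\{r(v_1,l,u),\dots,r(v_n,l,u)\},$$ for each $v\in\{v_1,\dots,v_n\}$, of the rules $$\{b(v,1),\dots,b(v,d)\}\leftarrow,\qquad \bot\leftarrow b(v,i),\ \mathit{not}\,b(v,i+1)\quad(1\le i<d),\qquad \bot\leftarrow\mathit{not}\,b(v,d),$$ and, for each such $v$ and each interval $[l,u]\subseteq[1,d]$, of the rules $$r(v,l,u)\leftarrow\mathit{not}\,b(v,l-1),\ b(v,u),\qquad \bot\leftarrow r(v,l,u),\ b(v,l-1),\qquad \bot\leftarrow r(v,l,u),\ \mathit{not}\,b(v,u),$$ with $c$ required to hold, enforces bound consistency on $c$, in $\mathcal{O}(nd^2)$ total time down any branch of the search tree.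
   Context: Constraints. Variables have domain $[1,d]=\{1,\dots,d\}$. The all-different constraint on $v_1,\dots,v_n$ requires these variables to take pairwise different values. Current domains $D(v)\subseteq[1,d]$ are intervals. A bound support for $v_i=a$ is an allowed tuple with $i$-th entry $a$ and, for every $j\neq i$, $j$-th entry in $[\min D(v_j),\max D(v_j)]$. A constraint is bound consistent iff for every variable $v_i$ in its scope and each $a\in\{\min D(v_i),\max D(v_i)\}$ there is a bound support for $v_i=a$. Enforcing bound consistency means replacing the interval domains by the largest interval subdomains for which $c$ is bound consistent; failure means that some domain becomes empty. Logic programs and unit-propagation. A rule $h\leftarrow a_1,\dots,a_m,\mathit{not}\,a_{m+1},\dots,\mathit{not}\,a_k$ has head $h$ and body the set of literals on its right; $\bot$ is the always-false atom. A choice rule $\{h_1,\dots,h_k\}\leftarrow$ leaves $h_1,\dots,h_k$ free. A cardinality body $k\{\ell_1,\dots,\ell_m\}$ holds iff at least $k$ of the literals $\ell_j$ hold. Unit-propagation works on partial truth assignments to atoms and rule bodies, using the nogoods (forbidden sets of truth-value assignments) expressing that: a body is true iff its literals are all true (for a cardinality body: iff at least $k$ of its literals are true; semantically one nogood per relevant subset of literals, but an implementation may realise the same inferences by other means such as counters); a true body makes its head true; an atom is true only if the body of some rule having it in its head is true; $\bot$ is false. Whenever all but one element of a nogood hold, the complement of the remaining element is added; a conflict occurs if all elements of some nogood hold. The atoms $b(v,i)$ mean $v\le i$ and the atoms $r(v,l,u)$, $1\le l\le u\le d$, mean $v\in[l,u]$; $b(v,0)$ is taken as false (so $\mathit{not}\,b(v,0)$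 is omitted, and rules with $b(v,0)$ in the body are dropped). The program also contains the reification rules $sat(c)\leftarrow\mathit{not}\,violate(c)$ and $violate(c)\leftarrow\mathit{not}\,sat(c)$. Enforcing a consistency by unit-propagation. Given nonempty initial interval domains $D(v)=[p_v,q_v]\subseteq[1,d]$, start from the assignment in which $violate(c)$ is false, $b(v,p_v-1)$ is false (if $p_v>1$) and $b(v,q_v)$ is true, and run unit-propagation to fixpoint. The domain of $v$ at the fixpoint is the interval $[p,q]$ where $p-1$ is the largest $i\ge 0$ with $b(v,i)$ false and $q$ is the smallest $i$ with $b(v,i)$ true. That unit-propagation enforces bound consistency means: for all such initial domains, a conflict occurs iff enforcing bound consistency fails, and otherwise the domains at the fixpoint equal those obtained by enforcing bound consistency. Search tree branch. A branch is a sequence of decisions, each assigning a truth value to an unassigned atom, with unit-propagation run to fixpoint after each decision, until a conflict occurs or everything is assigned. "In $\mathcal{O}(f)$ down any branch" means that unit-propagation can be implemented so that its total running time over any whole branch is $\mathcal{O}(f)$. *)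

theory Defs
  imports "HOL-Library.FuncSet"
begin

section \<open>Constraints and bound consistency\<close>

text \<open>
  The variables \<open>v\<^sub>1, \<dots>, v\<^sub>n\<close> are represented by their indices \<open>1, \<dots>, n\<close>. A constraint on them is
  the set of its allowed tuples, a tuple being an extensional function on \<open>{1..n}\<close>.
\<close>

type_synonym constr = "(nat \<Rightarrow> nat) set"
type_synonym domains = "nat \<Rightarrow> nat set"

definition alldifferent :: "nat \<Rightarrow> nat \<Rightarrow> constr" where
  "alldifferent n d = {t \<in> {1..n} \<rightarrow>\<^sub>E {1..d}. inj_on t {1..n}}"

definition interval :: "nat set \<Rightarrow> bool" where
  "interval X \<longleftrightarrow> (\<exists>a b. X = {a..b})"

text \<open>\<open>Min\<close> and \<open>Max\<close> are unspecified on the empty set, so empty domains are treated explicitly: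
  an empty domain offers no value for a support, and has no bound that would need one.\<close>

definition bound_support :: "nat \<Rightarrow> constr \<Rightarrow> domains \<Rightarrow> nat \<Rightarrow> nat \<Rightarrow> (nat \<Rightarrow> nat) \<Rightarrow> bool" where
  "bound_support n C D i a t \<longleftrightarrow>
     t \<in> C \<and> t i = a \<and>
     (\<forall>j\<in>{1..n} - {i}. D j \<noteq> {} \<and> Min (D j) \<le> t j \<and> t j \<le> Max (D j))"

definition bound_consistent :: "nat \<Rightarrow> constr \<Rightarrow> domains \<Rightarrow> bool" where
  "bound_consistent n C D \<longleftrightarrow>
     (\<forall>i\<in>{1..n}. D i \<noteq> {} \<longrightarrow>
        (\<forall>a\<in>{Min (D i), Max (D i)}. \<exists>t. bound_support n C D i a t))"

definition bc_subdomains :: "nat \<Rightarrow> constr \<Rightarrow> domains \<Rightarrow> domains \<Rightarrow> bool" where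
  "bc_subdomains n C D D' \<longleftrightarrow>
     (\<forall>i\<in>{1..n}. interval (D' i) \<and> D' i \<subseteq> D i) \<and> bound_consistent n C D'"

text \<open>\<open>D'\<close> is the result of enforcing bound consistency on \<open>D\<close>; it is unique on \<open>{1..n}\<close>.\<close>

definition bc_enforced :: "nat \<Rightarrow> constr \<Rightarrow> domains \<Rightarrow> domains \<Rightarrow> bool" where
  "bc_enforced n C D D' \<longleftrightarrow>
     bc_subdomains n C D D' \<and>
     (\<forall>E. bc_subdomains n C D E \<longrightarrow> (\<forall>i\<in>{1..n}. E i \<subseteq> D' i))"

definition bc_fails :: "nat \<Rightarrow> domains \<Rightarrow> bool" where
  "bc_fails n D' \<longleftrightarrow> (\<exists>i\<in>{1..n}. D' i = {})"


section \<open>Logic programs and their nogoods\<close>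

datatype atom = Bot | Sat | Violate | B nat nat | R nat nat nat
datatype lit = Pos atom | Neg atom
datatype body = Conj "lit set" | Card nat "lit set"
datatype head = Head atom | Choice "atom set"
datatype rule = Rule head body

type_synonym program = "rule set"

fun lit_atom :: "lit \<Rightarrow> atom" where
  "lit_atom (Pos a) = a"
| "lit_atom (Neg a) = a"

fun head_atoms :: "head \<Rightarrow> atom set" where
  "head_atoms (Head a) = {a}"
| "head_atoms (Choice H) = H"

fun body_lits :: "body \<Rightarrow> lit set" where
  "body_lits (Conj L) = L"
| "body_lits (Card k L) = L"

definition atoms :: "program \<Rightarrow> atom set" where
  "atoms P = {a. \<exists>h \<beta>. Rule h \<beta> \<in> P \<and> (a \<in> head_atoms h \<or> a \<in> lit_atom ` body_lits \<beta>)}"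

definition bodies :: "program \<Rightarrow> body set" where
  "bodies P = {\<beta>. \<exists>h. Rule h \<beta> \<in> P}"

text \<open>
  Truth values are assigned to atoms and bodies. A partial assignment, and likewise a nogood, is a
  set of pairs of such an object and a truth value.
\<close>

datatype obj = Atom atom | Body body

type_synonym entry = "obj \<times> bool"
type_synonym assignment = "entry set"

fun compl :: "entry \<Rightarrow> entry" where
  "compl (x, b) = (x, \<not> b)"

fun holds :: "lit \<Rightarrow> entry" where
  "holds (Pos a) = (Atom a, True)"
| "holds (Neg a) = (Atom a, False)"

text \<open>
  For \<open>Card k L\<close>, the second kind of nogood says that the body is not true once \<open>card L - k + 1\<close> of
  its literals are false, leaving only \<open>k - 1\<close>. If \<open>k > card L\<close>, truncated subtraction yields
  \<open>S = {}\<close>, that is, the body is false outright.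
\<close>

fun body_nogoods :: "body \<Rightarrow> assignment set" where
  "body_nogoods (Conj L) =
     {{(Body (Conj L), False)} \<union> holds ` L} \<union>
     {{(Body (Conj L), True), compl (holds l)} | l. l \<in> L}"
| "body_nogoods (Card k L) =
     {{(Body (Card k L), False)} \<union> holds ` S | S. S \<subseteq> L \<and> card S = k} \<union>
     {{(Body (Card k L), True)} \<union> (compl \<circ> holds) ` S | S. S \<subseteq> L \<and> card S = card L + 1 - k}"

definition nogoods :: "program \<Rightarrow> assignment set" where
  "nogoods P =
     (\<Union>\<beta>\<in>bodies P. body_nogoods \<beta>) \<union>
     {{(Body \<beta>, True), (Atom h, False)} | h \<beta>. Rule (Head h) \<beta> \<in> P} \<union>
     {{(Atom a, True)} \<union> {(Body \<beta>, False) | \<beta>. \<exists>h. Rule h \<beta> \<in> P \<and> a \<in> head_atoms h} | a. a \<in> atoms P} \<union>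
     {{(Atom Bot, True)}}"


section \<open>Unit-propagation\<close>

text \<open>
  \<open>up N A\<close> is the fixpoint of unit-propagation started from \<open>A\<close>. Propagation is not stopped at a
  conflict here. This does not matter: what is derived before a conflict is contained in \<open>up N A\<close>,
  and if \<open>up N A\<close> contains no nogood, then no conflict is met on the way to it.
\<close>

inductive_set up :: "assignment set \<Rightarrow> assignment \<Rightarrow> assignment"
  for N :: "assignment set" and A :: assignment where
  start: "x \<in> A \<Longrightarrow> x \<in> up N A"
| unit: "\<delta> \<in> N \<Longrightarrow> x \<in> \<delta> \<Longrightarrow> (\<And>y. y \<in> \<delta> - {x} \<Longrightarrow> y \<in> up N A) \<Longrightarrow> compl x \<in> up N A"

definition conflict :: "assignment set \<Rightarrow> assignment \<Rightarrow> bool" where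
  "conflict N A \<longleftrightarrow> (\<exists>\<delta>\<in>N. \<delta> \<subseteq> A)"

definition init_domains :: "nat \<Rightarrow> nat \<Rightarrow> (nat \<Rightarrow> nat) \<Rightarrow> (nat \<Rightarrow> nat) \<Rightarrow> bool" where
  "init_domains n d p q \<longleftrightarrow> (\<forall>v\<in>{1..n}. 1 \<le> p v \<and> p v \<le> q v \<and> q v \<le> d)"

definition init_assignment :: "nat \<Rightarrow> (nat \<Rightarrow> nat) \<Rightarrow> (nat \<Rightarrow> nat) \<Rightarrow> assignment" where
  "init_assignment n p q =
     {(Atom Violate, False)} \<union>
     {(Atom (B v (p v - 1)), False) | v. v \<in> {1..n} \<and> p v > 1} \<union>
     {(Atom (B v (q v)), True) | v. v \<in> {1..n}}"

definition root :: "nat \<Rightarrow> program \<Rightarrow> (nat \<Rightarrow> nat) \<Rightarrow> (nat \<Rightarrow> nat) \<Rightarrow> assignment" where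
  "root n P p q = up (nogoods P) (init_assignment n p q)"

text \<open>The element \<open>0\<close> below stands for \<open>b(v,0)\<close>, which is false.\<close>

definition dom_of :: "assignment \<Rightarrow> domains" where
  "dom_of A v =
     {Max (insert 0 {i. (Atom (B v i), False) \<in> A}) + 1 .. (LEAST i. (Atom (B v i), True) \<in> A)}"

definition up_enforces_bc :: "nat \<Rightarrow> nat \<Rightarrow> program \<Rightarrow> constr \<Rightarrow> bool" where
  "up_enforces_bc n d P C \<longleftrightarrow>
     (\<forall>p q. init_domains n d p q \<longrightarrow>
        (\<exists>D'. bc_enforced n C (\<lambda>v. {p v..q v}) D' \<and>
              (conflict (nogoods P) (root n P p q) \<longleftrightarrow> bc_fails n D') \<and>
              (\<not> conflict (nogoods P) (root n P p q) \<longrightarrow>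
                 (\<forall>v\<in>{1..n}. dom_of (root n P p q) v = D' v))))"


section \<open>The program for the all-different constraint\<close>

text \<open>Literals \<open>not b(v,0)\<close> are omitted and rules with \<open>b(v,0)\<close> in the body are dropped.\<close>

definition not_b :: "nat \<Rightarrow> nat \<Rightarrow> lit set" where
  "not_b v i = (if i = 0 then {} else {Neg (B v i)})"

definition hall_body :: "nat \<Rightarrow> nat \<Rightarrow> nat \<Rightarrow> body" where
  "hall_body n l u = Card (u - l + 2) ((\<lambda>v. Pos (R v l u)) ` {1..n})"

definition order_body :: "nat \<Rightarrow> nat \<Rightarrow> body" where
  "order_body v i = Conj {Pos (B v i), Neg (B v (i + 1))}"

definition top_body :: "nat \<Rightarrow> nat \<Rightarrow> body" where
  "top_body d v = Conj {Neg (B v d)}"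

definition r_body :: "nat \<Rightarrow> nat \<Rightarrow> nat \<Rightarrow> body" where
  "r_body v l u = Conj (not_b v (l - 1) \<union> {Pos (B v u)})"

definition lower_body :: "nat \<Rightarrow> nat \<Rightarrow> nat \<Rightarrow> body" where
  "lower_body v l u = Conj {Pos (R v l u), Pos (B v (l - 1))}"

definition upper_body :: "nat \<Rightarrow> nat \<Rightarrow> nat \<Rightarrow> body" where
  "upper_body v l u = Conj {Pos (R v l u), Neg (B v u)}"

definition reification_rules :: program where
  "reification_rules =
     {Rule (Head Sat) (Conj {Neg Violate}), Rule (Head Violate) (Conj {Neg Sat})}"

definition alldiff_program :: "nat \<Rightarrow> nat \<Rightarrow> program" where
  "alldiff_program n d =
     reification_rules \<union>
     {Rule (Head Violate) (hall_body n l u) | l u. 1 \<le> l \<and> l \<le> u \<and> u \<le> d} \<union>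
     {Rule (Choice (B v ` {1..d})) (Conj {}) | v. v \<in> {1..n}} \<union>
     {Rule (Head Bot) (order_body v i) | v i. v \<in> {1..n} \<and> 1 \<le> i \<and> i < d} \<union>
     {Rule (Head Bot) (top_body d v) | v. v \<in> {1..n}} \<union>
     {Rule (Head (R v l u)) (r_body v l u) | v l u. v \<in> {1..n} \<and> 1 \<le> l \<and> l \<le> u \<and> u \<le> d} \<union>
     {Rule (Head Bot) (lower_body v l u) | v l u. v \<in> {1..n} \<and> 1 < l \<and> l \<le> u \<and> u \<le> d} \<union>
     {Rule (Head Bot) (upper_body v l u) | v l u. v \<in> {1..n} \<and> 1 \<le> l \<and> l \<le> u \<and> u \<le> d}"


section \<open>A random access machine\<close>

text \<open>
  Running times refer to imperative programs over arrays of natural numbers, with addition,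
  truncated subtraction and comparison. Every assignment and every test costs one unit. The
  expressions occurring in a fixed program have bounded size, so counting their operators instead
  would change running times by a constant factor only. There is no multiplication, so the uniform
  cost measure cannot be exploited to do bulk computation on rapidly growing numbers.

  A scalar variable is an array cell with constant index. The arrays other than \<open>Work k\<close> are the
  interface to the environment.
\<close>

datatype arr = Size | Lower | Upper | Decision | Conflict | Value nat | Work nat

type_synonym store = "arr \<Rightarrow> nat \<Rightarrow> nat"

datatype aexp = Const nat | Get arr aexp | Plus aexp aexp | Minus aexp aexp
datatype bexp = Less aexp aexp | Equal aexp aexp | BNot bexp | BAnd bexp bexp

datatype com =
    Skip
  | Put arr aexp aexp
  | Seq com com
  | Cond bexp com com
  | While bexp com

fun aval :: "aexp \<Rightarrow> store \<Rightarrow> nat" where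
  "aval (Const k) s = k"
| "aval (Get x e) s = s x (aval e s)"
| "aval (Plus e f) s = aval e s + aval f s"
| "aval (Minus e f) s = aval e s - aval f s"

fun bval :: "bexp \<Rightarrow> store \<Rightarrow> bool" where
  "bval (Less e f) s \<longleftrightarrow> aval e s < aval f s"
| "bval (Equal e f) s \<longleftrightarrow> aval e s = aval f s"
| "bval (BNot b) s \<longleftrightarrow> \<not> bval b s"
| "bval (BAnd b c) s \<longleftrightarrow> bval b s \<and> bval c s"

text \<open>\<open>exec c s t s'\<close>: program \<open>c\<close>, started in store \<open>s\<close>, halts after \<open>t\<close> steps in store \<open>s'\<close>.\<close>

inductive exec :: "com \<Rightarrow> store \<Rightarrow> nat \<Rightarrow> store \<Rightarrow> bool" where
  Skip: "exec Skip s 1 s"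
| Put: "exec (Put x i e) s 1 (s(x := (s x)(aval i s := aval e s)))"
| Seq: "exec c s t s' \<Longrightarrow> exec c' s' t' s'' \<Longrightarrow> exec (Seq c c') s (t + t') s''"
| CondTrue: "bval b s \<Longrightarrow> exec c s t s' \<Longrightarrow> exec (Cond b c c') s (t + 1) s'"
| CondFalse: "\<not> bval b s \<Longrightarrow> exec c' s t s' \<Longrightarrow> exec (Cond b c c') s (t + 1) s'"
| WhileFalse: "\<not> bval b s \<Longrightarrow> exec (While b c) s 1 s"
| WhileTrue: "bval b s \<Longrightarrow> exec c s t s' \<Longrightarrow> exec (While b c) s' t' s'' \<Longrightarrow>
    exec (While b c) s (t + t' + 1) s''"


section \<open>Implementing unit-propagation down a branch\<close>

text \<open>
  The machine receives \<open>n\<close>, \<open>d\<close> and the initial domains, in a store that is zero otherwise. It then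
  receives the decisions of the branch one at a time, each only after it has finished propagating
  the previous one. Whenever it halts, \<open>Conflict\<close> has to tell whether a conflict has occurred and,
  if not, the arrays \<open>Value k\<close> have to contain the fixpoint.
\<close>

definition input_store :: "nat \<Rightarrow> nat \<Rightarrow> (nat \<Rightarrow> nat) \<Rightarrow> (nat \<Rightarrow> nat) \<Rightarrow> store" where
  "input_store n d p q =
     (\<lambda>_ _. 0)
       (Size := (\<lambda>_. 0)(0 := n, 1 := d),
        Lower := (\<lambda>v. if v \<in> {1..n} then p v else 0),
        Upper := (\<lambda>v. if v \<in> {1..n} then q v else 0))"

fun atom_code :: "atom \<Rightarrow> nat list" where
  "atom_code (B v i) = [0, v, i, 0]"
| "atom_code (R v l u) = [1, v, l, u]"
| "atom_code Sat = [2, 0, 0, 0]"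
| "atom_code Violate = [3, 0, 0, 0]"
| "atom_code Bot = [4, 0, 0, 0]"

definition write_decision :: "atom \<Rightarrow> bool \<Rightarrow> store \<Rightarrow> store" where
  "write_decision a b s =
     s(Decision := (\<lambda>k. if k < 5 then (atom_code a @ [of_bool b]) ! k else 0))"

text \<open>
  \<open>(k, i, x) \<in> slots n d\<close> means that the truth value of \<open>x\<close> is to be found in \<open>Value k\<close> at index \<open>i\<close>.
  Every atom and every body of the program has a slot.
\<close>

definition index2 :: "nat \<Rightarrow> nat \<Rightarrow> nat \<Rightarrow> nat" where
  "index2 d v i = v * (d + 1) + i"

definition index3 :: "nat \<Rightarrow> nat \<Rightarrow> nat \<Rightarrow> nat \<Rightarrow> nat" where
  "index3 d v l u = (v * (d + 1) + l) * (d + 1) + u"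

definition slots :: "nat \<Rightarrow> nat \<Rightarrow> (nat \<times> nat \<times> obj) set" where
  "slots n d =
     {(0, 0, Atom Bot), (0, 1, Atom Sat), (0, 2, Atom Violate),
      (0, 3, Body (Conj {})), (0, 4, Body (Conj {Neg Violate})), (0, 5, Body (Conj {Neg Sat}))} \<union>
     {(1, index2 d v i, Atom (B v i)) | v i. v \<in> {1..n} \<and> i \<in> {1..d}} \<union>
     {(2, index3 d v l u, Atom (R v l u)) | v l u. v \<in> {1..n} \<and> 1 \<le> l \<and> l \<le> u \<and> u \<le> d} \<union>
     {(3, index2 d l u, Body (hall_body n l u)) | l u. 1 \<le> l \<and> l \<le> u \<and> u \<le> d} \<union>
     {(4, index2 d v i, Body (order_body v i)) | v i. v \<in> {1..n} \<and> 1 \<le> i \<and> i < d} \<union>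
     {(5, v, Body (top_body d v)) | v. v \<in> {1..n}} \<union>
     {(6, index3 d v l u, Body (r_body v l u)) | v l u. v \<in> {1..n} \<and> 1 \<le> l \<and> l \<le> u \<and> u \<le> d} \<union>
     {(7, index3 d v l u, Body (lower_body v l u)) | v l u. v \<in> {1..n} \<and> 1 < l \<and> l \<le> u \<and> u \<le> d} \<union>
     {(8, index3 d v l u, Body (upper_body v l u)) | v l u. v \<in> {1..n} \<and> 1 \<le> l \<and> l \<le> u \<and> u \<le> d}"

definition value_code :: "assignment \<Rightarrow> obj \<Rightarrow> nat" where
  "value_code A x = (if (x, True) \<in> A then 1 else if (x, False) \<in> A then 2 else 0)"

definition represents :: "nat \<Rightarrow> nat \<Rightarrow> assignment set \<Rightarrow> store \<Rightarrow> assignment \<Rightarrow> bool" where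
  "represents n d N s A \<longleftrightarrow>
     (if conflict N A then s Conflict 0 = 1
      else s Conflict 0 = 0 \<and> (\<forall>(k, i, x)\<in>slots n d. s (Value k) i = value_code A x))"

text \<open>
  \<open>branch P A ds\<close>: from the fixpoint \<open>A\<close>, the decisions \<open>ds\<close> can be made one after the other. Initial
  segments of complete branches are included, so that bounds hold at any time down a branch.
\<close>

fun branch :: "program \<Rightarrow> assignment \<Rightarrow> (atom \<times> bool) list \<Rightarrow> bool" where
  "branch P A [] \<longleftrightarrow> True"
| "branch P A ((a, b) # ds) \<longleftrightarrow>
     \<not> conflict (nogoods P) A \<and> a \<in> atoms P \<and> (Atom a, True) \<notin> A \<and> (Atom a, False) \<notin> A \<and>
     branch P (up (nogoods P) (insert (Atom a, b) A)) ds"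

text \<open>
  \<open>runs n d P step A s ds t\<close>: started in store \<open>s\<close> at the fixpoint \<open>A\<close>, the machine processes the
  decisions \<open>ds\<close> by running \<open>step\<close> once for each of them, correctly and in \<open>t\<close> steps altogether.
\<close>

fun runs :: "nat \<Rightarrow> nat \<Rightarrow> program \<Rightarrow> com \<Rightarrow> assignment \<Rightarrow> store \<Rightarrow> (atom \<times> bool) list \<Rightarrow> nat \<Rightarrow> bool" where
  "runs n d P step A s [] t \<longleftrightarrow> represents n d (nogoods P) s A \<and> t = 0"
| "runs n d P step A s ((a, b) # ds) t \<longleftrightarrow>
     represents n d (nogoods P) s A \<and>
     (\<exists>s' t1 t2. exec step (write_decision a b s) t1 s' \<and>
        runs n d P step (up (nogoods P) (insert (Atom a, b) A)) s' ds t2 \<and> t = t1 + t2)"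

text \<open>
  Unit-propagation on the programs \<open>P n d\<close> can be implemented to run in \<open>O(f n d)\<close> down any branch.
  The programs \<open>start\<close> (setting up and propagating at the root) and \<open>step\<close> (propagating after a
  decision) do not depend on \<open>n\<close>, \<open>d\<close> or the branch. The time for \<open>start\<close> is included.
\<close>

definition up_time_down_branch :: "(nat \<Rightarrow> nat \<Rightarrow> program) \<Rightarrow> (nat \<Rightarrow> nat \<Rightarrow> nat) \<Rightarrow> bool" where
  "up_time_down_branch P f \<longleftrightarrow>
     (\<exists>start step K. \<forall>n d p q ds.
        1 \<le> n \<longrightarrow> 1 \<le> d \<longrightarrow> init_domains n d p q \<longrightarrow> branch (P n d) (root n (P n d) p q) ds \<longrightarrow>
        (\<exists>s t0 t. exec start (input_store n d p q) t0 s \<and>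
           runs n d (P n d) step (root n (P n d) p q) s ds t \<and>
           t0 + t \<le> K * f n d))"

end

theory Submission
  imports Defs
begin

text \<open>
  Unit-propagation is determined by the atoms \<open>b(v,i)\<close> and \<open>r(v,l,u)\<close>: all bodies are constant or, like
  that of \<open>r(v,l,u)\<close>, equivalent to their head. On these atoms it computes the least set of literals
  closed under a few rules (\<open>der\<close>), and a conflict occurs iff this set is inconsistent. The bounds read
  off a consistent closed set satisfy Hall's condition, and no bound of a variable lies in a tight
  interval unless the whole domain does; by Hall's theorem for intervals this is bound consistency.
  Conversely, every bound consistent choice of domains yields a consistent closed set.

  For the running time, set literals are kept on a stack. Processing \<open>b(v,i)\<close> means checking the \<open>d\<close>
  triples \<open>b(v,l-1), b(v,u), r(v,l,u)\<close> with \<open>l = i + 1\<close> or \<open>u = i\<close>; processing \<open>r(v,l,u)\<close> takes constant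
  time, except that a counter for \<open>[l,u]\<close> triggers one scan of all variables when the interval becomes
  full. As every atom is set at most once down a branch, the sum of these costs is a potential in
  \<open>O(n d\<^sup>2)\<close>.
\<close>

text \<open>Two discrepancies between the program and its core shape the statements. First,
  \<open>up\<close> continues past a conflict, where its result no longer mirrors the core; so
  equality with the core is claimed for conflict-free fixpoints only, and otherwise just that a
  conflict exists. Second, the program omits \<open>b(v,0)\<close>: an inference that would make it
  true appears there as a violated nogood, but in the core as a contradiction with a false sentinel,
  so that l = 1 is an ordinary case. Since the fixpoint has to be right after every decision, the
  algorithm is verified by an invariant that only speaks about literals already taken off the stack.
  Counters, in contrast, change as soon as an atom is set, so a scan may start before all its
  premises have been processed. It uses derived literals only, and it leaves every atom of its
  interval assigned, which is why one scan per interval is enough.\<close>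

definition cell :: "nat \<Rightarrow> nat \<Rightarrow> nat \<Rightarrow> nat \<Rightarrow> nat \<Rightarrow> bool" where
  "cell n d v l u \<longleftrightarrow> v \<in> {1..n} \<and> 1 \<le> l \<and> l \<le> u \<and> u \<le> d"

text \<open>These are the unit inferences that remain once \<open>Violate\<close> and
  \<open>Bot\<close>, and with them all constraint bodies, are false. \<open>hall\<close> asks for
  exactly u - l + 1 other variables, because together with v they form the u - l + 2 atoms of a
  nogood. For l = 1 the atom \<open>B v (l - 1)\<close> is the sentinel; \<open>prune_upper\<close>
  then contradicts it.\<close>

inductive der :: "nat \<Rightarrow> nat \<Rightarrow> (atom \<times> bool) set \<Rightarrow> atom \<times> bool \<Rightarrow> bool" for n d X where
  order_up: "v \<in> {1..n} \<Longrightarrow> i < d \<Longrightarrow> (B v i, True) \<in> X \<Longrightarrow> der n d X (B v (Suc i), True)"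
| order_down: "v \<in> {1..n} \<Longrightarrow> i < d \<Longrightarrow> (B v (Suc i), False) \<in> X \<Longrightarrow> der n d X (B v i, False)"
| outside_left: "cell n d v l u \<Longrightarrow> (B v (l - 1), True) \<in> X \<Longrightarrow> der n d X (R v l u, False)"
| outside_right: "cell n d v l u \<Longrightarrow> (B v u, False) \<in> X \<Longrightarrow> der n d X (R v l u, False)"
| inside: "cell n d v l u \<Longrightarrow> (B v (l - 1), False) \<in> X \<Longrightarrow> (B v u, True) \<in> X \<Longrightarrow>
    der n d X (R v l u, True)"
| lower: "cell n d v l u \<Longrightarrow> (R v l u, True) \<in> X \<Longrightarrow> der n d X (B v (l - 1), False)"
| upper: "cell n d v l u \<Longrightarrow> (R v l u, True) \<in> X \<Longrightarrow> der n d X (B v u, True)"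
| prune_lower: "cell n d v l u \<Longrightarrow> (R v l u, False) \<in> X \<Longrightarrow> (B v (l - 1), False) \<in> X \<Longrightarrow>
    der n d X (B v u, False)"
| prune_upper: "cell n d v l u \<Longrightarrow> (R v l u, False) \<in> X \<Longrightarrow> (B v u, True) \<in> X \<Longrightarrow>
    der n d X (B v (l - 1), True)"
| hall: "cell n d v l u \<Longrightarrow> S \<subseteq> {1..n} - {v} \<Longrightarrow> card S = Suc (u - l) \<Longrightarrow>
    (\<And>w. w \<in> S \<Longrightarrow> (R w l u, True) \<in> X) \<Longrightarrow> der n d X (R v l u, False)"

lemma der_mono: "der n d X e \<Longrightarrow> X \<subseteq> Y \<Longrightarrow> der n d Y e"
  by (induction rule: der.induct) (blast intro: der.intros)+

definition closed :: "nat \<Rightarrow> nat \<Rightarrow> (atom \<times> bool) set \<Rightarrow> bool" where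
  "closed n d X \<longleftrightarrow> (\<forall>e. der n d X e \<longrightarrow> e \<in> X)"

definition consistent :: "('a \<times> bool) set \<Rightarrow> bool" where
  "consistent X \<longleftrightarrow> (\<forall>x. \<not> ((x, True) \<in> X \<and> (x, False) \<in> X))"

definition cl :: "nat \<Rightarrow> nat \<Rightarrow> (atom \<times> bool) set \<Rightarrow> (atom \<times> bool) set" where
  "cl n d X = \<Inter>{Y. X \<subseteq> Y \<and> closed n d Y}"

lemma closedD: "closed n d X \<Longrightarrow> der n d X e \<Longrightarrow> e \<in> X"
  unfolding closed_def by blast

lemma subset_cl: "X \<subseteq> cl n d X"
  by (auto simp: cl_def)

lemma cl_least: "X \<subseteq> Y \<Longrightarrow> closed n d Y \<Longrightarrow> cl n d X \<subseteq> Y"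
  by (auto simp: cl_def)

text \<open>Rules are monotone, so what follows from the intersection also follows within each
  closed superset.\<close>

lemma closed_cl: "closed n d (cl n d X)"
  unfolding closed_def
proof (intro allI impI)
  fix e assume e: "der n d (cl n d X) e"
  show "e \<in> cl n d X"
    unfolding cl_def
  proof (rule InterI)
    fix Y assume "Y \<in> {Y. X \<subseteq> Y \<and> closed n d Y}"
    then have Y: "X \<subseteq> Y" "closed n d Y" by auto
    then show "e \<in> Y" using der_mono[OF e cl_least[OF Y]] closedD by blast
  qed
qed

lemma consistentD: "consistent X \<Longrightarrow> (x, b) \<in> X \<Longrightarrow> (x, \<not> b) \<notin> X"
  by (cases b) (auto simp: consistent_def)

lemma consistent_mono: "consistent Y \<Longrightarrow> X \<subseteq> Y \<Longrightarrow> consistent X"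
  by (auto simp: consistent_def)

definition core_atoms :: "nat \<Rightarrow> nat \<Rightarrow> atom set" where
  "core_atoms n d = {B v i | v i. v \<in> {1..n} \<and> i \<le> d} \<union> {R v l u | v l u. cell n d v l u}"

lemma core_atoms_iff [simp]:
  "B v i \<in> core_atoms n d \<longleftrightarrow> v \<in> {1..n} \<and> i \<le> d"
  "R v l u \<in> core_atoms n d \<longleftrightarrow> cell n d v l u"
  "Bot \<notin> core_atoms n d" "Sat \<notin> core_atoms n d" "Violate \<notin> core_atoms n d"
  by (auto simp: core_atoms_def)

lemma der_core: "der n d X e \<Longrightarrow> fst e \<in> core_atoms n d"
  by (erule der.cases) (auto simp: cell_def)

lemma cl_core: "fst ` X \<subseteq> core_atoms n d \<Longrightarrow> fst ` cl n d X \<subseteq> core_atoms n d"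
proof -
  assume X: "fst ` X \<subseteq> core_atoms n d"
  have "closed n d {e. fst e \<in> core_atoms n d}"
    by (auto simp: closed_def dest: der_core)
  then have "cl n d X \<subseteq> {e. fst e \<in> core_atoms n d}"
    using X by (intro cl_least) auto
  then show ?thesis by auto
qed

section \<open>Hall's condition for intervals\<close>

definition inside_set :: "nat set \<Rightarrow> (nat \<Rightarrow> nat) \<Rightarrow> (nat \<Rightarrow> nat) \<Rightarrow> nat \<Rightarrow> nat \<Rightarrow> nat set" where
  "inside_set V L U l u = {w \<in> V. l \<le> L w \<and> U w \<le> u}"

definition hall_cond :: "nat set \<Rightarrow> (nat \<Rightarrow> nat) \<Rightarrow> (nat \<Rightarrow> nat) \<Rightarrow> bool" where
  "hall_cond V L U \<longleftrightarrow> (\<forall>l u. l \<le> u \<longrightarrow> card (inside_set V L U l u) \<le> Suc u - l)"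

lemma finite_inside [simp]: "finite V \<Longrightarrow> finite (inside_set V L U l u)"
  by (simp add: inside_set_def)

text \<open>Narrowing the interval of one variable \<open>v\<close> at a time: if neither \<open>[L v, L v]\<close> nor
  \<open>[L v + 1, U v]\<close> preserved the condition, there would be tight intervals \<open>[a, b]\<close> and \<open>[c, e]\<close>
  on both sides, which overlap or are adjacent, and their union would be overfull because it
  contains \<open>v\<close> as well.\<close>

lemma hall_cond_narrow:
  assumes V: "finite V" and v: "v \<in> V" and lt: "L v < U v" and le: "\<forall>w\<in>V. L w \<le> U w"
    and H: "hall_cond V L U"
  shows "hall_cond V L (U(v := L v)) \<or> hall_cond V (L(v := Suc (L v))) U"
proof (rule ccontr)
  assume "\<not> ?thesis"
  then obtain a b c e where
    ab: "a \<le> b" "card (inside_set V L (U(v := L v)) a b) > Suc b - a" and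
    ce: "c \<le> e" "card (inside_set V (L(v := Suc (L v))) U c e) > Suc e - c"
    unfolding hall_cond_def by (auto simp: not_le)
  let ?I = "\<lambda>l u. inside_set (V - {v}) L U l u"
  have Hle: "card (inside_set V L U l u) \<le> Suc u - l" if "l \<le> u" for l u
    using H that by (auto simp: hall_cond_def)
  have sub: "card (?I l u) \<le> card (inside_set V L U l u)" for l u
    using V by (intro card_mono) (auto simp: inside_set_def)
  have v1: "a \<le> L v" "L v \<le> b"
  proof -
    have "v \<in> inside_set V L (U(v := L v)) a b"
    proof (rule ccontr)
      assume "\<not> ?thesis"
      then have "inside_set V L (U(v := L v)) a b \<subseteq> inside_set V L U a b"
        by (auto simp: inside_set_def split: if_splits)
      then have "card (inside_set V L (U(v := L v)) a b) \<le> card (inside_set V L U a b)"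
        using V by (intro card_mono) auto
      with ab Hle show False by (meson leD le_trans)
    qed
    then show "a \<le> L v" "L v \<le> b" by (auto simp: inside_set_def)
  qed
  have v2: "c \<le> Suc (L v)" "U v \<le> e"
  proof -
    have "v \<in> inside_set V (L(v := Suc (L v))) U c e"
    proof (rule ccontr)
      assume "\<not> ?thesis"
      then have "inside_set V (L(v := Suc (L v))) U c e \<subseteq> inside_set V L U c e"
        by (auto simp: inside_set_def split: if_splits)
      then have "card (inside_set V (L(v := Suc (L v))) U c e) \<le> card (inside_set V L U c e)"
        using V by (intro card_mono) auto
      with ce Hle show False by (meson leD le_trans)
    qed
    then show "c \<le> Suc (L v)" "U v \<le> e" by (auto simp: inside_set_def)
  qed
  have "inside_set V L (U(v := L v)) a b \<subseteq> insert v (?I a b)"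
    by (auto simp: inside_set_def split: if_splits)
  then have "card (inside_set V L (U(v := L v)) a b) \<le> card (insert v (?I a b))"
    using V by (intro card_mono) auto
  also have "\<dots> = Suc (card (?I a b))"
    using V by (subst card_insert_disjoint) (auto simp: inside_set_def)
  finally have tab: "card (?I a b) \<ge> Suc b - a" using ab by simp
  have "inside_set V (L(v := Suc (L v))) U c e \<subseteq> insert v (?I c e)"
    by (auto simp: inside_set_def split: if_splits)
  then have "card (inside_set V (L(v := Suc (L v))) U c e) \<le> card (insert v (?I c e))"
    using V by (intro card_mono) auto
  also have "\<dots> = Suc (card (?I c e))"
    using V by (subst card_insert_disjoint) (auto simp: inside_set_def)
  finally have tce: "card (?I c e) \<ge> Suc e - c" using ce by simp
  \<comment> \<open>\<open>tab\<close> counts without v. If \<open>[a, b]\<close> contained all of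
    \<open>[L v, U v]\<close>, then v would make it overfull for the original bounds; so b falls
    short of \<open>U v\<close>. In the same way c cannot lie below \<open>L v + 1\<close>.\<close>
  have bU: "b < U v"
  proof (rule ccontr)
    assume "\<not> b < U v"
    then have "insert v (?I a b) \<subseteq> inside_set V L U a b"
      using v v1 by (auto simp: inside_set_def)
    then have "card (insert v (?I a b)) \<le> card (inside_set V L U a b)"
      using V by (intro card_mono) auto
    also have "card (insert v (?I a b)) = Suc (card (?I a b))"
      using V by (subst card_insert_disjoint) (auto simp: inside_set_def)
    finally show False using tab Hle[OF ab(1)] by simp
  qed
  have cL: "c = Suc (L v)"
  proof (rule ccontr)
    assume "\<not> c = Suc (L v)"
    then have "insert v (?I c e) \<subseteq> inside_set V L U c e"
      using v v2 by (auto simp: inside_set_def)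
    then have "card (insert v (?I c e)) \<le> card (inside_set V L U c e)"
      using V by (intro card_mono) auto
    also have "card (insert v (?I c e)) = Suc (card (?I c e))"
      using V by (subst card_insert_disjoint) (auto simp: inside_set_def)
    finally show False using tce Hle[OF ce(1)] by simp
  qed
  \<comment> \<open>For b = \<open>L v\<close> the two intervals are merely adjacent. Then
    \<open>Suc b - c\<close> is 0, and a variable inside both would have its lower bound above its
    upper bound.\<close>
  have int: "card (?I a b \<inter> ?I c e) \<le> Suc b - c"
  proof (cases "c \<le> b")
    case True
    have "card (?I a b \<inter> ?I c e) \<le> card (inside_set V L U c b)"
      using V by (intro card_mono) (auto simp: inside_set_def)
    then show ?thesis using Hle[OF True] by linarith
  next
    case False
    have "?I a b \<inter> ?I c e = {}"
      using False le by (fastforce simp: inside_set_def)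
    then show ?thesis by simp
  qed
  have "insert v (?I a b \<union> ?I c e) \<subseteq> inside_set V L U a e"
    using v v1 v2 bU cL by (auto simp: inside_set_def)
  then have "card (insert v (?I a b \<union> ?I c e)) \<le> card (inside_set V L U a e)"
    using V by (intro card_mono) auto
  also have "\<dots> \<le> Suc e - a" using v1 v2 lt by (intro Hle) simp
  also have "card (insert v (?I a b \<union> ?I c e)) = Suc (card (?I a b \<union> ?I c e))"
    using V by (subst card_insert_disjoint) (auto simp: inside_set_def)
  finally have "Suc (card (?I a b \<union> ?I c e)) \<le> Suc e - a" .
  moreover have "card (?I a b) + card (?I c e) =
      card (?I a b \<union> ?I c e) + card (?I a b \<inter> ?I c e)"
    using V by (intro card_Un_Int) auto
  ultimately show False using int tab tce v1 v2 bU cL lt by linarith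
qed

text \<open>Induction on the total slack of the intervals: narrowing some interval preserves the
  condition, and once all intervals are points, the condition for singletons \<open>[x, x]\<close>
  says that no two points coincide.\<close>

lemma hall_cond_matching:
  assumes "finite V" "\<forall>w\<in>V. L w \<le> U w" "hall_cond V L U"
  shows "\<exists>t. inj_on t V \<and> (\<forall>w\<in>V. L w \<le> t w \<and> t w \<le> U w)"
  using assms
proof (induction "\<Sum>w\<in>V. U w - L w" arbitrary: L U rule: less_induct)
  case less
  show ?case
  proof (cases "\<forall>w\<in>V. L w = U w")
    case True
    have "inj_on L V"
    proof (rule inj_onI, rule ccontr)
      fix x y assume xy: "x \<in> V" "y \<in> V" "L x = L y" "x \<noteq> y"
      then have "{x, y} \<subseteq> inside_set V L U (L x) (L x)" using True by (auto simp: inside_set_def)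
      then have "card {x, y} \<le> card (inside_set V L U (L x) (L x))"
        using less.prems(1) by (intro card_mono) auto
      also have "\<dots> \<le> Suc (L x) - L x" using less.prems(3) unfolding hall_cond_def by blast
      finally show False using xy by simp
    qed
    then show ?thesis using True by (intro exI[of _ L]) auto
  next
    case False
    then obtain v where v: "v \<in> V" "L v < U v" using less.prems(2) by (metis order_le_less)
    consider "hall_cond V L (U(v := L v))" | "hall_cond V (L(v := Suc (L v))) U"
      using hall_cond_narrow[where L = L and U = U] less.prems v by blast
    then show ?thesis
    proof cases
      case 1
      have "(\<Sum>w\<in>V. (U(v := L v)) w - L w) < (\<Sum>w\<in>V. U w - L w)"
        using v less.prems(1) by (intro sum_strict_mono_ex1) auto
      moreover have "\<forall>w\<in>V. L w \<le> (U(v := L v)) w" using less.prems(2) by auto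
      ultimately obtain t where t: "inj_on t V" "\<forall>w\<in>V. L w \<le> t w \<and> t w \<le> (U(v := L v)) w"
        using less.hyps less.prems(1) 1 by blast
      moreover have "t w \<le> U w" if "w \<in> V" for w
        using t that v by (cases "w = v") fastforce+
      ultimately show ?thesis by blast
    next
      case 2
      have "(\<Sum>w\<in>V. U w - (L(v := Suc (L v))) w) < (\<Sum>w\<in>V. U w - L w)"
        using v less.prems(1) by (intro sum_strict_mono_ex1) auto
      moreover have "\<forall>w\<in>V. (L(v := Suc (L v))) w \<le> U w" using less.prems(2) v by auto
      ultimately obtain t where t: "inj_on t V" "\<forall>w\<in>V. (L(v := Suc (L v))) w \<le> t w \<and> t w \<le> U w"
        using less.hyps less.prems(1) 2 by blast
      moreover have "L w \<le> t w" if "w \<in> V" for w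
        using t that v by (cases "w = v") fastforce+
      ultimately show ?thesis by blast
    qed
  qed
qed

section \<open>Unit-propagation on the program in terms of its core\<close>

definition unit_closed :: "assignment set \<Rightarrow> assignment \<Rightarrow> bool" where
  "unit_closed N A \<longleftrightarrow> (\<forall>\<delta>\<in>N. \<forall>x\<in>\<delta>. \<delta> - {x} \<subseteq> A \<longrightarrow> compl x \<in> A)"

lemma unit_closedD:
  "unit_closed N A \<Longrightarrow> \<delta> \<in> N \<Longrightarrow> x \<in> \<delta> \<Longrightarrow> \<delta> - {x} \<subseteq> A \<Longrightarrow> compl x \<in> A"
  unfolding unit_closed_def by blast

lemma unit_closed_up: "unit_closed N (up N A)"
  unfolding unit_closed_def by (blast intro: up.unit)

lemma up_least:
  assumes "A \<subseteq> Y" "unit_closed N Y"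
  shows "up N A \<subseteq> Y"
proof
  fix x assume "x \<in> up N A"
  then show "x \<in> Y"
  proof induction
    case (start x)
    then show ?case using assms by blast
  next
    case (unit \<delta> x)
    then show ?case by (intro unit_closedD[OF assms(2)]) blast+
  qed
qed

lemma subset_up: "A \<subseteq> up N A"
  by (blast intro: up.start)

lemma compl_compl [simp]: "compl (compl x) = x"
  by (cases x) simp

lemma compl_neq [simp]: "x \<noteq> compl x"
  by (cases x) simp

lemma consistent_compl: "consistent A \<Longrightarrow> x \<in> A \<Longrightarrow> compl x \<notin> A"
  by (cases x) (auto dest: consistentD)

text \<open>One of two opposite literals was derived rather than given. The nogood that produced it
  has all its other elements assigned, and its last element is the opposite literal, so the whole
  nogood holds.\<close>

lemma inconsistent_up_conflict:
  assumes "consistent A" "\<not> consistent (up N A)"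
  shows "conflict N (up N A)"
proof -
  obtain x where x: "(x, True) \<in> up N A" "(x, False) \<in> up N A"
    using assms(2) by (auto simp: consistent_def)
  obtain y where y: "y \<in> up N A" "compl y \<in> up N A" "y \<notin> A"
  proof (cases "(x, True) \<in> A")
    case True
    then have "(x, False) \<notin> A" using assms(1) by (auto simp: consistent_def)
    then show ?thesis using that[of "(x, False)"] x by simp
  next
    case False
    then show ?thesis using that[of "(x, True)"] x by simp
  qed
  from y(1) obtain \<delta> z where \<delta>: "\<delta> \<in> N" "z \<in> \<delta>" "\<delta> - {z} \<subseteq> up N A" "y = compl z"
    using y(3) by (cases rule: up.cases) blast+
  then have "\<delta> \<subseteq> up N A" using y(2) by auto
  then show ?thesis using \<delta>(1) by (auto simp: conflict_def)
qed

text \<open>In a nogood that holds entirely, any element also has its complement derived.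
  Nonemptiness provides such an element.\<close>

lemma consistent_no_conflict:
  assumes "unit_closed N A" "consistent A" "\<And>\<delta>. \<delta> \<in> N \<Longrightarrow> \<delta> \<noteq> {}"
  shows "\<not> conflict N A"
proof
  assume "conflict N A"
  then obtain \<delta> where \<delta>: "\<delta> \<in> N" "\<delta> \<subseteq> A" by (auto simp: conflict_def)
  then obtain x where "x \<in> \<delta>" using assms(3) by blast
  then show False using unit_closedD[OF assms(1) \<delta>(1)] \<delta> consistent_compl[OF assms(2)] by blast
qed

text \<open>A nogood with a false element y is inert: all of its elements but x can hold only if x
  is y, and then the inference yields what is known already.\<close>

lemma unit_satisfied:
  assumes "consistent A" "y \<in> \<delta>" "compl y \<in> A" "\<delta> - {x} \<subseteq> A"
  shows "compl x \<in> A"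
proof (cases "x = y")
  case False
  then have "y \<in> A" using assms by blast
  then show ?thesis using consistent_compl assms by blast
qed (use assms in simp)

lemma body_nogoods_subset: "Rule h \<beta> \<in> P \<Longrightarrow> body_nogoods \<beta> \<subseteq> nogoods P"
  unfolding nogoods_def bodies_def by blast

lemma head_nogood: "Rule (Head h) \<beta> \<in> P \<Longrightarrow> {(Body \<beta>, True), (Atom h, False)} \<in> nogoods P"
  unfolding nogoods_def by blast

lemma Bot_nogood: "{(Atom Bot, True)} \<in> nogoods P"
  unfolding nogoods_def by blast

lemma conj_nogood: "Rule h (Conj L) \<in> P \<Longrightarrow> insert (Body (Conj L), False) (holds ` L) \<in> nogoods P"
  using body_nogoods_subset[of h "Conj L"] by auto

lemma conj_nogood': "Rule h (Conj L) \<in> P \<Longrightarrow> l \<in> L \<Longrightarrow>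
    {(Body (Conj L), True), compl (holds l)} \<in> nogoods P"
  using body_nogoods_subset[of h "Conj L"] by auto

lemma holds_inj [simp]: "holds l = holds l' \<longleftrightarrow> l = l'"
  by (cases l; cases l') auto

context
  fixes P A
  assumes A: "unit_closed (nogoods P) A"
begin

lemma Bot_false: "(Atom Bot, False) \<in> A"
  using unit_closedD[OF A Bot_nogood, of "(Atom Bot, True)"] by simp

lemma head_false: "Rule (Head h) \<beta> \<in> P \<Longrightarrow> (Atom h, False) \<in> A \<Longrightarrow> (Body \<beta>, False) \<in> A"
  using unit_closedD[OF A head_nogood, of h \<beta> "(Body \<beta>, True)"] by auto

lemma head_true: "Rule (Head h) \<beta> \<in> P \<Longrightarrow> (Body \<beta>, True) \<in> A \<Longrightarrow> (Atom h, True) \<in> A"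
  using unit_closedD[OF A head_nogood, of h \<beta> "(Atom h, False)"] by auto

lemma conj_true: "Rule h (Conj L) \<in> P \<Longrightarrow> holds ` L \<subseteq> A \<Longrightarrow> (Body (Conj L), True) \<in> A"
  using unit_closedD[OF A conj_nogood, of h L "(Body (Conj L), False)"] by auto

lemma conj_lit_true: "Rule h (Conj L) \<in> P \<Longrightarrow> l \<in> L \<Longrightarrow> (Body (Conj L), True) \<in> A \<Longrightarrow> holds l \<in> A"
  using unit_closedD[OF A conj_nogood', of h L l "compl (holds l)"] by auto

lemma conj_false: 
  assumes "Rule h (Conj L) \<in> P" "l \<in> L" "(Body (Conj L), False) \<in> A" "holds ` (L - {l}) \<subseteq> A"
  shows "compl (holds l) \<in> A"
  using unit_closedD[OF A conj_nogood[OF assms(1)], of "holds l"] assms by auto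

lemma constraint:
  assumes "Rule (Head Bot) (Conj L) \<in> P" "l \<in> L" "holds ` (L - {l}) \<subseteq> A"
  shows "compl (holds l) \<in> A"
  using conj_false assms head_false[OF assms(1) Bot_false] by blast

end

section \<open>Constant literals, and the extension of a core to all atoms and bodies\<close>

definition fixed_true :: "obj set" where
  "fixed_true = {Atom Sat, Body (Conj {}), Body (Conj {Neg Violate})}"

text \<open>All bodies listed here belong to rules with head \<open>Violate\<close> or
  \<open>Bot\<close>, which are false from the beginning.\<close>

definition fixed_false :: "nat \<Rightarrow> nat \<Rightarrow> obj set" where
  "fixed_false n d =
     {Atom Bot, Atom Violate, Body (Conj {Neg Sat})} \<union>
     {Body (hall_body n l u) | l u. 1 \<le> l \<and> l \<le> u \<and> u \<le> d} \<union>
     {Body (order_body v i) | v i. v \<in> {1..n} \<and> 1 \<le> i \<and> i < d} \<union>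
     {Body (top_body d v) | v. v \<in> {1..n}} \<union>
     {Body (lower_body v l u) | v l u. cell n d v l u \<and> 1 < l} \<union>
     {Body (upper_body v l u) | v l u. cell n d v l u}"

text \<open>The atoms \<open>b(v,0)\<close>, which do not occur in the program, serve as false sentinels in the core.\<close>

definition core_of :: "nat \<Rightarrow> assignment \<Rightarrow> (atom \<times> bool) set" where
  "core_of n A = {(a, b). (Atom a, b) \<in> A \<and> (\<forall>v. a \<noteq> B v 0)} \<union> {(B v 0, False) | v. v \<in> {1..n}}"

text \<open>Candidate for the fixpoint: each r-body takes over the value of its atom, everything
  else outside the core is constant.\<close>

definition full :: "nat \<Rightarrow> nat \<Rightarrow> (atom \<times> bool) set \<Rightarrow> assignment" where
  "full n d X =
     {(Atom a, b) | a b. (a, b) \<in> X \<and> (\<forall>v. a \<noteq> B v 0)} \<union>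
     {(Body (r_body v l u), b) | v l u b. cell n d v l u \<and> (R v l u, b) \<in> X} \<union>
     fixed_true \<times> {True} \<union> fixed_false n d \<times> {False}"

lemmas body_defs = hall_body_def order_body_def top_body_def r_body_def lower_body_def upper_body_def
  not_b_def

text \<open>A body is identified by its literals alone, whatever rule it comes from. Copying the
  values of r-atoms to r-bodies therefore makes sense only if distinct cells have distinct
  bodies.\<close>

lemma r_body_inj:
  "cell n d v l u \<Longrightarrow> cell n d v' l' u' \<Longrightarrow> r_body v l u = r_body v' l' u' \<longleftrightarrow> v = v' \<and> l = l' \<and> u = u'"
  by (auto simp: r_body_def not_b_def cell_def doubleton_eq_iff split: if_splits)

text \<open>The delicate case is \<open>order_body v u\<close>, which equals
  \<open>r_body v l u\<close> for l = u + 2; in a cell, l \<le> u excludes this.\<close>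

lemma r_body_not_fixed:
  assumes "cell n d v l u"
  shows "Body (r_body v l u) \<notin> fixed_true" "Body (r_body v l u) \<notin> fixed_false n d"
  using assms by (auto simp: fixed_true_def fixed_false_def body_defs cell_def doubleton_eq_iff
      split: if_splits)

lemma fixed_disjoint: "x \<in> fixed_true \<Longrightarrow> x \<notin> fixed_false n d"
  by (auto simp: fixed_true_def fixed_false_def body_defs)

lemma full_Atom:
  assumes "fst ` X \<subseteq> core_atoms n d"
  shows "(Atom a, b) \<in> full n d X \<longleftrightarrow>
    (a, b) \<in> X \<and> (\<forall>v. a \<noteq> B v 0) \<or> a = Sat \<and> b \<or> a \<in> {Bot, Violate} \<and> \<not> b"
  by (auto simp: full_def fixed_true_def fixed_false_def)

lemma full_r_body:
  assumes "cell n d v l u"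
  shows "(Body (r_body v l u), b) \<in> full n d X \<longleftrightarrow> (R v l u, b) \<in> X"
  using r_body_not_fixed[OF assms] r_body_inj[OF assms] assms
  unfolding full_def by blast

lemma full_fixed:
  shows "x \<in> fixed_true \<Longrightarrow> (x, True) \<in> full n d X"
    and "x \<in> fixed_false n d \<Longrightarrow> (x, False) \<in> full n d X"
  by (auto simp: full_def)

lemma consistent_full:
  assumes "consistent X" "fst ` X \<subseteq> core_atoms n d"
  shows "consistent (full n d X)"
  unfolding consistent_def
proof (intro allI notI)
  fix x assume x: "(x, True) \<in> full n d X \<and> (x, False) \<in> full n d X"
  show False
  proof (cases "\<exists>v l u. cell n d v l u \<and> x = Body (r_body v l u)")
    case True
    then show False using x full_r_body assms(1) by (auto simp: consistent_def)
  next
    case False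
    show False
    proof (cases x)
      case (Atom a)
      then show ?thesis using x full_Atom[OF assms(2)] assms
        by (auto simp: consistent_def)
    next
      case (Body \<beta>)
      then have "x \<in> fixed_true" "x \<in> fixed_false n d" using x False by (auto simp: full_def)
      then show False using fixed_disjoint by blast
    qed
  qed
qed

lemma alldiff_rules:
  "Rule (Head Sat) (Conj {Neg Violate}) \<in> alldiff_program n d"
  "Rule (Head Violate) (Conj {Neg Sat}) \<in> alldiff_program n d"
  "1 \<le> l \<Longrightarrow> l \<le> u \<Longrightarrow> u \<le> d \<Longrightarrow> Rule (Head Violate) (hall_body n l u) \<in> alldiff_program n d"
  "v \<in> {1..n} \<Longrightarrow> Rule (Choice (B v ` {1..d})) (Conj {}) \<in> alldiff_program n d"
  "v \<in> {1..n} \<Longrightarrow> 1 \<le> i \<Longrightarrow> i < d \<Longrightarrow> Rule (Head Bot) (order_body v i) \<in> alldiff_program n d"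
  "v \<in> {1..n} \<Longrightarrow> Rule (Head Bot) (top_body d v) \<in> alldiff_program n d"
  "cell n d v l u \<Longrightarrow> Rule (Head (R v l u)) (r_body v l u) \<in> alldiff_program n d"
  "cell n d v l u \<Longrightarrow> 1 < l \<Longrightarrow> Rule (Head Bot) (lower_body v l u) \<in> alldiff_program n d"
  "cell n d v l u \<Longrightarrow> Rule (Head Bot) (upper_body v l u) \<in> alldiff_program n d"
  unfolding alldiff_program_def reification_rules_def cell_def by blast+

lemma alldiff_rule_cases:
  assumes "Rule h \<beta> \<in> alldiff_program n d"
  obtains "h = Head Sat" "\<beta> = Conj {Neg Violate}"
  | "h = Head Violate" "\<beta> = Conj {Neg Sat}"
  | l u where "1 \<le> l" "l \<le> u" "u \<le> d" "h = Head Violate" "\<beta> = hall_body n l u"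
  | v where "v \<in> {1..n}" "h = Choice (B v ` {1..d})" "\<beta> = Conj {}"
  | v i where "v \<in> {1..n}" "1 \<le> i" "i < d" "h = Head Bot" "\<beta> = order_body v i"
  | v where "v \<in> {1..n}" "h = Head Bot" "\<beta> = top_body d v"
  | v l u where "cell n d v l u" "h = Head (R v l u)" "\<beta> = r_body v l u"
  | v l u where "cell n d v l u" "1 < l" "h = Head Bot" "\<beta> = lower_body v l u"
  | v l u where "cell n d v l u" "h = Head Bot" "\<beta> = upper_body v l u"
proof -
  from assms show ?thesis
    unfolding alldiff_program_def
    apply (elim UnE)
    subgoal using that(1,2) by (auto simp: reification_rules_def)
    subgoal using that(3) by blast
    subgoal using that(4) by blast
    subgoal using that(5) by blast
    subgoal using that(6) by blast
    subgoal using that(7) unfolding cell_def by blast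
    subgoal using that(8) unfolding cell_def by (auto simp: less_imp_le)
    subgoal using that(9) unfolding cell_def by blast
    done
qed

lemma atoms_alldiff:
  assumes "a \<in> atoms (alldiff_program n d)" "1 \<le> d"
  shows "a \<in> {Bot, Sat, Violate} \<or> a \<in> core_atoms n d \<and> (\<forall>v. a \<noteq> B v 0)"
proof -
  obtain h \<beta> where "Rule h \<beta> \<in> alldiff_program n d"
    and a: "a \<in> head_atoms h \<or> a \<in> lit_atom ` body_lits \<beta>"
    using assms by (auto simp: atoms_def)
  then show ?thesis
    using a assms(2)
    by (cases rule: alldiff_rule_cases) (auto simp: body_defs cell_def split: if_splits)
qed

lemma R_in_atoms: "cell n d v l u \<Longrightarrow> R v l u \<in> atoms (alldiff_program n d)"
  unfolding atoms_def using alldiff_rules(7)[of n d v l u] by fastforce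

lemma R_support:
  assumes "cell n d v l u"
  shows "{\<beta>. \<exists>h. Rule h \<beta> \<in> alldiff_program n d \<and> R v l u \<in> head_atoms h} = {r_body v l u}"
  using alldiff_rules(7)[OF assms] by (fastforce elim: alldiff_rule_cases)

text \<open>Only one body can support an r-atom, so its support nogood is binary. Together with the
  head nogood this makes atom and body equivalent under propagation.\<close>

lemma R_support_nogood:
  assumes "cell n d v l u"
  shows "{(Atom (R v l u), True), (Body (r_body v l u), False)} \<in> nogoods (alldiff_program n d)"
proof -
  have "{(Atom (R v l u), True)} \<union>
      {(Body \<beta>, False) | \<beta>. \<exists>h. Rule h \<beta> \<in> alldiff_program n d \<and> R v l u \<in> head_atoms h}
      \<in> nogoods (alldiff_program n d)"
    using R_in_atoms[OF assms] unfolding nogoods_def by blast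
  also have "{(Body \<beta>, False) | \<beta>. \<exists>h. Rule h \<beta> \<in> alldiff_program n d \<and> R v l u \<in> head_atoms h} =
      {(Body (r_body v l u), False)}"
    using R_support[OF assms] by blast
  finally show ?thesis by (simp add: insert_commute)
qed

lemma nogoods_nonempty: "\<delta> \<in> nogoods P \<Longrightarrow> \<delta> \<noteq> {}"
proof -
  assume "\<delta> \<in> nogoods P"
  moreover have "\<delta> \<noteq> {}" if "\<delta> \<in> body_nogoods \<beta>" for \<beta>
    using that by (cases \<beta>) auto
  ultimately show ?thesis by (auto simp: nogoods_def)
qed

lemma core_of_B: "(B v i, b) \<in> core_of n A \<longleftrightarrow>
    (if i = 0 then v \<in> {1..n} \<and> \<not> b else (Atom (B v i), b) \<in> A)"
  by (auto simp: core_of_def)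

lemma core_of_R: "(R v l u, b) \<in> core_of n A \<longleftrightarrow> (Atom (R v l u), b) \<in> A"
  by (auto simp: core_of_def)

lemma hall_nogood:
  assumes "cell n d v l u" "S \<subseteq> {1..n} - {v}" "card S = Suc (u - l)"
  shows "insert (Body (hall_body n l u), False) ((\<lambda>w. (Atom (R w l u), True)) ` insert v S)
    \<in> nogoods (alldiff_program n d)"
proof -
  have "Rule (Head Violate) (hall_body n l u) \<in> alldiff_program n d"
    using assms(1) by (intro alldiff_rules) (auto simp: cell_def)
  then have sub: "body_nogoods (hall_body n l u) \<subseteq> nogoods (alldiff_program n d)"
    by (rule body_nogoods_subset)
  let ?T = "(\<lambda>w. Pos (R w l u)) ` insert v S"
  have "?T \<subseteq> (\<lambda>w. Pos (R w l u)) ` {1..n}" using assms by (auto simp: cell_def)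
  moreover have "card ?T = u - l + 2"
  proof -
    have "finite S" "v \<notin> S" using assms(2) finite_subset by auto
    then show ?thesis using assms(3) by (subst card_image) (auto simp: inj_on_def)
  qed
  ultimately have "{(Body (hall_body n l u), False)} \<union> holds ` ?T \<in> body_nogoods (hall_body n l u)"
    unfolding hall_body_def body_nogoods.simps by blast
  then show ?thesis using sub by (auto simp: image_image insert_commute)
qed

section \<open>From a closed assignment of the program to a closed core\<close>

context
  fixes n d A
  assumes A: "unit_closed (nogoods (alldiff_program n d)) A"
    and Violate: "(Atom Violate, False) \<in> A"
    and nd: "1 \<le> n" "1 \<le> d"
begin

lemma up_fixed_true: "x \<in> fixed_true \<Longrightarrow> (x, True) \<in> A"
proof -
  have 1: "(Body (Conj {Neg Violate}), True) \<in> A"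
    using conj_true[OF A alldiff_rules(1)] Violate by simp
  then have 2: "(Atom Sat, True) \<in> A" using head_true[OF A alldiff_rules(1)] by blast
  have "(Body (Conj {}), True) \<in> A"
    using conj_true[OF A alldiff_rules(4)[of 1]] nd by simp
  then show "x \<in> fixed_true \<Longrightarrow> (x, True) \<in> A" using 1 2 by (auto simp: fixed_true_def)
qed

lemma up_fixed_false:
  assumes "x \<in> fixed_false n d"
  shows "(x, False) \<in> A"
  using assms unfolding fixed_false_def
  by (blast intro: head_false[OF A] Violate Bot_false[OF A] alldiff_rules)

lemma up_r_body: "cell n d v l u \<Longrightarrow> (Atom (R v l u), b) \<in> A \<Longrightarrow> (Body (r_body v l u), b) \<in> A"
  using head_false[OF A alldiff_rules(7), of v l u]
    unit_closedD[OF A R_support_nogood, of v l u "(Body (r_body v l u), False)"]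
  by (cases b) auto

lemma up_top: "v \<in> {1..n} \<Longrightarrow> (Atom (B v d), True) \<in> A"
  using constraint[OF A alldiff_rules(6)[unfolded top_body_def], of v "Neg (B v d)"] by simp

text \<open>Each rule of \<open>der\<close> is a short chain of unit inferences; those from an
  r-atom to its bounds pass through its body. The absence of a conflict matters at the sentinel
  only.\<close>

lemma closed_core_of:
  assumes nc: "\<not> conflict (nogoods (alldiff_program n d)) A"
  shows "closed n d (core_of n A)"
  unfolding closed_def
proof (intro allI impI)
  fix e assume "der n d (core_of n A) e"
  then show "e \<in> core_of n A"
  proof cases
    case (order_up v i)
    then have i: "1 \<le> i" "(Atom (B v i), True) \<in> A" by (auto simp: insert_Diff_if core_of_B split: if_splits)
    then show ?thesis
      using constraint[OF A alldiff_rules(5)[unfolded order_body_def], of v i "Neg (B v (i + 1))"] order_up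
      by (auto simp: insert_Diff_if core_of_B)
  next
    case (order_down v i)
    then show ?thesis
      using constraint[OF A alldiff_rules(5)[unfolded order_body_def], of v i "Pos (B v i)"]
      by (cases "i = 0") (auto simp: insert_Diff_if core_of_B)
  next
    case (outside_left v l u)
    then have "1 < l" by (auto simp: insert_Diff_if core_of_B cell_def split: if_splits)
    then show ?thesis
      using constraint[OF A alldiff_rules(8)[unfolded lower_body_def], of v l u "Pos (R v l u)"] outside_left
      by (auto simp: insert_Diff_if core_of_B core_of_R)
  next
    case (outside_right v l u)
    then have "(Atom (B v u), False) \<in> A" by (auto simp: insert_Diff_if core_of_B cell_def)
    then show ?thesis
      using constraint[OF A alldiff_rules(9)[unfolded upper_body_def], of v l u "Pos (R v l u)"] outside_right
      by (auto simp: insert_Diff_if core_of_B core_of_R)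
  next
    case (inside v l u)
    then have "holds ` (not_b v (l - 1) \<union> {Pos (B v u)}) \<subseteq> A"
      by (auto simp: insert_Diff_if core_of_B cell_def not_b_def split: if_splits)
    then have "(Body (r_body v l u), True) \<in> A"
      using conj_true[OF A alldiff_rules(7)[unfolded r_body_def], of v l u] inside by (auto simp: r_body_def)
    then show ?thesis using head_true[OF A alldiff_rules(7)] inside by (auto simp: core_of_R)
  next
    case (lower v l u)
    then have "(Body (r_body v l u), True) \<in> A" using up_r_body by (auto simp: core_of_R)
    then show ?thesis
      using conj_lit_true[OF A alldiff_rules(7)[unfolded r_body_def], of v l u "Neg (B v (l - 1))"] lower
      by (auto simp: insert_Diff_if core_of_B r_body_def not_b_def cell_def)
  next
    case (upper v l u)
    then have "(Body (r_body v l u), True) \<in> A" using up_r_body by (auto simp: core_of_R)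
    then show ?thesis
      using conj_lit_true[OF A alldiff_rules(7)[unfolded r_body_def], of v l u "Pos (B v u)"] upper
      by (auto simp: insert_Diff_if core_of_B r_body_def cell_def)
  next
    case (prune_lower v l u)
    then have r: "(Body (r_body v l u), False) \<in> A" using up_r_body by (auto simp: core_of_R)
    have "holds ` ((not_b v (l - 1) \<union> {Pos (B v u)}) - {Pos (B v u)}) \<subseteq> A"
      using prune_lower by (auto simp: insert_Diff_if core_of_B cell_def not_b_def split: if_splits)
    then show ?thesis
      using conj_false[OF A alldiff_rules(7)[unfolded r_body_def], of v l u "Pos (B v u)"] r prune_lower
      by (auto simp: insert_Diff_if core_of_B r_body_def cell_def)
  next
    case (prune_upper v l u)
    then have r: "(Body (r_body v l u), False) \<in> A" using up_r_body by (auto simp: core_of_R)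
    have u: "(Atom (B v u), True) \<in> A" using prune_upper by (auto simp: insert_Diff_if core_of_B cell_def)
    show ?thesis
    proof (cases "l = 1")
      case True
      \<comment> \<open>For l = 1 the body consists of \<open>b(v,u)\<close> alone. Here the body is
        false while this literal is true, so a nogood holds; this is how the program sees the
        derivation of a true \<open>b(v,0)\<close>.\<close>
      have "insert (Body (r_body v l u), False) (holds ` (not_b v (l - 1) \<union> {Pos (B v u)})) \<in>
          nogoods (alldiff_program n d)"
        unfolding r_body_def
        by (rule conj_nogood) (use prune_upper alldiff_rules(7) in \<open>simp add: r_body_def\<close>)
      moreover have "insert (Body (r_body v l u), False) (holds ` (not_b v (l - 1) \<union> {Pos (B v u)})) \<subseteq> A"
        using r u True by (auto simp: not_b_def)
      ultimately show ?thesis using nc unfolding conflict_def by blast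
    next
      case False
      then show ?thesis
        using conj_false[OF A alldiff_rules(7)[unfolded r_body_def], of v l u "Neg (B v (l - 1))"] r u
          prune_upper
        by (auto simp: insert_Diff_if core_of_B r_body_def not_b_def cell_def)
    qed
  next
    case (hall v l u S)
    have "(Body (hall_body n l u), False) \<in> A"
      using hall(2) by (intro up_fixed_false) (auto simp: fixed_false_def cell_def)
    then have "compl (Atom (R v l u), True) \<in> A"
      using hall
      by (intro unit_closedD[OF A hall_nogood[OF hall(2-4)]]) (auto simp: core_of_R)
    then show ?thesis using hall by (simp add: core_of_R)
  qed
qed

lemma full_core_of_subset:
  "full n d (core_of n A) \<subseteq> A"
proof -
  have "(Atom a, b) \<in> A" if "(a, b) \<in> core_of n A" "\<forall>v. a \<noteq> B v 0" for a b
    using that by (auto simp: core_of_def)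
  then show ?thesis
    unfolding full_def using up_r_body up_fixed_true up_fixed_false
    by (auto simp: core_of_R)
qed

end

section \<open>From a consistent closed core to a closed assignment of the program\<close>

lemma closed_cellD:
  assumes "closed n d X" "cell n d v l u"
  shows "(R v l u, True) \<in> X \<Longrightarrow> (B v (l - 1), False) \<in> X"
    and "(R v l u, True) \<in> X \<Longrightarrow> (B v u, True) \<in> X"
    and "(B v (l - 1), False) \<in> X \<Longrightarrow> (B v u, True) \<in> X \<Longrightarrow> (R v l u, True) \<in> X"
    and "(R v l u, False) \<in> X \<Longrightarrow> (B v (l - 1), False) \<in> X \<Longrightarrow> (B v u, False) \<in> X"
    and "(R v l u, False) \<in> X \<Longrightarrow> (B v u, True) \<in> X \<Longrightarrow> (B v (l - 1), True) \<in> X"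
    and "(B v (l - 1), True) \<in> X \<Longrightarrow> (R v l u, False) \<in> X"
    and "(B v u, False) \<in> X \<Longrightarrow> (R v l u, False) \<in> X"
  using closedD[OF assms(1)] assms(2)
  by (blast intro: der.lower der.upper der.inside der.prune_lower der.prune_upper
      der.outside_left der.outside_right)+

lemma unit_binary:
  assumes "x \<in> {a, b}" "{a, b} - {x} \<subseteq> A" "a \<noteq> b"
    "b \<in> A \<Longrightarrow> compl a \<in> A" "a \<in> A \<Longrightarrow> compl b \<in> A"
  shows "compl x \<in> A"
  using assms by blast

lemma unit_ternary:
  assumes "x \<in> {a, b, c}" "{a, b, c} - {x} \<subseteq> A" "a \<noteq> b" "a \<noteq> c" "b \<noteq> c"
    "b \<in> A \<Longrightarrow> c \<in> A \<Longrightarrow> compl a \<in> A" "a \<in> A \<Longrightarrow> c \<in> A \<Longrightarrow> compl b \<in> A"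
    "a \<in> A \<Longrightarrow> b \<in> A \<Longrightarrow> compl c \<in> A"
  shows "compl x \<in> A"
  using assms by blast

text \<open>Nogoods containing the complement of a constant literal are inert by
  \<open>unit_satisfied\<close>. Any other nogood, stripped of its constant literals, either links
  an r-atom with its body or expresses rules under which X is closed.\<close>

lemma unit_closed_full:
  assumes X: "closed n d X" "consistent X" "fst ` X \<subseteq> core_atoms n d"
    and XB: "\<And>v. v \<in> {1..n} \<Longrightarrow> (B v 0, False) \<in> X \<and> (B v d, True) \<in> X"
    and nd: "1 \<le> n" "1 \<le> d"
  shows "unit_closed (nogoods (alldiff_program n d)) (full n d X)"
  unfolding unit_closed_def
proof (intro ballI impI)
  let ?P = "alldiff_program n d" and ?F = "full n d X"
  fix \<delta> x assume \<delta>: "\<delta> \<in> nogoods ?P" and x: "x \<in> \<delta>" and sub: "\<delta> - {x} \<subseteq> ?F"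
  note cF = consistent_full[OF X(2,3)]
  have sat: "compl x \<in> ?F" if "y \<in> \<delta>" "compl y \<in> ?F" for y
    using unit_satisfied[OF cF that sub] .
  note FA = full_Atom[OF X(3)]
  have B: "(Atom (B v i), b) \<in> ?F \<longleftrightarrow> (B v i, b) \<in> X" if "i \<ge> 1" for v i b
    using that by (auto simp: FA)
  have RX: "(Atom (R v l u), b) \<in> ?F \<longleftrightarrow> (R v l u, b) \<in> X" for v l u b
    by (auto simp: FA)
  have low: "holds ` not_b v (l - 1) \<subseteq> ?F \<longleftrightarrow> (B v (l - 1), False) \<in> X" if "cell n d v l u" for v l u
    using that XB[of v] by (auto simp: not_b_def FA cell_def)
  have fixed_false: "compl x \<in> ?F" if "(Body \<beta>, True) \<in> \<delta>" "Body \<beta> \<in> fixed_false n d" for \<beta>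
    using sat[OF that(1)] full_fixed(2)[OF that(2)] by simp
  have body: "compl x \<in> ?F" if "Rule h \<beta> \<in> ?P" and \<delta>b: "\<delta> \<in> body_nogoods \<beta>" for h \<beta>
    using that
  proof (cases rule: alldiff_rule_cases)
    case 1
    then have "(Body (Conj {Neg Violate}), False) \<in> \<delta> \<or> (Atom Violate, True) \<in> \<delta>" using \<delta>b by auto
    then show ?thesis
      using sat full_fixed(1)[of "Body (Conj {Neg Violate})" n d X] full_fixed(2)[of "Atom Violate" n d X]
      by (auto simp: fixed_true_def fixed_false_def)
  next
    case 2
    then have "(Body (Conj {Neg Sat}), True) \<in> \<delta> \<or> (Atom Sat, False) \<in> \<delta>" using \<delta>b by auto
    then show ?thesis
      using sat full_fixed(1)[of "Atom Sat" n d X] full_fixed(2)[of "Body (Conj {Neg Sat})" n d X]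
      by (auto simp: fixed_true_def fixed_false_def)
  next
    case (3 l u)
    then have ff: "Body (hall_body n l u) \<in> fixed_false n d" by (auto simp: fixed_false_def)
    show ?thesis
    proof (cases "(Body \<beta>, True) \<in> \<delta>")
      case True
      then show ?thesis using fixed_false ff 3 by simp
    next
      case False
      then obtain T where T: "\<delta> = {(Body \<beta>, False)} \<union> holds ` T"
        "T \<subseteq> (\<lambda>v. Pos (R v l u)) ` {1..n}" "card T = u - l + 2"
        using \<delta>b 3 by (auto simp: hall_body_def)
      define S where "S = {w \<in> {1..n}. Pos (R w l u) \<in> T}"
      have TS: "T = (\<lambda>w. Pos (R w l u)) ` S" using T(2) by (auto simp: S_def)
      have cS: "card S = u - l + 2" using T(3) unfolding TS by (subst (asm) card_image) (auto simp: inj_on_def)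
      have fS: "finite S" by (simp add: S_def)
      have \<delta>S: "\<delta> = insert (Body \<beta>, False) ((\<lambda>w. (Atom (R w l u), True)) ` S)"
        unfolding T(1) TS by (auto simp: image_image)
      have key: "(R w l u, False) \<in> X" if w: "w \<in> S" and oth: "\<And>w'. w' \<in> S - {w} \<Longrightarrow> (R w' l u, True) \<in> X" for w
      proof -
        have "der n d X (R w l u, False)"
          by (rule der.hall[where S = "S - {w}"])
            (use w oth 3 cS fS in \<open>auto simp: S_def cell_def\<close>)
        then show ?thesis using closedD[OF X(1)] by blast
      qed
      consider "x = (Body \<beta>, False)" | w where "w \<in> S" "x = (Atom (R w l u), True)"
        using x \<delta>S by blast
      then show ?thesis
      proof cases
        case 1
        \<comment> \<open>All u - l + 2 atoms would be true, but then \<open>hall\<close> makes each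
          of them false as well. So consistency prevents the constantly false body from being
          inferred true.\<close>
        then have all: "\<And>w. w \<in> S \<Longrightarrow> (R w l u, True) \<in> X" using sub RX unfolding \<delta>S by auto
        obtain w where "w \<in> S" using cS by fastforce
        then have "(R w l u, True) \<in> X" "(R w l u, False) \<in> X" using all key by auto
        then show ?thesis using X(2) by (auto simp: consistent_def)
      next
        case (2 w)
        then have "\<And>w'. w' \<in> S - {w} \<Longrightarrow> (R w' l u, True) \<in> X" using sub RX unfolding \<delta>S by auto
        then show ?thesis using key 2 RX by simp
      qed
    qed
  next
    case (4 v)
    then have "\<delta> = {(Body (Conj {}), False)}" using \<delta>b by auto
    then show ?thesis
      using sat[of "(Body (Conj {}), False)"] full_fixed(1)[of "Body (Conj {})"] by (auto simp: fixed_true_def)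
  next
    case (5 v i)
    then have ff: "Body (order_body v i) \<in> fixed_false n d" by (auto simp: fixed_false_def)
    show ?thesis
    proof (cases "(Body \<beta>, True) \<in> \<delta>")
      case True
      then show ?thesis using fixed_false ff 5 by simp
    next
      case False
      then have \<delta>': "\<delta> = {(Body \<beta>, False), (Atom (B v i), True), (Atom (B v (Suc i)), False)}"
        using \<delta>b 5 by (auto simp: order_body_def)
      have "(B v i, True) \<in> X \<Longrightarrow> (B v (Suc i), True) \<in> X"
        "(B v (Suc i), False) \<in> X \<Longrightarrow> (B v i, False) \<in> X"
        using 5 by (blast intro: closedD[OF X(1)] der.order_up der.order_down)+
      \<comment> \<open>This excludes the third inference from the nogood, which would make the
        constantly false body true.\<close>
      moreover have "\<not> ((B v (Suc i), True) \<in> X \<and> (B v (Suc i), False) \<in> X)"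
        using X(2) by (auto simp: consistent_def)
      ultimately show ?thesis
        using 5(2) by (intro unit_ternary[OF x[unfolded \<delta>'] sub[unfolded \<delta>']]) (auto simp: B)
    qed
  next
    case (6 v)
    then have ff: "Body (top_body d v) \<in> fixed_false n d" by (auto simp: fixed_false_def)
    have "(Body \<beta>, True) \<in> \<delta> \<or> (Atom (B v d), False) \<in> \<delta>"
      using \<delta>b 6 by (auto simp: top_body_def)
    then show ?thesis using fixed_false ff 6 sat[of "(Atom (B v d), False)"] XB nd by (auto simp: B)
  next
    case (7 v l u)
    have u: "1 \<le> u" using 7 by (auto simp: cell_def)
    have r: "(Body \<beta>, b) \<in> ?F \<longleftrightarrow> (R v l u, b) \<in> X" for b using full_r_body 7 by simp
    note d = closed_cellD[OF X(1) 7(1)]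
    consider "\<delta> = insert (Body \<beta>, False) (holds ` (not_b v (l - 1) \<union> {Pos (B v u)}))"
      | "\<delta> = {(Body \<beta>, True), (Atom (B v u), False)}"
      | "l \<noteq> 1" "\<delta> = {(Body \<beta>, True), (Atom (B v (l - 1)), True)}"
      using \<delta>b 7 by (auto simp: r_body_def not_b_def split: if_splits)
    then show ?thesis
    proof cases
      case 1
      show ?thesis
      proof (cases "l = 1")
        case True
        then have \<delta>': "\<delta> = {(Body \<beta>, False), (Atom (B v u), True)}" using 1 by (simp add: not_b_def)
        have "(B v (l - 1), False) \<in> X" using True XB[of v] 7(1) by (simp add: cell_def)
        then show ?thesis
          using d(3,4) u
          by (intro unit_binary[OF x[unfolded \<delta>'] sub[unfolded \<delta>']]) (simp_all add: B r)
      next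
        case False
        then have l: "1 \<le> l - 1" using 7 by (auto simp: cell_def)
        then have \<delta>': "\<delta> = {(Body \<beta>, False), (Atom (B v u), True), (Atom (B v (l - 1)), False)}"
          using 1 by (auto simp: not_b_def)
        show ?thesis
          using d(3-5) u l
          by (intro unit_ternary[OF x[unfolded \<delta>'] sub[unfolded \<delta>']]) (simp_all add: B r)
      qed
    next
      case 2
      show ?thesis
        using d(2,7) u by (intro unit_binary[OF x[unfolded 2] sub[unfolded 2]]) (simp_all add: B r)
    next
      case 3
      then have l: "1 \<le> l - 1" using 7 by (auto simp: cell_def)
      show ?thesis
        using d(1,6) l by (intro unit_binary[OF x[unfolded 3(2)] sub[unfolded 3(2)]]) (simp_all add: B r)
    qed
  next
    case (8 v l u)
    then have ff: "Body (lower_body v l u) \<in> fixed_false n d" by (auto simp: fixed_false_def)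
    show ?thesis
    proof (cases "(Body \<beta>, True) \<in> \<delta>")
      case True
      then show ?thesis using fixed_false ff 8 by simp
    next
      case False
      then have \<delta>': "\<delta> = {(Body \<beta>, False), (Atom (R v l u), True), (Atom (B v (l - 1)), True)}"
        using \<delta>b 8 by (auto simp: lower_body_def)
      have "(R v l u, True) \<in> X \<Longrightarrow> (B v (l - 1), False) \<in> X"
        "(B v (l - 1), True) \<in> X \<Longrightarrow> (R v l u, False) \<in> X"
        using closed_cellD[OF X(1) 8(1)] by blast+
      moreover have "\<not> ((R v l u, True) \<in> X \<and> (R v l u, False) \<in> X)"
        using X(2) by (auto simp: consistent_def)
      ultimately show ?thesis
        using 8(2) by (intro unit_ternary[OF x[unfolded \<delta>'] sub[unfolded \<delta>']]) (auto simp: B RX)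
    qed
  next
    case (9 v l u)
    then have ff: "Body (upper_body v l u) \<in> fixed_false n d" by (auto simp: fixed_false_def)
    have u: "1 \<le> u" using 9 by (auto simp: cell_def)
    show ?thesis
    proof (cases "(Body \<beta>, True) \<in> \<delta>")
      case True
      then show ?thesis using fixed_false ff 9 by simp
    next
      case False
      then have \<delta>': "\<delta> = {(Body \<beta>, False), (Atom (R v l u), True), (Atom (B v u), False)}"
        using \<delta>b 9 by (auto simp: upper_body_def)
      have "(R v l u, True) \<in> X \<Longrightarrow> (B v u, True) \<in> X"
        "(B v u, False) \<in> X \<Longrightarrow> (R v l u, False) \<in> X"
        using closed_cellD[OF X(1) 9(1)] by blast+
      moreover have "\<not> ((R v l u, True) \<in> X \<and> (R v l u, False) \<in> X)"
        using X(2) by (auto simp: consistent_def)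
      ultimately show ?thesis
        using u by (intro unit_ternary[OF x[unfolded \<delta>'] sub[unfolded \<delta>']]) (auto simp: B RX)
    qed
  qed
  have head: "compl x \<in> ?F" if "Rule (Head h) \<beta> \<in> ?P" and \<delta>h: "\<delta> = {(Body \<beta>, True), (Atom h, False)}" for h \<beta>
  proof -
    have bf: "Body \<beta> \<in> fixed_false n d \<Longrightarrow> ?thesis" using fixed_false \<delta>h by simp
    show ?thesis using that
    proof (cases rule: alldiff_rule_cases)
      case 1
      then show ?thesis using sat[of "(Atom Sat, False)"] \<delta>h full_fixed(1)[of "Atom Sat"]
        by (auto simp: fixed_true_def)
    next
      case (7 v l u)
      then show ?thesis
        using full_r_body[of n d v l u]
        by (intro unit_binary[OF x[unfolded \<delta>h] sub[unfolded \<delta>h]]) (simp_all add: RX)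
    qed (rule bf; auto simp: fixed_false_def)+
  qed
  have support: "compl x \<in> ?F" if a: "a \<in> atoms ?P"
    and \<delta>a: "\<delta> = {(Atom a, True)} \<union> {(Body \<beta>, False) | \<beta>. \<exists>h. Rule h \<beta> \<in> ?P \<and> a \<in> head_atoms h}" for a
  proof (cases a)
    case (B v i)
    then have "Rule (Choice (B v ` {1..d})) (Conj {}) \<in> ?P" "a \<in> head_atoms (Choice (B v ` {1..d}))"
      using atoms_alldiff[OF a nd(2)] alldiff_rules(4)[of v n d]
      by (cases i; auto)+
    \<comment> \<open>The empty body of the choice rule is true and supports every
      \<open>b(v,i)\<close>, so support nogoods of these atoms never propagate.\<close>
    then have "(Body (Conj {}), False) \<in> \<delta>" unfolding \<delta>a by blast
    then show ?thesis
      using sat full_fixed(1)[of "Body (Conj {})"] by (auto simp: fixed_true_def)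
  next
    case (R v l u)
    then have c: "cell n d v l u" using atoms_alldiff[OF a nd(2)] by auto
    have "\<delta> = {(Atom (R v l u), True), (Body (r_body v l u), False)}"
      using R_support[OF c] unfolding \<delta>a R by blast
    then have \<delta>': "\<delta> = {(Atom (R v l u), True), (Body (r_body v l u), False)}" .
    show ?thesis
      using full_r_body[OF c]
      by (intro unit_binary[OF x[unfolded \<delta>'] sub[unfolded \<delta>']]) (simp_all add: RX)
  next
    case Bot
    then show ?thesis
      using sat[of "(Atom Bot, True)"] full_fixed(2)[of "Atom Bot"] \<delta>a by (auto simp: fixed_false_def)
  next
    case Violate
    then show ?thesis
      using sat[of "(Atom Violate, True)"] full_fixed(2)[of "Atom Violate"] \<delta>a by (auto simp: fixed_false_def)
  next
    case Sat
    have "(Body (Conj {Neg Violate}), False) \<in> \<delta>" unfolding \<delta>a Sat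
      using alldiff_rules(1) by fastforce
    then show ?thesis
      using sat full_fixed(1)[of "Body (Conj {Neg Violate})"] by (auto simp: fixed_true_def)
  qed
  from \<delta> show "compl x \<in> ?F"
    unfolding nogoods_def
  proof (elim UnE)
    assume "\<delta> \<in> {{(Atom Bot, True)}}"
    then show ?thesis
      using sat[of "(Atom Bot, True)"] full_fixed(2)[of "Atom Bot"] by (auto simp: fixed_false_def)
  qed (use body head support in \<open>auto simp: bodies_def\<close>)
qed

text \<open>\<open>A\<close> may be anything between the generators \<open>X\<close> and the
  extension of their closure, so that the root and every decision are instances. The extension is
  unit-closed and hence an upper bound for \<open>U\<close>; the core of \<open>U\<close> is closed
  and contains \<open>X\<close>, which gives the lower bound. If the closure is inconsistent, a
  conflict-free \<open>U\<close> would contain it and be inconsistent itself, which is a conflict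
  because \<open>A\<close> is consistent.\<close>

theorem up_core:
  assumes nd: "1 \<le> n" "1 \<le> d" and X: "fst ` X \<subseteq> core_atoms n d"
    and XB: "\<And>v. v \<in> {1..n} \<Longrightarrow> (B v 0, False) \<in> X \<and> (B v d, True) \<in> X"
    and A: "A \<subseteq> full n d (cl n d X)" "consistent A" "(Atom Violate, False) \<in> A"
    and XA: "X \<subseteq> core_of n (up (nogoods (alldiff_program n d)) A)"
  defines "U \<equiv> up (nogoods (alldiff_program n d)) A"
  shows "conflict (nogoods (alldiff_program n d)) U \<longleftrightarrow> \<not> consistent (cl n d X)"
    and "consistent (cl n d X) \<Longrightarrow> U = full n d (cl n d X)"
proof -
  let ?N = "nogoods (alldiff_program n d)" and ?C = "cl n d X"
  have U: "unit_closed ?N U" unfolding U_def by (rule unit_closed_up)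
  have V: "(Atom Violate, False) \<in> U" using A(3) subset_up unfolding U_def by blast
  have C: "?C \<subseteq> core_of n U" if "\<not> conflict ?N U"
    using XA closed_core_of[OF U V nd that] unfolding U_def by (intro cl_least)
  have incon: "conflict ?N U" if "\<not> consistent ?C"
  proof (rule ccontr)
    assume nc: "\<not> conflict ?N U"
    have "\<not> consistent (core_of n U)" using C[OF nc] that consistent_mono by blast
    then have "\<not> consistent U" by (auto simp: consistent_def core_of_def)
    then show False using nc inconsistent_up_conflict[OF A(2)] unfolding U_def by blast
  qed
  have con: "\<not> conflict ?N U \<and> U = full n d ?C" if "consistent ?C"
  proof -
    have core: "fst ` ?C \<subseteq> core_atoms n d" using cl_core[OF X] .
    have uc: "unit_closed ?N (full n d ?C)"
      using XB subset_cl[of X n d] by (intro unit_closed_full closed_cl that core nd) blast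
    have sub: "U \<subseteq> full n d ?C" unfolding U_def by (rule up_least[OF A(1) uc])
    have "\<not> conflict ?N (full n d ?C)"
      by (rule consistent_no_conflict[OF uc consistent_full[OF that core] nogoods_nonempty])
    then have nc: "\<not> conflict ?N U" using sub by (auto simp: conflict_def)
    have "full n d ?C \<subseteq> full n d (core_of n U)" using C[OF nc] unfolding full_def by blast
    then have "full n d ?C \<subseteq> U" using full_core_of_subset[OF U V nd] by blast
    then show ?thesis using nc sub by blast
  qed
  show "conflict ?N U \<longleftrightarrow> \<not> consistent ?C" using incon con by blast
  show "consistent ?C \<Longrightarrow> U = full n d ?C" using con by blast
qed

section \<open>Bound consistency\<close>

text \<open>Besides the given bounds it contains the sentinels and \<open>b(v,d)\<close>, which
  \<open>top_body\<close> forces. For \<open>p v\<close> = 1 the lower bound is the sentinel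
  itself.\<close>

definition start_core :: "nat \<Rightarrow> nat \<Rightarrow> (nat \<Rightarrow> nat) \<Rightarrow> (nat \<Rightarrow> nat) \<Rightarrow> (atom \<times> bool) set" where
  "start_core n d p q =
     (\<Union>v\<in>{1..n}. {(B v 0, False), (B v d, True), (B v (p v - 1), False), (B v (q v), True)})"

lemma start_core_atoms: "init_domains n d p q \<Longrightarrow> fst ` start_core n d p q \<subseteq> core_atoms n d"
  by (fastforce simp: start_core_def init_domains_def)

lemma start_coreI:
  "v \<in> {1..n} \<Longrightarrow> (B v 0, False) \<in> start_core n d p q \<and> (B v d, True) \<in> start_core n d p q"
  by (auto simp: start_core_def)

lemma
  assumes nd: "1 \<le> n" "1 \<le> d" and pq: "init_domains n d p q"
  defines "P \<equiv> alldiff_program n d" and "C \<equiv> cl n d (start_core n d p q)"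
  shows root_conflict: "conflict (nogoods P) (root n P p q) \<longleftrightarrow> \<not> consistent C"
    and root_full: "consistent C \<Longrightarrow> root n P p q = full n d C"
proof -
  let ?X = "start_core n d p q" and ?A = "init_assignment n p q"
  have X: "fst ` ?X \<subseteq> core_atoms n d" by (rule start_core_atoms[OF pq])
  have pq': "1 \<le> p v" "p v \<le> q v" "q v \<le> d" if "v \<in> {1..n}" for v
    using pq that by (auto simp: init_domains_def)
  have sub: "(a, b) \<in> ?X \<Longrightarrow> (a, b) \<in> C" for a b using subset_cl unfolding C_def by blast
  have 1: "?A \<subseteq> full n d C"
  proof
    fix x assume "x \<in> ?A"
    then consider "x = (Atom Violate, False)"
      | v where "v \<in> {1..n}" "p v > 1" "x = (Atom (B v (p v - 1)), False)"
      | v where "v \<in> {1..n}" "x = (Atom (B v (q v)), True)"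
      by (auto simp: init_assignment_def)
    then show "x \<in> full n d C"
    proof cases
      case 1
      then show ?thesis by (simp add: full_fixed fixed_false_def)
    next
      case (2 v)
      then have "(B v (p v - 1), False) \<in> C" by (intro sub) (auto simp: start_core_def)
      then show ?thesis using 2 full_Atom[OF cl_core[OF X]] unfolding C_def by auto
    next
      case (3 v)
      then have "(B v (q v), True) \<in> C" by (intro sub) (auto simp: start_core_def)
      then show ?thesis using 3 full_Atom[OF cl_core[OF X]] pq'[of v] unfolding C_def by auto
    qed
  qed
  have 2: "consistent ?A"
    using pq' by (fastforce simp: consistent_def init_assignment_def)
  have 3: "(Atom Violate, False) \<in> ?A" by (simp add: init_assignment_def)
  have uc: "unit_closed (nogoods P) (up (nogoods P) ?A)" by (rule unit_closed_up)
  have 4: "?X \<subseteq> core_of n (up (nogoods P) ?A)"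
  proof
    fix x assume "x \<in> ?X"
    then obtain v where v: "v \<in> {1..n}"
      "x \<in> {(B v 0, False), (B v d, True), (B v (p v - 1), False), (B v (q v), True)}"
      by (auto simp: start_core_def)
    have a: "(Atom (B v (q v)), True) \<in> up (nogoods P) ?A"
      using v by (intro up.start) (auto simp: init_assignment_def)
    have b: "p v > 1 \<Longrightarrow> (Atom (B v (p v - 1)), False) \<in> up (nogoods P) ?A"
      using v by (intro up.start) (auto simp: init_assignment_def)
    have c: "(Atom (B v d), True) \<in> up (nogoods P) ?A"
      using up_top[OF uc[unfolded P_def] _ nd v(1)] 3 subset_up unfolding P_def by blast
    show "x \<in> core_of n (up (nogoods P) ?A)"
      using v a b c nd pq'[OF v(1)] by (auto simp: core_of_B)
  qed
  note up = up_core[OF nd X start_coreI 1[unfolded C_def] 2 3 4[unfolded P_def]]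
  show "conflict (nogoods P) (root n P p q) \<longleftrightarrow> \<not> consistent C"
    using up(1) unfolding root_def P_def C_def by blast
  show "consistent C \<Longrightarrow> root n P p q = full n d C"
    using up(2) unfolding root_def P_def C_def by blast
qed

section \<open>Hall's condition with tight intervals as a description of bound consistency\<close>

definition tight :: "nat \<Rightarrow> (nat \<Rightarrow> nat) \<Rightarrow> (nat \<Rightarrow> nat) \<Rightarrow> nat \<Rightarrow> nat \<Rightarrow> bool" where
  "tight n L U l u \<longleftrightarrow> card (inside_set {1..n} L U l u) = Suc u - l"

text \<open>The variables inside a tight interval use up all its values, so a bound of any other
  variable in that interval would have no support.\<close>

definition bc_cond :: "nat \<Rightarrow> nat \<Rightarrow> (nat \<Rightarrow> nat) \<Rightarrow> (nat \<Rightarrow> nat) \<Rightarrow> bool" where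
  "bc_cond n d L U \<longleftrightarrow>
     (\<forall>v\<in>{1..n}. 1 \<le> L v \<and> L v \<le> U v \<and> U v \<le> d) \<and> hall_cond {1..n} L U \<and>
     (\<forall>v l u. cell n d v l u \<longrightarrow> tight n L U l u \<longrightarrow> v \<notin> inside_set {1..n} L U l u \<longrightarrow>
        L v \<notin> {l..u} \<and> U v \<notin> {l..u})"

text \<open>A domain may extend beyond a tight interval on both sides, with neither bound in it. It
  still intersects the interval, but \<open>hall\<close> makes the r-atom false; hence the last
  disjunct.\<close>

definition canon :: "nat \<Rightarrow> nat \<Rightarrow> (nat \<Rightarrow> nat) \<Rightarrow> (nat \<Rightarrow> nat) \<Rightarrow> (atom \<times> bool) set" where
  "canon n d L U =
     {(B v i, True) | v i. v \<in> {1..n} \<and> U v \<le> i \<and> i \<le> d} \<union>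
     {(B v i, False) | v i. v \<in> {1..n} \<and> i < L v} \<union>
     {(R v l u, True) | v l u. cell n d v l u \<and> l \<le> L v \<and> U v \<le> u} \<union>
     {(R v l u, False) | v l u. cell n d v l u \<and>
        (U v < l \<or> u < L v \<or> tight n L U l u \<and> \<not> (l \<le> L v \<and> U v \<le> u))}"

lemma canon_iff:
  "(B v i, True) \<in> canon n d L U \<longleftrightarrow> v \<in> {1..n} \<and> U v \<le> i \<and> i \<le> d"
  "(B v i, False) \<in> canon n d L U \<longleftrightarrow> v \<in> {1..n} \<and> i < L v"
  "(R v l u, True) \<in> canon n d L U \<longleftrightarrow> cell n d v l u \<and> l \<le> L v \<and> U v \<le> u"
  "(R v l u, False) \<in> canon n d L U \<longleftrightarrow> cell n d v l u \<and>
        (U v < l \<or> u < L v \<or> tight n L U l u \<and> \<not> (l \<le> L v \<and> U v \<le> u))"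
  by (auto simp: canon_def)

lemma cell_simps: "cell n d v l u \<Longrightarrow> v \<in> {1..n} \<and> 1 \<le> l \<and> l \<le> u \<and> u \<le> d"
  by (simp add: cell_def)

lemma closed_canon:
  assumes "bc_cond n d L U"
  shows "closed n d (canon n d L U)"
  unfolding closed_def
proof (intro allI impI)
  have LU: "1 \<le> L v" "L v \<le> U v" "U v \<le> d" if "v \<in> {1..n}" for v
    using assms that by (auto simp: bc_cond_def)
  have tight: "L v \<notin> {l..u} \<and> U v \<notin> {l..u}"
    if "cell n d v l u" "tight n L U l u" "\<not> (l \<le> L v \<and> U v \<le> u)" for v l u
    using assms that unfolding bc_cond_def inside_set_def by blast
  fix e assume "der n d (canon n d L U) e"
  then show "e \<in> canon n d L U"
  proof cases
    case (hall v l u S)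
    have c: "1 \<le> l" "l \<le> u" "v \<in> {1..n}" using hall(2) by (auto simp: cell_def)
    have S: "S \<subseteq> inside_set {1..n} L U l u" using hall by (auto simp: inside_set_def canon_iff)
    have "card (inside_set {1..n} L U l u) \<le> Suc u - l"
      using assms c by (auto simp: bc_cond_def hall_cond_def)
    \<comment> \<open>S already has as many elements as Hall's condition allows, so there are no
      further variables inside and the interval is tight.\<close>
    then have "S = inside_set {1..n} L U l u"
      using S hall(4) c by (intro card_seteq) auto
    then have "tight n L U l u" "v \<notin> inside_set {1..n} L U l u"
      using hall c by (auto simp: tight_def)
    then show ?thesis using hall c by (auto simp: canon_iff inside_set_def)
  next
    case (prune_lower v l u)
    \<comment> \<open>Given l \<le> \<open>L v\<close>, the r-atom is false either because u <
      \<open>L v\<close>, as desired, or because the interval is tight without containing the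
      domain; then \<open>L v\<close> avoids it and lies above u.\<close>
    then show ?thesis using LU[of v] tight[of v l u] cell_simps[OF prune_lower(2)] by (auto simp: canon_iff)
  next
    case (prune_upper v l u)
    then show ?thesis using LU[of v] tight[of v l u] cell_simps[OF prune_upper(2)] by (auto simp: canon_iff)
  next
    case (order_up v i)
    then show ?thesis by (auto simp: canon_iff)
  next
    case (order_down v i)
    then show ?thesis by (auto simp: canon_iff)
  next
    case (outside_left v l u)
    then show ?thesis using cell_simps[OF outside_left(2)] by (auto simp: canon_iff)
  next
    case (outside_right v l u)
    then show ?thesis by (auto simp: canon_iff)
  next
    case (inside v l u)
    then show ?thesis by (auto simp: canon_iff)
  next
    case (lower v l u)
    then show ?thesis using cell_simps[OF lower(2)] by (auto simp: canon_iff)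
  next
    case (upper v l u)
    then show ?thesis using cell_simps[OF upper(2)] by (auto simp: canon_iff)
  qed
qed

lemma consistent_canon:
  assumes "bc_cond n d L U"
  shows "consistent (canon n d L U)"
  unfolding consistent_def
proof (intro allI notI)
  have LU: "L v \<le> U v" if "v \<in> {1..n}" for v
    using assms that by (auto simp: bc_cond_def)
  fix x assume x: "(x, True) \<in> canon n d L U \<and> (x, False) \<in> canon n d L U"
  then show False
  proof (cases x)
    case (B v i)
    then show ?thesis using x LU[of v] by (auto simp: canon_iff)
  next
    case (R v l u)
    then show ?thesis using x LU[of v] by (auto simp: canon_iff cell_def)
  qed (auto simp: canon_def)
qed

lemma inside_clip:
  assumes "\<forall>v\<in>{1..n}. 1 \<le> L v \<and> L v \<le> U v \<and> U v \<le> d"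
  shows "inside_set {1..n} L U l u = inside_set {1..n} L U (max 1 l) (min d u)"
    and "u < l \<Longrightarrow> inside_set {1..n} L U l u = {}"
proof -
  show "inside_set {1..n} L U l u = inside_set {1..n} L U (max 1 l) (min d u)"
    using assms by (force simp: inside_set_def)
  show "inside_set {1..n} L U l u = {}" if "u < l"
  proof (rule ccontr)
    assume "inside_set {1..n} L U l u \<noteq> {}"
    then obtain v where "v \<in> {1..n}" "l \<le> L v" "U v \<le> u" by (auto simp: inside_set_def)
    then show False using assms that by fastforce
  qed
qed

text \<open>Propagation knows intervals within \<open>[1, d]\<close> only. Clipping an interval to
  this range keeps the variables inside and does not increase the number of values.\<close>

lemma hall_condI:
  assumes LU: "\<forall>v\<in>{1..n}. 1 \<le> L v \<and> L v \<le> U v \<and> U v \<le> d"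
    and H: "\<And>l u. 1 \<le> l \<Longrightarrow> l \<le> u \<Longrightarrow> u \<le> d \<Longrightarrow> card (inside_set {1..n} L U l u) \<le> Suc u - l"
  shows "hall_cond {1..n} L U"
  unfolding hall_cond_def
proof (intro allI impI)
  fix l u :: nat assume "l \<le> u"
  show "card (inside_set {1..n} L U l u) \<le> Suc u - l"
  proof (cases "max 1 l \<le> min d u")
    case True
    have "card (inside_set {1..n} L U l u) \<le> Suc (min d u) - max 1 l"
      unfolding inside_clip(1)[OF LU, of l u] using True by (intro H) auto
    then show ?thesis by linarith
  next
    case False
    then have "inside_set {1..n} L U l u = {}"
      unfolding inside_clip(1)[OF LU, of l u] by (intro inside_clip(2)[OF LU]) linarith
    then show ?thesis by simp
  qed
qed

text \<open>If a tight interval left \<open>[1, d]\<close>, clipping would remove values but no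
  variables and leave an overfull interval.\<close>

lemma tight_range:
  assumes "bc_cond n d L U" "tight n L U l u" "l \<le> u"
  shows "1 \<le> l \<and> u \<le> d"
proof -
  have LU: "\<forall>v\<in>{1..n}. 1 \<le> L v \<and> L v \<le> U v \<and> U v \<le> d" and H: "hall_cond {1..n} L U"
    using assms by (auto simp: bc_cond_def)
  have ne: "inside_set {1..n} L U l u \<noteq> {}" using assms(2,3) by (auto simp: tight_def)
  have "\<not> min d u < max 1 l"
    using ne inside_clip(2)[OF LU] unfolding inside_clip(1)[OF LU, of l u] by blast
  then have "max 1 l \<le> min d u" by (simp only: not_less)
  then have "card (inside_set {1..n} L U l u) \<le> Suc (min d u) - max 1 l"
    using H unfolding inside_clip(1)[OF LU, of l u] hall_cond_def by blast
  then show ?thesis using assms(2,3) by (auto simp: tight_def min_def max_def split: if_splits)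
qed

lemma Min_Max_interval [simp]:
  fixes a b :: nat
  assumes "a \<le> b"
  shows "Min {a..b} = a" "Max {a..b} = b"
  using assms by (auto intro: Min_eqI Max_eqI)

text \<open>To support a bound a of variable i, shrink its domain to a. Hall's condition can only
  fail for an interval that gains i; it was tight before, contains a and did not contain the domain,
  contrary to \<open>bc_cond\<close>. Conversely, a support is an injection within the domains: it
  maps the variables inside an interval into it, and a support for a bound in a tight interval would
  place one variable too many there.\<close>

lemma bound_consistent_iff:
  assumes n: "1 \<le> n" and LU: "\<forall>v\<in>{1..n}. 1 \<le> L v \<and> L v \<le> U v \<and> U v \<le> d"
    and D: "\<forall>v\<in>{1..n}. D v = {L v..U v}"
  shows "bound_consistent n (alldifferent n d) D \<longleftrightarrow> bc_cond n d L U"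
proof
  assume bc: "bc_cond n d L U"
  show "bound_consistent n (alldifferent n d) D"
    unfolding bound_consistent_def
  proof (intro ballI impI)
    fix i a assume i: "i \<in> {1..n}" and a: "a \<in> {Min (D i), Max (D i)}"
    have Di: "D i = {L i..U i}" "L i \<le> U i" using D LU i by auto
    then have a': "a = L i \<or> a = U i" using a by simp
    let ?L = "L(i := a)" and ?U = "U(i := a)"
    have "hall_cond {1..n} ?L ?U"
      unfolding hall_cond_def
    proof (intro allI impI, rule ccontr)
      fix l u :: nat assume lu: "l \<le> u" and viol: "\<not> card (inside_set {1..n} ?L ?U l u) \<le> Suc u - l"
      let ?I = "inside_set {1..n} L U l u" and ?I' = "inside_set {1..n} ?L ?U l u"
      have le: "card ?I \<le> Suc u - l" using bc lu by (auto simp: bc_cond_def hall_cond_def)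
      have notsub: "\<not> ?I' \<subseteq> ?I"
      proof
        assume "?I' \<subseteq> ?I"
        then have "card ?I' \<le> card ?I" by (intro card_mono) auto
        then show False using le viol by simp
      qed
      have sub: "?I' \<subseteq> insert i ?I" by (auto simp: inside_set_def split: if_splits)
      have iI: "i \<in> ?I'" "i \<notin> ?I" using notsub sub by auto
      then have al: "a \<in> {l..u}" by (auto simp: inside_set_def)
      have "card ?I' \<le> card (insert i ?I)" using sub by (intro card_mono) auto
      also have "\<dots> = Suc (card ?I)" using iI by (intro card_insert_disjoint) auto
      finally have t: "tight n L U l u" using viol le by (simp add: tight_def)
      have "cell n d i l u" using tight_range[OF bc t lu] i lu by (auto simp: cell_def)
      then show False using bc t iI(2) al a' unfolding bc_cond_def by blast
    qed
    moreover have "\<forall>w\<in>{1..n}. ?L w \<le> ?U w" using LU by auto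
    ultimately obtain t where t: "inj_on t {1..n}" "\<forall>w\<in>{1..n}. ?L w \<le> t w \<and> t w \<le> ?U w"
      using hall_cond_matching[of "{1..n}" ?L ?U] by auto
    have ti: "t i = a" using t(2) i by (metis fun_upd_same le_antisym)
    have tj: "L j \<le> t j \<and> t j \<le> U j" if "j \<in> {1..n}" for j
      using t(2)[rule_format, OF that] a' Di(2) by (auto split: if_splits)
    have "bound_support n (alldifferent n d) D i a (restrict t {1..n})"
      unfolding bound_support_def
    proof (intro conjI ballI)
      have "\<forall>j\<in>{1..n}. t j \<in> {1..d}" using tj LU by (meson atLeastAtMost_iff le_trans)
      then show "restrict t {1..n} \<in> alldifferent n d"
        unfolding alldifferent_def using t(1) by simp
    next
      show "restrict t {1..n} i = a" using ti i by simp
    next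
      fix j assume j: "j \<in> {1..n} - {i}"
      then have "D j = {L j..U j}" "L j \<le> U j" using D LU by auto
      then show "D j \<noteq> {}" "Min (D j) \<le> restrict t {1..n} j" "restrict t {1..n} j \<le> Max (D j)"
        using tj[of j] j by auto
    qed
    then show "\<exists>t. bound_support n (alldifferent n d) D i a t" by blast
  qed
next
  assume bc: "bound_consistent n (alldifferent n d) D"
  have sup: "\<exists>t. inj_on t {1..n} \<and> t i = a \<and> (\<forall>j\<in>{1..n}. L j \<le> t j \<and> t j \<le> U j)"
    if i: "i \<in> {1..n}" and a: "a = L i \<or> a = U i" for i a
  proof -
    have "D j = {L j..U j}" "L j \<le> U j" if "j \<in> {1..n}" for j using D LU that by auto
    then have mm: "D j \<noteq> {}" "Min (D j) = L j" "Max (D j) = U j" if "j \<in> {1..n}" for j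
      using that by auto
    then obtain t where t: "bound_support n (alldifferent n d) D i a t"
      using bc i a unfolding bound_consistent_def by (metis insertI1 insertI2)
    have "L j \<le> t j \<and> t j \<le> U j" if "j \<in> {1..n}" for j
    proof (cases "j = i")
      case True
      then show ?thesis using t a LU i unfolding bound_support_def by auto
    next
      case False
      then have "j \<in> {1..n} - {i}" using that by blast
      then show ?thesis using t mm(2,3)[OF that] unfolding bound_support_def by metis
    qed
    moreover have "inj_on t {1..n}" "t i = a"
      using t by (auto simp: bound_support_def alldifferent_def)
    ultimately show ?thesis by blast
  qed
  have le: "card W \<le> Suc u - l" if W: "W \<subseteq> {1..n}" and t: "inj_on t {1..n}" "t ` W \<subseteq> {l..u}" for t W l u
  proof -
    have "card W = card (t ` W)" using t(1) W by (metis card_image inj_on_subset)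
    also have "\<dots> \<le> card {l..u}" using t(2) by (intro card_mono) auto
    finally show ?thesis by simp
  qed
  have im: "t ` inside_set {1..n} L U l u \<subseteq> {l..u}" if "\<forall>j\<in>{1..n}. L j \<le> t j \<and> t j \<le> U j" for t l u
  proof
    fix x assume "x \<in> t ` inside_set {1..n} L U l u"
    then obtain w where "w \<in> {1..n}" "l \<le> L w" "U w \<le> u" "x = t w" by (auto simp: inside_set_def)
    then show "x \<in> {l..u}" using that by fastforce
  qed
  have ins: "inside_set {1..n} L U l u \<subseteq> {1..n}" for l u by (auto simp: inside_set_def)
  have "hall_cond {1..n} L U"
    unfolding hall_cond_def
  proof (intro allI impI)
    fix l u :: nat
    \<comment> \<open>Any support will do; n \<ge> 1 guarantees that there is a bound to be
      supported.\<close>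
    obtain t where t: "inj_on t {1..n}" "\<forall>j\<in>{1..n}. L j \<le> t j \<and> t j \<le> U j"
      using sup[of 1 "L 1"] n by auto
    show "card (inside_set {1..n} L U l u) \<le> Suc u - l"
      by (rule le[OF ins t(1) im[OF t(2)]])
  qed
  moreover have "L v \<notin> {l..u} \<and> U v \<notin> {l..u}"
    if c: "cell n d v l u" and tight: "tight n L U l u" and v: "v \<notin> inside_set {1..n} L U l u" for v l u
  proof (rule ccontr)
    assume "\<not> ?thesis"
    then obtain a where a: "a = L v \<or> a = U v" "a \<in> {l..u}" by blast
    have v': "v \<in> {1..n}" using c by (auto simp: cell_def)
    obtain t where t: "inj_on t {1..n}" "t v = a" "\<forall>j\<in>{1..n}. L j \<le> t j \<and> t j \<le> U j"
      using sup[OF v' a(1)] by auto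
    have "card (insert v (inside_set {1..n} L U l u)) \<le> Suc u - l"
      using im[OF t(3)] ins t(2) a v' by (intro le[OF _ t(1)]) blast+
    then show False using tight v by (simp add: tight_def)
  qed
  ultimately show "bc_cond n d L U" using LU unfolding bc_cond_def by blast
qed

text \<open>By the order rules the false \<open>b(v,i)\<close> form an initial segment and the true
  ones a final segment of the indices, so two thresholds describe them. Consistency separates the
  segments, and sentinel and \<open>b(v,d)\<close> keep the thresholds within
  \<open>[1, d]\<close>.\<close>

lemma core_bounds:
  assumes nd: "1 \<le> n" "1 \<le> d"
    and C: "closed n d C" "consistent C" "fst ` C \<subseteq> core_atoms n d"
    and CB: "\<And>v. v \<in> {1..n} \<Longrightarrow> (B v 0, False) \<in> C \<and> (B v d, True) \<in> C"
  obtains L U where "bc_cond n d L U"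
    "\<And>v i. v \<in> {1..n} \<Longrightarrow> (B v i, False) \<in> C \<longleftrightarrow> i < L v"
    "\<And>v i. v \<in> {1..n} \<Longrightarrow> (B v i, True) \<in> C \<longleftrightarrow> U v \<le> i \<and> i \<le> d"
    "\<And>v. v \<in> {1..n} \<Longrightarrow> dom_of (full n d C) v = {L v..U v}"
proof -
  define L where "L v = (LEAST i. (B v i, False) \<notin> C)" for v
  define U where "U v = (LEAST i. (B v i, True) \<in> C)" for v
  have rng: "v \<in> {1..n}" "i \<le> d" if "(B v i, b) \<in> C" for v i b
    using C(3) that by force+
  have down: "(B v j, False) \<in> C" if "j \<le> i" "(B v i, False) \<in> C" for v i j
    using that
  proof (induction rule: inc_induct)
    case (step k)
    have "(B v (Suc k), False) \<in> C" by (rule step.IH[OF step.prems])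
    moreover from rng[OF this] have "v \<in> {1..n}" "k < d" by auto
    ultimately show ?case by (blast intro: closedD[OF C(1)] der.order_down)
  qed
  have up: "(B v j, True) \<in> C" if "i \<le> j" "j \<le> d" "(B v i, True) \<in> C" for v i j
    using that
  proof (induction j rule: dec_induct)
    case (step k)
    have "(B v k, True) \<in> C" using step by simp
    moreover from rng[OF this] step have "v \<in> {1..n}" "k < d" by auto
    ultimately show ?case by (blast intro: closedD[OF C(1)] der.order_up)
  qed
  have Liff: "(B v i, False) \<in> C \<longleftrightarrow> i < L v" if v: "v \<in> {1..n}" for v i
  proof
    assume i: "(B v i, False) \<in> C"
    have "(B v d, False) \<notin> C" using CB[OF v] C(2) by (auto simp: consistent_def)
    then have "(B v (L v), False) \<notin> C" unfolding L_def by (rule LeastI)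
    then show "i < L v" using down[OF _ i] by (metis not_le)
  next
    assume "i < L v"
    then show "(B v i, False) \<in> C" unfolding L_def using not_less_Least by blast
  qed
  have Uiff: "(B v i, True) \<in> C \<longleftrightarrow> U v \<le> i \<and> i \<le> d" if v: "v \<in> {1..n}" for v i
  proof
    assume "(B v i, True) \<in> C"
    then show "U v \<le> i \<and> i \<le> d" using rng unfolding U_def by (blast intro: Least_le)
  next
    have "(B v (U v), True) \<in> C" unfolding U_def by (rule LeastI[of _ d]) (use CB[OF v] in blast)
    then show "U v \<le> i \<and> i \<le> d \<Longrightarrow> (B v i, True) \<in> C" using up by blast
  qed
  have LU: "\<forall>v\<in>{1..n}. 1 \<le> L v \<and> L v \<le> U v \<and> U v \<le> d"
  proof
    fix v assume v: "v \<in> {1..n}"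
    have "0 < L v" "U v \<le> d" using CB[OF v] Liff[OF v] Uiff[OF v] by auto
    moreover have "L v \<le> U v"
    proof (rule ccontr)
      assume "\<not> L v \<le> U v"
      then have "(B v (U v), False) \<in> C" "(B v (U v), True) \<in> C" using Liff[OF v] Uiff[OF v] \<open>U v \<le> d\<close> by auto
      then show False using C(2) by (auto simp: consistent_def)
    qed
    ultimately show "1 \<le> L v \<and> L v \<le> U v \<and> U v \<le> d" by simp
  qed
  have dom: "dom_of (full n d C) v = {L v..U v}" if v: "v \<in> {1..n}" for v
  proof -
    have "(Atom (B v i), b) \<in> full n d C \<longleftrightarrow> (B v i, b) \<in> C \<and> i \<noteq> 0" for i b
      by (auto simp: full_Atom[OF C(3)])
    then have F: "{i. (Atom (B v i), False) \<in> full n d C} = {1..<L v}"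
      and T: "\<And>i. (Atom (B v i), True) \<in> full n d C \<longleftrightarrow> U v \<le> i \<and> i \<le> d"
      using Liff[OF v] Uiff[OF v] LU v by fastforce+
    have "(LEAST i. (Atom (B v i), True) \<in> full n d C) = U v"
      unfolding T using LU v by (intro Least_equality) auto
    moreover have "Max (insert 0 {1..<L v}) + 1 = L v"
    proof -
      have "1 \<le> L v" using LU v by blast
      then have "insert 0 {1..<L v} = {0..L v - 1}" by auto
      then have "Max (insert 0 {1..<L v}) = L v - 1" by simp
      then show ?thesis using \<open>1 \<le> L v\<close> by simp
    qed
    ultimately show ?thesis unfolding dom_of_def F by simp
  qed
  have RT: "(R w l u, True) \<in> C" if "w \<in> inside_set {1..n} L U l u" "1 \<le> l" "l \<le> u" "u \<le> d" for w l u
  proof -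
    have w: "w \<in> {1..n}" "l \<le> L w" "U w \<le> u" "cell n d w l u" using that by (auto simp: inside_set_def cell_def)
    then have "(B w (l - 1), False) \<in> C" "(B w u, True) \<in> C" using that Liff[OF w(1)] Uiff[OF w(1)] by auto
    then show ?thesis using closed_cellD(3)[OF C(1) w(4)] by blast
  qed
  have RF: "(R v l u, False) \<in> C"
    if c: "cell n d v l u" and S: "S \<subseteq> inside_set {1..n} L U l u - {v}" "card S = Suc (u - l)" for v l u S
    by (rule closedD[OF C(1)], rule der.hall[OF c _ S(2)])
      (use S RT c in \<open>auto simp: cell_def inside_set_def\<close>)
  have "hall_cond {1..n} L U"
  proof (rule hall_condI[OF LU], rule ccontr)
    fix l u assume lu: "1 \<le> l" "l \<le> u" "u \<le> d" and "\<not> card (inside_set {1..n} L U l u) \<le> Suc u - l"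
    then have big: "card (inside_set {1..n} L U l u) > Suc (u - l)" by simp
    then obtain v where v: "v \<in> inside_set {1..n} L U l u" by fastforce
    \<comment> \<open>Even without v there are enough variables to fill the interval. So
      \<open>hall\<close> excludes v, although its own bounds put it inside.\<close>
    then have "card (inside_set {1..n} L U l u - {v}) \<ge> Suc (u - l)" using big by simp
    then obtain S where S: "S \<subseteq> inside_set {1..n} L U l u - {v}" "card S = Suc (u - l)"
      by (meson obtain_subset_with_card_n)
    have "cell n d v l u" using v lu by (auto simp: cell_def inside_set_def)
    from RF[OF this S] RT[OF v lu] show False using C(2) by (auto simp: consistent_def)
  qed
  moreover have "L v \<notin> {l..u} \<and> U v \<notin> {l..u}"
    if c: "cell n d v l u" and t: "tight n L U l u" and v: "v \<notin> inside_set {1..n} L U l u" for v l u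
  proof -
    have lu: "v \<in> {1..n}" "1 \<le> l" "l \<le> u" "u \<le> d" using c by (auto simp: cell_def)
    have "(R v l u, False) \<in> C"
      using v t lu by (intro RF[OF c, of "inside_set {1..n} L U l u"]) (auto simp: tight_def)
    note R = closed_cellD(4,5)[OF C(1) c this]
    have "l - 1 < L v \<longrightarrow> u < L v" using R(1) Liff[OF lu(1)] by blast
    moreover have "U v \<le> u \<longrightarrow> U v \<le> l - 1" using R(2) Uiff[OF lu(1)] lu(4) by blast
    ultimately show ?thesis using lu by auto
  qed
  ultimately have "bc_cond n d L U" using LU unfolding bc_cond_def by blast
  then show thesis using that Liff Uiff dom by blast
qed

text \<open>A bound consistent family that is not empty yields, through \<open>canon\<close>, a
  consistent closed set above the initial literals, and the least closed set lies below it. So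
  propagation never removes a value that such a family keeps, and it finds a contradiction only if
  there is no such family.\<close>

theorem alldiff_enforces_bc:
  assumes nd: "1 \<le> n" "1 \<le> d"
  shows "up_enforces_bc n d (alldiff_program n d) (alldifferent n d)"
  unfolding up_enforces_bc_def
proof (intro allI impI)
  fix p q assume pq: "init_domains n d p q"
  let ?P = "alldiff_program n d" and ?X = "start_core n d p q" and ?K = "alldifferent n d"
  let ?C = "cl n d ?X" and ?D = "\<lambda>v. {p v..q v}"
  have pq': "1 \<le> p v" "p v \<le> q v" "q v \<le> d" if "v \<in> {1..n}" for v
    using pq that by (auto simp: init_domains_def)
  have sound: "\<exists>L U. bc_cond n d L U \<and> (\<forall>v\<in>{1..n}. E v = {L v..U v}) \<and> ?C \<subseteq> canon n d L U"
    if E: "bc_subdomains n ?K ?D E" and i: "i \<in> {1..n}" "E i \<noteq> {}" for E i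
  proof -
    \<comment> \<open>A support takes a value from every other domain, so one nonempty domain makes
      all of them nonempty.\<close>
    obtain t where "bound_support n ?K E i (Min (E i)) t"
      using E i unfolding bc_subdomains_def bound_consistent_def by blast
    then have ne: "E j \<noteq> {}" if "j \<in> {1..n}" for j
      using that i unfolding bound_support_def by (cases "j = i") auto
    have "\<forall>v\<in>{1..n}. \<exists>a b. E v = {a..b}" using E by (auto simp: bc_subdomains_def interval_def)
    then obtain L U where LU: "\<forall>v\<in>{1..n}. E v = {L v..U v}" by metis
    have rng: "L v \<le> U v \<and> p v \<le> L v \<and> U v \<le> q v" if v: "v \<in> {1..n}" for v
    proof -
      have "E v = {L v..U v}" "L v \<le> U v" using LU ne[OF v] v by auto
      moreover have "E v \<subseteq> {p v..q v}" using E v by (auto simp: bc_subdomains_def)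
      ultimately show ?thesis by auto
    qed
    have "\<forall>v\<in>{1..n}. 1 \<le> L v \<and> L v \<le> U v \<and> U v \<le> d" using rng pq' by fastforce
    then have bc: "bc_cond n d L U"
      using bound_consistent_iff[OF nd(1) _ LU] E by (auto simp: bc_subdomains_def)
    have "?X \<subseteq> canon n d L U"
    proof
      fix x assume "x \<in> ?X"
      then obtain v where v: "v \<in> {1..n}"
        "x \<in> {(B v 0, False), (B v d, True), (B v (p v - 1), False), (B v (q v), True)}"
        by (auto simp: start_core_def)
      have "0 < L v" "U v \<le> d" "p v - 1 < L v" "U v \<le> q v" "q v \<le> d"
        using rng[OF v(1)] pq'[OF v(1)] by linarith+
      then show "x \<in> canon n d L U" using v by (elim insertE) (simp_all add: canon_iff)
    qed
    then show ?thesis using bc LU cl_least closed_canon by blast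
  qed
  show "\<exists>D'. bc_enforced n ?K ?D D' \<and>
      (conflict (nogoods ?P) (root n ?P p q) \<longleftrightarrow> bc_fails n D') \<and>
      (\<not> conflict (nogoods ?P) (root n ?P p q) \<longrightarrow> (\<forall>v\<in>{1..n}. dom_of (root n ?P p q) v = D' v))"
  proof (cases "consistent ?C")
    case False
    have empty: "E i = {}" if "bc_subdomains n ?K ?D E" "i \<in> {1..n}" for E i
      using sound[OF that] False consistent_canon consistent_mono by blast
    \<comment> \<open>By \<open>empty\<close>, every bound consistent family is empty everywhere.
      The empty family has no bounds to support, so it is itself one, and the largest.\<close>
    have "bc_enforced n ?K ?D (\<lambda>_. {})"
      unfolding bc_enforced_def
    proof (intro conjI allI impI ballI)
      have "{} = {1..0::nat}" by simp
      then have "interval {}" unfolding interval_def by blast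
      then show "bc_subdomains n ?K ?D (\<lambda>_. {})"
        by (simp add: bc_subdomains_def bound_consistent_def)
    qed (use empty in auto)
    moreover have "bc_fails n (\<lambda>_. {})" using nd by (auto simp: bc_fails_def)
    ultimately show ?thesis using False root_conflict[OF nd pq] by blast
  next
    case True
    have XC: "?X \<subseteq> ?C" by (rule subset_cl)
    have CB: "(B v 0, False) \<in> ?C \<and> (B v d, True) \<in> ?C" if "v \<in> {1..n}" for v
      using start_coreI[OF that] XC by blast
    obtain L U where bc: "bc_cond n d L U"
      and L: "\<And>v i. v \<in> {1..n} \<Longrightarrow> (B v i, False) \<in> ?C \<longleftrightarrow> i < L v"
      and U: "\<And>v i. v \<in> {1..n} \<Longrightarrow> (B v i, True) \<in> ?C \<longleftrightarrow> U v \<le> i \<and> i \<le> d"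
      and dom: "\<And>v. v \<in> {1..n} \<Longrightarrow> dom_of (full n d ?C) v = {L v..U v}"
      using core_bounds[OF nd closed_cl True cl_core[OF start_core_atoms[OF pq]] CB] by blast
    let ?D' = "\<lambda>v. {L v..U v}"
    have LU: "\<forall>v\<in>{1..n}. 1 \<le> L v \<and> L v \<le> U v \<and> U v \<le> d" using bc by (auto simp: bc_cond_def)
    have sub: "?D' v \<subseteq> ?D v" if v: "v \<in> {1..n}" for v
    proof -
      have "(B v (p v - 1), False) \<in> ?X" "(B v (q v), True) \<in> ?X"
        unfolding start_core_def using v by blast+
      then have "(B v (p v - 1), False) \<in> ?C" "(B v (q v), True) \<in> ?C" using XC by blast+
      then show ?thesis using L[OF v] U[OF v] by auto
    qed
    have "bc_enforced n ?K ?D ?D'"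
      unfolding bc_enforced_def
    proof (intro conjI allI impI ballI)
      show "bc_subdomains n ?K ?D ?D'"
        using sub bound_consistent_iff[OF nd(1) LU, of ?D'] bc
        by (auto simp: bc_subdomains_def interval_def)
    next
      fix E i assume E: "bc_subdomains n ?K ?D E" and i: "i \<in> {1..n}"
      show "E i \<subseteq> ?D' i"
      proof (cases "E i = {}")
        case False
        obtain L' U' where E': "bc_cond n d L' U'" "E i = {L' i..U' i}" "?C \<subseteq> canon n d L' U'"
          using sound[OF E i False] i by blast
        \<comment> \<open>Membership of these two literals in \<open>canon\<close> says
          \<open>L i \<le> L' i\<close> and \<open>U' i \<le> U i\<close>.\<close>
        have "(B i (L i - 1), False) \<in> canon n d L' U'" "(B i (U i), True) \<in> canon n d L' U'"
          using E'(3) L[OF i] U[OF i] LU i by force+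
        then show ?thesis using E'(2) LU i by (auto simp: canon_iff)
      qed simp
    qed
    moreover have "\<not> bc_fails n ?D'" using LU by (auto simp: bc_fails_def)
    moreover have "\<forall>v\<in>{1..n}. dom_of (root n ?P p q) v = ?D' v"
      using dom root_full[OF nd pq True] by simp
    ultimately show ?thesis using True root_conflict[OF nd pq] by blast
  qed
qed

section \<open>A propagation algorithm\<close>

text \<open>\<open>stk\<close> lists the assigned atoms whose consequences have not been drawn yet,
  \<open>don\<close> the intervals whose variables have been scanned, and \<open>cfl\<close> is the
  conflict flag.\<close>

record pstate =
  vals :: "(atom \<times> bool) set"
  stk :: "atom list"
  don :: "(nat \<times> nat) set"
  cfl :: bool

text \<open>A contradicting literal raises the flag but is not stored. So \<open>vals\<close> stays
  consistent and fits into one memory cell per atom.\<close>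

fun enq :: "atom \<times> bool \<Rightarrow> pstate \<Rightarrow> pstate" where
  "enq (a, b) \<sigma> =
     (if (a, True) \<in> vals \<sigma> \<or> (a, False) \<in> vals \<sigma> then \<sigma>\<lparr>cfl := cfl \<sigma> \<or> (a, \<not> b) \<in> vals \<sigma>\<rparr>
      else \<sigma>\<lparr>vals := insert (a, b) (vals \<sigma>), stk := stk \<sigma> @ [a]\<rparr>)"

text \<open>The consequences are computed from a snapshot X, although enqueuing the first of them
  may change the triple. Such a change puts an atom of the triple on the stack and so causes another
  check.\<close>

definition cell_cons :: "(atom \<times> bool) set \<Rightarrow> nat \<Rightarrow> nat \<Rightarrow> nat \<Rightarrow> (atom \<times> bool) list" where
  "cell_cons X v l u =
     (if (B v (l - 1), True) \<in> X then [(R v l u, False)] else []) @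
     (if (B v u, False) \<in> X then [(R v l u, False)] else []) @
     (if (B v (l - 1), False) \<in> X \<and> (B v u, True) \<in> X then [(R v l u, True)] else []) @
     (if (R v l u, True) \<in> X then [(B v (l - 1), False), (B v u, True)] else []) @
     (if (R v l u, False) \<in> X \<and> (B v (l - 1), False) \<in> X then [(B v u, False)] else []) @
     (if (R v l u, False) \<in> X \<and> (B v u, True) \<in> X then [(B v (l - 1), True)] else [])"

definition order_cons :: "nat \<Rightarrow> (atom \<times> bool) set \<Rightarrow> nat \<Rightarrow> nat \<Rightarrow> (atom \<times> bool) list" where
  "order_cons d X v i =
     (if (B v i, True) \<in> X \<and> i < d then [(B v (Suc i), True)] else []) @
     (if (B v i, False) \<in> X \<and> 0 < i then [(B v (i - 1), False)] else [])"

definition check :: "nat \<Rightarrow> nat \<Rightarrow> nat \<Rightarrow> pstate \<Rightarrow> pstate" where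
  "check v l u \<sigma> = fold enq (cell_cons (vals \<sigma>) v l u) \<sigma>"

definition true_count :: "nat \<Rightarrow> (atom \<times> bool) set \<Rightarrow> nat \<Rightarrow> nat \<Rightarrow> nat" where
  "true_count n X l u = card {w \<in> {1..n}. (R w l u, True) \<in> X}"

text \<open>The counter includes true atoms that are still on the stack. Hence a scan may be early,
  but never late: when the last premise of a \<open>hall\<close> inference is processed, all of them
  have been counted.\<close>

definition hall_trigger :: "nat \<Rightarrow> nat \<Rightarrow> nat \<Rightarrow> nat \<Rightarrow> pstate \<Rightarrow> bool" where
  "hall_trigger n v l u \<sigma> \<longleftrightarrow>
     (R v l u, True) \<in> vals \<sigma> \<and> (l, u) \<notin> don \<sigma> \<and> u - l < true_count n (vals \<sigma>) l u"

text \<open>An overfull interval makes \<open>enq\<close> detect a conflict, because some true atom is then set to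
  false.\<close>

definition exclude :: "nat \<Rightarrow> nat \<Rightarrow> nat \<Rightarrow> nat \<Rightarrow> pstate \<Rightarrow> pstate" where
  "exclude n l u w \<sigma> =
     (if (R w l u, True) \<notin> vals \<sigma> \<or> Suc (u - l) < true_count n (vals \<sigma>) l u
      then enq (R w l u, False) \<sigma> else \<sigma>)"

definition hall_step :: "nat \<Rightarrow> nat \<Rightarrow> nat \<Rightarrow> nat \<Rightarrow> pstate \<Rightarrow> pstate" where
  "hall_step n v l u \<sigma> =
     (if hall_trigger n v l u \<sigma>
      then fold (exclude n l u) [1..<Suc n] (\<sigma>\<lparr>don := insert (l, u) (don \<sigma>)\<rparr>) else \<sigma>)"

fun process :: "nat \<Rightarrow> nat \<Rightarrow> atom \<Rightarrow> pstate \<Rightarrow> pstate" where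
  "process n d (B v i) \<sigma> =
     fold (\<lambda>l. check v l i) [1..<Suc i]
       (fold (\<lambda>u. check v (Suc i) u) [Suc i..<Suc d]
         (fold enq (order_cons d (vals \<sigma>) v i) \<sigma>))"
| "process n d (R v l u) \<sigma> = hall_step n v l u (check v l u \<sigma>)"
| "process n d a \<sigma> = \<sigma>"

definition pop :: "pstate \<Rightarrow> pstate" where
  "pop \<sigma> = \<sigma>\<lparr>stk := butlast (stk \<sigma>)\<rparr>"

definition cells :: "nat \<Rightarrow> (nat \<times> nat) set" where
  "cells d = {(l, u). 1 \<le> l \<and> l \<le> u \<and> u \<le> d}"

text \<open>The weights pay for the steps of the random access machine: \<open>wt d a\<close> for processing \<open>a\<close>, another
  \<open>100\<close> for a possible decision on \<open>a\<close>, and \<open>100 * (n + 1)\<close> for the one scan of all variables once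
  an interval is full.\<close>

fun wt :: "nat \<Rightarrow> atom \<Rightarrow> nat" where
  "wt d (B v i) = 400 * (d + 1)"
| "wt d a = 400"

definition pot :: "nat \<Rightarrow> nat \<Rightarrow> pstate \<Rightarrow> nat" where
  "pot n d \<sigma> = (\<Sum>a\<in>core_atoms n d - fst ` vals \<sigma>. wt d a + 100) + sum_list (map (wt d) (stk \<sigma>)) +
     100 * (n + 1) * card (cells d - don \<sigma>)"

definition good :: "nat \<Rightarrow> nat \<Rightarrow> (atom \<times> bool) set \<Rightarrow> pstate \<Rightarrow> bool" where
  "good n d C \<sigma> \<longleftrightarrow> vals \<sigma> \<subseteq> C \<and> consistent (vals \<sigma>) \<and> fst ` vals \<sigma> \<subseteq> core_atoms n d \<and>
     set (stk \<sigma>) \<subseteq> core_atoms n d \<and> (cfl \<sigma> \<longrightarrow> \<not> consistent C)"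

text \<open>New literals are on the stack, so the set of processed literals does not grow.
  \<open>don\<close> is fixed, because only the start of a scan changes it, and
  \<open>hall_step_good\<close> treats that separately.\<close>

definition extends :: "nat \<Rightarrow> nat \<Rightarrow> pstate \<Rightarrow> pstate \<Rightarrow> bool" where
  "extends n d \<sigma> \<sigma>' \<longleftrightarrow> vals \<sigma> \<subseteq> vals \<sigma>' \<and> fst ` (vals \<sigma>' - vals \<sigma>) \<subseteq> set (stk \<sigma>') \<and>
     set (stk \<sigma>) \<subseteq> set (stk \<sigma>') \<and> don \<sigma>' = don \<sigma> \<and> (cfl \<sigma> \<longrightarrow> cfl \<sigma>') \<and> pot n d \<sigma>' \<le> pot n d \<sigma>"

lemma ext_refl [simp]: "extends n d \<sigma> \<sigma>"
  by (simp add: extends_def)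

lemma ext_trans: "extends n d \<sigma> \<tau> \<Longrightarrow> extends n d \<tau> \<rho> \<Longrightarrow> extends n d \<sigma> \<rho>"
proof -
  assume 1: "extends n d \<sigma> \<tau>" and 2: "extends n d \<tau> \<rho>"
  then have "vals \<rho> - vals \<sigma> \<subseteq> (vals \<rho> - vals \<tau>) \<union> (vals \<tau> - vals \<sigma>)" by blast
  moreover have "fst ` (vals \<rho> - vals \<tau>) \<subseteq> set (stk \<rho>)" "fst ` (vals \<tau> - vals \<sigma>) \<subseteq> set (stk \<rho>)"
    using 1 2 by (auto simp: extends_def)
  ultimately have "fst ` (vals \<rho> - vals \<sigma>) \<subseteq> set (stk \<rho>)" by blast
  then show ?thesis using 1 2 by (auto simp: extends_def)
qed

lemma finite_core_atoms [simp]: "finite (core_atoms n d)"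
proof -
  have "core_atoms n d \<subseteq> (\<lambda>(v, i). B v i) ` ({1..n} \<times> {..d}) \<union>
      (\<lambda>(v, l, u). R v l u) ` ({1..n} \<times> {..d} \<times> {..d})"
    by (force simp: core_atoms_def cell_def)
  then show ?thesis by (rule finite_subset) auto
qed

lemma finite_cells [simp]: "finite (cells d)"
  by (rule finite_subset[of _ "{..d} \<times> {..d}"]) (auto simp: cells_def)

text \<open>Setting an atom moves its weight from the unassigned atoms to the stack. The surplus of
  100 is released, and pays for the decision if the atom was set by one.\<close>

lemma pot_insert:
  assumes "a \<in> core_atoms n d" "a \<notin> fst ` vals \<sigma>"
  shows "pot n d \<sigma> = pot n d (\<sigma>\<lparr>vals := insert (a, b) (vals \<sigma>), stk := stk \<sigma> @ [a]\<rparr>) + 100"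
proof -
  let ?S = "core_atoms n d - fst ` insert (a, b) (vals \<sigma>)"
  have eq: "core_atoms n d - fst ` vals \<sigma> = insert a ?S"
    using assms by auto
  have "(\<Sum>x\<in>insert a ?S. wt d x + 100) = wt d a + 100 + (\<Sum>x\<in>?S. wt d x + 100)"
    by (rule sum.insert) auto
  then show ?thesis unfolding pot_def eq by simp
qed

lemma consistent_insert:
  "consistent X \<Longrightarrow> (a, True) \<notin> X \<Longrightarrow> (a, False) \<notin> X \<Longrightarrow> consistent (insert (a, b) X)"
  by (cases b) (auto simp: consistent_def)

lemma enq_good:
  assumes g: "good n d C \<sigma>" and e: "e \<in> C" "fst e \<in> core_atoms n d"
  shows "good n d C (enq e \<sigma>)" "extends n d \<sigma> (enq e \<sigma>)" "\<not> cfl (enq e \<sigma>) \<Longrightarrow> e \<in> vals (enq e \<sigma>)"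
proof -
  obtain a b where ab: "e = (a, b)" by (cases e)
  have "good n d C (enq e \<sigma>) \<and> extends n d \<sigma> (enq e \<sigma>) \<and> (\<not> cfl (enq e \<sigma>) \<longrightarrow> e \<in> vals (enq e \<sigma>))"
  proof (cases "(a, True) \<in> vals \<sigma> \<or> (a, False) \<in> vals \<sigma>")
    case True
    have "(a, \<not> b) \<in> vals \<sigma> \<Longrightarrow> \<not> consistent C"
      using g e consistentD[of C a b] by (auto simp: good_def ab)
    moreover have "(a, \<not> b) \<notin> vals \<sigma> \<Longrightarrow> (a, b) \<in> vals \<sigma>" using True by (cases b) auto
    ultimately show ?thesis using True g by (auto simp: good_def extends_def pot_def ab)
  next
    case False
    have a: "a \<notin> fst ` vals \<sigma>"
    proof
      assume "a \<in> fst ` vals \<sigma>"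
      then obtain b' where "(a, b') \<in> vals \<sigma>" by auto
      then show False using False by (cases b') auto
    qed
    have "pot n d (enq e \<sigma>) \<le> pot n d \<sigma>"
      using pot_insert[of a n d \<sigma> b] a e False by (simp add: ab)
    then show ?thesis using False g e consistent_insert[of "vals \<sigma>" a b]
      by (auto simp: good_def extends_def ab)
  qed
  then show "good n d C (enq e \<sigma>)" "extends n d \<sigma> (enq e \<sigma>)" "\<not> cfl (enq e \<sigma>) \<Longrightarrow> e \<in> vals (enq e \<sigma>)"
    by blast+
qed

declare enq.simps [simp del]

text \<open>\<theta> is an earlier state from which the iterations may take a snapshot. As Q is
  monotone, what one iteration achieves survives the later ones.\<close>

lemma fold_cover:
  assumes "\<And>x \<tau>. x \<in> set xs \<Longrightarrow> good n d C \<tau> \<Longrightarrow> extends n d \<theta> \<tau> \<Longrightarrow>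
      good n d C (f x \<tau>) \<and> extends n d \<tau> (f x \<tau>) \<and> (\<not> cfl (f x \<tau>) \<longrightarrow> Q x (vals (f x \<tau>)))"
    and "\<And>x Z Z'. Q x Z \<Longrightarrow> Z \<subseteq> Z' \<Longrightarrow> Q x Z'"
    and "good n d C \<sigma>" "extends n d \<theta> \<sigma>"
  shows "good n d C (fold f xs \<sigma>) \<and> extends n d \<sigma> (fold f xs \<sigma>) \<and>
    (\<not> cfl (fold f xs \<sigma>) \<longrightarrow> (\<forall>x\<in>set xs. Q x (vals (fold f xs \<sigma>))))"
  using assms(1,3,4)
proof (induction xs arbitrary: \<sigma>)
  case (Cons x xs)
  have x: "good n d C (f x \<sigma>)" "extends n d \<sigma> (f x \<sigma>)" "\<not> cfl (f x \<sigma>) \<longrightarrow> Q x (vals (f x \<sigma>))"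
    using Cons.prems by auto
  have x0: "extends n d \<theta> (f x \<sigma>)" using Cons.prems(3) x(2) by (rule ext_trans)
  have IH: "good n d C (fold f xs (f x \<sigma>)) \<and> extends n d (f x \<sigma>) (fold f xs (f x \<sigma>)) \<and>
    (\<not> cfl (fold f xs (f x \<sigma>)) \<longrightarrow> (\<forall>y\<in>set xs. Q y (vals (fold f xs (f x \<sigma>)))))"
    using Cons.IH[of "f x \<sigma>"] Cons.prems(1) x(1) x0 by simp
  then have "extends n d \<sigma> (fold f xs (f x \<sigma>))" using x(2) ext_trans by blast
  moreover have "\<not> cfl (fold f xs (f x \<sigma>)) \<longrightarrow> Q x (vals (fold f xs (f x \<sigma>)))"
    using IH x(3) assms(2) unfolding extends_def by blast
  ultimately show ?case using IH by auto
qed auto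

lemma fold_enq:
  assumes "good n d C \<sigma>" "set es \<subseteq> C" "fst ` set es \<subseteq> core_atoms n d"
  shows "good n d C (fold enq es \<sigma>) \<and> extends n d \<sigma> (fold enq es \<sigma>) \<and>
    (\<not> cfl (fold enq es \<sigma>) \<longrightarrow> set es \<subseteq> vals (fold enq es \<sigma>))"
proof -
  have "good n d C (fold enq es \<sigma>) \<and> extends n d \<sigma> (fold enq es \<sigma>) \<and>
    (\<not> cfl (fold enq es \<sigma>) \<longrightarrow> (\<forall>e\<in>set es. e \<in> vals (fold enq es \<sigma>)))"
  proof (rule fold_cover[where \<theta> = \<sigma> and Q = "\<lambda>e Z. e \<in> Z"])
    fix e \<tau> assume "e \<in> set es" "good n d C \<tau>"
    then show "good n d C (enq e \<tau>) \<and> extends n d \<tau> (enq e \<tau>) \<and> (\<not> cfl (enq e \<tau>) \<longrightarrow> e \<in> vals (enq e \<tau>))"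
      using enq_good[of n d C \<tau> e] assms(2,3) by blast
  qed (use assms(1) in auto)
  then show ?thesis by blast
qed

lemma cell_cons_der: "cell n d v l u \<Longrightarrow> e \<in> set (cell_cons X v l u) \<Longrightarrow> der n d X e"
  by (auto simp: cell_cons_def simp del: One_nat_def split: if_splits
      intro: der.outside_left der.outside_right der.inside der.lower der.upper
        der.prune_lower der.prune_upper)

lemma order_cons_der:
  assumes "v \<in> {1..n}" "i \<le> d" "e \<in> set (order_cons d X v i)"
  shows "der n d X e"
proof -
  consider "(B v i, True) \<in> X" "i < d" "e = (B v (Suc i), True)"
    | "(B v i, False) \<in> X" "0 < i" "e = (B v (i - 1), False)"
    using assms by (auto simp: order_cons_def split: if_splits)
  then show ?thesis
  proof cases
    case 1
    then show ?thesis using assms(1) der.order_up by blast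
  next
    case 2
    then show ?thesis using assms(1,2) der.order_down[of v n "i - 1" d X] by simp
  qed
qed

lemma check_good:
  assumes "good n d C \<sigma>" "closed n d C" "cell n d v l u"
  shows "good n d C (check v l u \<sigma>) \<and> extends n d \<sigma> (check v l u \<sigma>) \<and>
    (\<not> cfl (check v l u \<sigma>) \<longrightarrow> set (cell_cons (vals \<sigma>) v l u) \<subseteq> vals (check v l u \<sigma>))"
proof -
  have "der n d (vals \<sigma>) e" if "e \<in> set (cell_cons (vals \<sigma>) v l u)" for e
    using cell_cons_der[OF assms(3) that] .
  moreover have "vals \<sigma> \<subseteq> C" using assms(1) by (simp add: good_def)
  ultimately have "set (cell_cons (vals \<sigma>) v l u) \<subseteq> C"
    "fst ` set (cell_cons (vals \<sigma>) v l u) \<subseteq> core_atoms n d"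
    using der_mono closedD[OF assms(2)] der_core by blast+
  then show ?thesis unfolding check_def by (rule fold_enq[OF assms(1)])
qed

section \<open>The invariant of propagation\<close>

definition done_ok :: "nat \<Rightarrow> pstate \<Rightarrow> bool" where
  "done_ok n \<sigma> \<longleftrightarrow> (\<forall>(l, u)\<in>don \<sigma>. (\<forall>w\<in>{1..n}. R w l u \<in> fst ` vals \<sigma>) \<and>
     true_count n (vals \<sigma>) l u \<le> Suc (u - l))"

text \<open>All r-atoms of a scanned interval are assigned, so consistency freezes them and their
  count.\<close>

lemma done_ok_ext:
  assumes "done_ok n \<sigma>" "extends n d \<sigma> \<sigma>'" "consistent (vals \<sigma>')"
  shows "done_ok n \<sigma>'"
  unfolding done_ok_def
proof (intro ballI, clarify)
  fix l u assume "(l, u) \<in> don \<sigma>'"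
  then have lu: "\<forall>w\<in>{1..n}. R w l u \<in> fst ` vals \<sigma>" "true_count n (vals \<sigma>) l u \<le> Suc (u - l)"
    using assms(1,2) by (auto simp: done_ok_def extends_def)
  have sub: "vals \<sigma> \<subseteq> vals \<sigma>'" using assms(2) by (simp add: extends_def)
  have "(R w l u, True) \<in> vals \<sigma>" if w: "w \<in> {1..n}" "(R w l u, True) \<in> vals \<sigma>'" for w
  proof -
    obtain b where "(R w l u, b) \<in> vals \<sigma>" using lu(1) w(1) by force
    moreover have "b" using calculation sub w(2) assms(3) consistentD by (cases b) fastforce+
    ultimately show ?thesis by simp
  qed
  then have "{w \<in> {1..n}. (R w l u, True) \<in> vals \<sigma>'} = {w \<in> {1..n}. (R w l u, True) \<in> vals \<sigma>}"
    using sub by blast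
  then have "true_count n (vals \<sigma>') l u \<le> Suc (u - l)" using lu(2) by (simp add: true_count_def)
  then show "(\<forall>w\<in>{1..n}. R w l u \<in> fst ` vals \<sigma>') \<and> true_count n (vals \<sigma>') l u \<le> Suc (u - l)"
    using lu(1) sub by blast
qed

definition pending_free :: "pstate \<Rightarrow> (atom \<times> bool) set" where
  "pending_free \<sigma> = {x \<in> vals \<sigma>. fst x \<notin> set (stk \<sigma>)}"

text \<open>Only consequences of processed literals have to be present, which becomes closedness
  when the stack is empty. After a conflict just soundness is kept.\<close>

definition prop_inv :: "nat \<Rightarrow> nat \<Rightarrow> (atom \<times> bool) set \<Rightarrow> pstate \<Rightarrow> bool" where
  "prop_inv n d X \<sigma> \<longleftrightarrow> good n d (cl n d X) \<sigma> \<and> don \<sigma> \<subseteq> cells d \<and>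
     (\<not> cfl \<sigma> \<longrightarrow> X \<subseteq> vals \<sigma> \<and> done_ok n \<sigma> \<and> (\<forall>e. der n d (pending_free \<sigma>) e \<longrightarrow> e \<in> vals \<sigma>))"

lemma pending_free_ext: "extends n d \<sigma> \<sigma>' \<Longrightarrow> pending_free \<sigma>' \<subseteq> pending_free \<sigma>"
  by (force simp: pending_free_def extends_def)

lemma cell_cons_subset:
  assumes "\<And>x. x \<in> Y \<Longrightarrow> fst x \<in> {B v (l - 1), B v u, R v l u} \<Longrightarrow> x \<in> Z"
  shows "set (cell_cons Y v l u) \<subseteq> set (cell_cons Z v l u)"
  unfolding cell_cons_def set_append by (intro Un_mono) (use assms in auto)

lemma order_cons_subset:
  assumes "\<And>b. (B v i, b) \<in> Y \<Longrightarrow> (B v i, b) \<in> Z"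
  shows "set (order_cons d Y v i) \<subseteq> set (order_cons d Z v i)"
  unfolding order_cons_def set_append by (intro Un_mono) (use assms in auto)

lemma der_cons:
  assumes "der n d X e"
  obtains v l u where "cell n d v l u" "e \<in> set (cell_cons X v l u)"
    | v i where "v \<in> {1..n}" "i \<le> d" "e \<in> set (order_cons d X v i)"
    | v l u S where "e = (R v l u, False)" "cell n d v l u" "S \<subseteq> {1..n} - {v}"
      "card S = Suc (u - l)" "\<And>w. w \<in> S \<Longrightarrow> (R w l u, True) \<in> X"
  using assms
proof cases
  case (order_up v i)
  then show ?thesis by (intro that(2)[of v i]) (auto simp: order_cons_def)
next
  case (order_down v i)
  then show ?thesis by (intro that(2)[of v "Suc i"]) (auto simp: order_cons_def)
next
  case (hall v l u S)
  then show ?thesis by (intro that(3)[of v l u S])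
qed (rule that(1), assumption, simp add: cell_cons_def)+

text \<open>An inference that becomes possible when a is taken off the stack has a literal on a
  among its premises. So it concerns a triple containing a, a neighbour of a in the order, or the
  interval of a; these are the places that \<open>process\<close> visits.\<close>

lemma der_split:
  assumes der: "der n d Y' e" and sub: "Y' \<subseteq> Y \<union> {x. fst x = a}"
  obtains "der n d Y e"
    | v l u where "cell n d v l u" "a \<in> {B v (l - 1), B v u, R v l u}" "e \<in> set (cell_cons Y' v l u)"
    | v i where "v \<in> {1..n}" "i \<le> d" "a = B v i" "e \<in> set (order_cons d Y' v i)"
    | v l u w S where "cell n d v l u" "a = R v l u" "(a, True) \<in> Y'" "w \<in> {1..n}"
      "e = (R w l u, False)" "S \<subseteq> {1..n} - {w}" "card S = Suc (u - l)" "\<And>x. x \<in> S \<Longrightarrow> (R x l u, True) \<in> Y'"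
  using der
proof (cases rule: der_cons)
  case (1 v l u)
  show ?thesis
  proof (cases "a \<in> {B v (l - 1), B v u, R v l u}")
    case False
    have "set (cell_cons Y' v l u) \<subseteq> set (cell_cons Y v l u)"
      using False sub by (intro cell_cons_subset) blast
    then show ?thesis using 1 cell_cons_der that(1) by blast
  qed (use 1 that(2) in blast)
next
  case (2 v i)
  show ?thesis
  proof (cases "a = B v i")
    case False
    have "set (order_cons d Y' v i) \<subseteq> set (order_cons d Y v i)"
      using False sub by (intro order_cons_subset) auto
    then show ?thesis using 2 order_cons_der that(1) by blast
  qed (use 2 that(3) in blast)
next
  case (3 v l u S)
  have v: "v \<in> {1..n}" using 3(2) by (simp add: cell_def)
  show ?thesis
  proof (cases "\<exists>w\<in>S. a = R w l u")
    case True
    then obtain w where w: "w \<in> S" "a = R w l u" by blast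
    have "cell n d w l u" using 3(2,3) w by (auto simp: cell_def)
    then show ?thesis using 3 w v by (intro that(4)[of w l u v S]) auto
  next
    case False
    have "(R w l u, True) \<in> Y" if "w \<in> S" for w
    proof -
      have "fst (R w l u, True) \<noteq> a" using False that by auto
      then show ?thesis using 3(5)[OF that] sub by blast
    qed
    then have "der n d Y e" unfolding 3(1) using 3(2-4) by (intro der.hall[where S = S])
    then show ?thesis by (rule that(1))
  qed
qed

lemma enq_True_iff: "(x, True) \<in> vals (enq (a, False) \<sigma>) \<longleftrightarrow> (x, True) \<in> vals \<sigma>"
  by (auto simp: enq.simps)

lemma fold_exclude_True:
  "(x, True) \<in> vals (fold (exclude n l u) ws \<sigma>) \<longleftrightarrow> (x, True) \<in> vals \<sigma>"
  by (induction ws arbitrary: \<sigma>) (auto simp: exclude_def enq_True_iff)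

text \<open>The premises of \<open>hall\<close> must not include w itself; so if w is among the true
  variables, one more than k + 1 of them is required.\<close>

lemma obtain_hall_set:
  assumes "Suc k \<le> card T" "w \<notin> T \<or> Suc k < card T" "finite T"
  obtains S where "S \<subseteq> T - {w}" "card S = Suc k"
proof -
  have "Suc k \<le> card (T - {w})" using assms by (cases "w \<in> T") auto
  then show thesis using obtain_subset_with_card_n that by metis
qed

text \<open>A scan is paid for by its interval leaving \<open>cells d - don\<close>. Each literal it
  enqueues follows by \<open>hall\<close>, since the count at its start can only grow
  meanwhile.\<close>

lemma hall_step_good:
  assumes g: "good n d C \<sigma>" and C: "closed n d C" and c: "cell n d v l u"
    and ok: "\<not> cfl \<sigma> \<Longrightarrow> done_ok n \<sigma>" and don: "don \<sigma> \<subseteq> cells d"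
  defines "\<sigma>' \<equiv> hall_step n v l u \<sigma>"
  shows "good n d C \<sigma>'" "vals \<sigma> \<subseteq> vals \<sigma>'" "fst ` (vals \<sigma>' - vals \<sigma>) \<subseteq> set (stk \<sigma>')"
    "set (stk \<sigma>) \<subseteq> set (stk \<sigma>')" "don \<sigma>' \<subseteq> cells d" "cfl \<sigma> \<Longrightarrow> cfl \<sigma>'"
    "pot n d \<sigma>' + (if hall_trigger n v l u \<sigma> then 100 * (n + 1) else 0) \<le> pot n d \<sigma>"
    "\<not> cfl \<sigma>' \<Longrightarrow> done_ok n \<sigma>'"
    "(R v l u, True) \<in> vals \<sigma> \<Longrightarrow> u - l < true_count n (vals \<sigma>) l u \<Longrightarrow> (l, u) \<in> don \<sigma>'"
proof -
  let ?\<tau> = "\<sigma>\<lparr>don := insert (l, u) (don \<sigma>)\<rparr>"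
  have "good n d C \<sigma>' \<and> vals \<sigma> \<subseteq> vals \<sigma>' \<and> fst ` (vals \<sigma>' - vals \<sigma>) \<subseteq> set (stk \<sigma>') \<and>
    set (stk \<sigma>) \<subseteq> set (stk \<sigma>') \<and> don \<sigma>' \<subseteq> cells d \<and> (cfl \<sigma> \<longrightarrow> cfl \<sigma>') \<and>
    pot n d \<sigma>' + (if hall_trigger n v l u \<sigma> then 100 * (n + 1) else 0) \<le> pot n d \<sigma> \<and>
    (\<not> cfl \<sigma>' \<longrightarrow> done_ok n \<sigma>') \<and>
    ((R v l u, True) \<in> vals \<sigma> \<longrightarrow> u - l < true_count n (vals \<sigma>) l u \<longrightarrow> (l, u) \<in> don \<sigma>')"
  proof (cases "hall_trigger n v l u \<sigma>")
    case False
    then show ?thesis using g ok don by (auto simp: \<sigma>'_def hall_step_def hall_trigger_def)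
  next
    case True
    then have \<sigma>': "\<sigma>' = fold (exclude n l u) [1..<Suc n] ?\<tau>" by (simp add: \<sigma>'_def hall_step_def)
    have trig: "(l, u) \<notin> don \<sigma>" "Suc (u - l) \<le> true_count n (vals \<sigma>) l u"
      using True by (auto simp: hall_trigger_def)
    have lu: "(l, u) \<in> cells d" using c by (auto simp: cell_def cells_def)
    have g': "good n d C ?\<tau>" using g by (simp add: good_def)
    have *: "good n d C \<sigma>' \<and> extends n d ?\<tau> \<sigma>' \<and>
      (\<not> cfl \<sigma>' \<longrightarrow> (\<forall>w\<in>set [1..<Suc n]. R w l u \<in> fst ` vals \<sigma>' \<and>
         (Suc (u - l) < true_count n (vals \<sigma>) l u \<longrightarrow> (R w l u, False) \<in> vals \<sigma>')))"
      unfolding \<sigma>'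
    proof (rule fold_cover[where \<theta> = ?\<tau>])
      fix w \<rho> assume w: "w \<in> set [1..<Suc n]" and \<rho>: "good n d C \<rho>" "extends n d ?\<tau> \<rho>"
      have "cell n d w l u" using c w by (auto simp: cell_def)
      have sub: "vals \<sigma> \<subseteq> vals \<rho>" using \<rho>(2) by (simp add: extends_def)
      have le: "true_count n (vals \<sigma>) l u \<le> true_count n (vals \<rho>) l u"
        using sub unfolding true_count_def by (intro card_mono) auto
      have C': "(R w l u, False) \<in> C"
        if "(R w l u, True) \<notin> vals \<rho> \<or> Suc (u - l) < true_count n (vals \<rho>) l u"
      proof -
        let ?T = "{w \<in> {1..n}. (R w l u, True) \<in> vals \<rho>}"
        have "Suc (u - l) \<le> card ?T" using trig(2) le unfolding true_count_def by linarith
        moreover have "w \<notin> ?T \<or> Suc (u - l) < card ?T" using that unfolding true_count_def by simp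
        moreover have "finite ?T" by simp
        ultimately obtain S where S: "S \<subseteq> ?T - {w}" "card S = Suc (u - l)"
          by (rule obtain_hall_set)
        have "der n d (vals \<rho>) (R w l u, False)"
          by (rule der.hall[where S = S]) (use \<open>cell n d w l u\<close> S in auto)
        moreover have "vals \<rho> \<subseteq> C" using \<rho>(1) by (simp add: good_def)
        ultimately show ?thesis using der_mono closedD[OF C] by blast
      qed
      show "good n d C (exclude n l u w \<rho>) \<and> extends n d \<rho> (exclude n l u w \<rho>) \<and>
        (\<not> cfl (exclude n l u w \<rho>) \<longrightarrow> R w l u \<in> fst ` vals (exclude n l u w \<rho>) \<and>
          (Suc (u - l) < true_count n (vals \<sigma>) l u \<longrightarrow> (R w l u, False) \<in> vals (exclude n l u w \<rho>)))"
      proof (cases "(R w l u, True) \<notin> vals \<rho> \<or> Suc (u - l) < true_count n (vals \<rho>) l u")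
        case True
        note e = enq_good[OF \<rho>(1) C'[OF True]]
        have "exclude n l u w \<rho> = enq (R w l u, False) \<rho>" using True by (simp add: exclude_def)
        then show ?thesis using e \<open>cell n d w l u\<close> by force
      next
        case False
        then have "exclude n l u w \<rho> = \<rho>" by (simp add: exclude_def)
        then show ?thesis using False \<rho>(1) le by force
      qed
    qed (use g' in auto)
    then have ext: "extends n d ?\<tau> \<sigma>'" and good: "good n d C \<sigma>'" by blast+
    have "card (cells d - don \<sigma>) = Suc (card (cells d - insert (l, u) (don \<sigma>)))"
    proof -
      have "cells d - don \<sigma> = insert (l, u) (cells d - insert (l, u) (don \<sigma>))" using lu trig by auto
      then have "card (cells d - don \<sigma>) = card (insert (l, u) (cells d - insert (l, u) (don \<sigma>)))"
        by (rule arg_cong)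
      also have "\<dots> = Suc (card (cells d - insert (l, u) (don \<sigma>)))"
        by (rule card_insert_disjoint) auto
      finally show ?thesis .
    qed
    then have "pot n d ?\<tau> + 100 * (n + 1) = pot n d \<sigma>" by (simp add: pot_def algebra_simps)
    then have pot: "pot n d \<sigma>' + 100 * (n + 1) \<le> pot n d \<sigma>" using ext by (simp add: extends_def)
    have dok: "done_ok n \<sigma>'" if nc: "\<not> cfl \<sigma>'"
      unfolding done_ok_def
    proof (intro ballI, clarify)
      fix l' u' assume l'u': "(l', u') \<in> don \<sigma>'"
      show "(\<forall>w\<in>{1..n}. R w l' u' \<in> fst ` vals \<sigma>') \<and> true_count n (vals \<sigma>') l' u' \<le> Suc (u' - l')"
      proof (cases "(l', u') = (l, u)")
        case True
        have count: "true_count n (vals \<sigma>') l u = true_count n (vals \<sigma>) l u"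
          unfolding \<sigma>' true_count_def fold_exclude_True by simp
        \<comment> \<open>For an overfull interval the scan tries to set every r-atom to false,
          among them a true one, and this raises the flag.\<close>
        have "true_count n (vals \<sigma>) l u \<le> Suc (u - l)"
        proof (rule ccontr)
          assume "\<not> ?thesis"
          then have big: "Suc (u - l) < true_count n (vals \<sigma>) l u" by simp
          then obtain w where w: "w \<in> {1..n}" "(R w l u, True) \<in> vals \<sigma>"
            unfolding true_count_def by (metis (no_types, lifting) Collect_empty_eq card.empty not_less0)
          then have "(R w l u, False) \<in> vals \<sigma>'" using * nc big by auto
          moreover have "(R w l u, True) \<in> vals \<sigma>'" using w ext by (auto simp: extends_def)
          ultimately show False using good by (auto simp: good_def consistent_def)
        qed
        then show ?thesis using True count * nc by auto
      next
        case False
        have nc': "\<not> cfl \<sigma>" using nc ext by (auto simp: extends_def)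
        have "(l', u') \<in> don \<sigma>" using False l'u' ext by (auto simp: extends_def)
        \<comment> \<open>\<open>done_ok_ext\<close> leaves \<open>don\<close> unchanged; so it is
          applied to the new values with the old \<open>don\<close>, which covers all intervals
          except \<open>[l, u]\<close>.\<close>
        moreover have "done_ok n (\<sigma>'\<lparr>don := don \<sigma>\<rparr>)"
          by (rule done_ok_ext[OF ok[OF nc'], of d])
            (use ext good pot in \<open>auto simp: extends_def good_def pot_def\<close>)
        ultimately show ?thesis by (auto simp: done_ok_def)
      qed
    qed
    show ?thesis
      using ext good pot dok True lu don by (auto simp: extends_def)
  qed
  then show "good n d C \<sigma>'" "vals \<sigma> \<subseteq> vals \<sigma>'" "fst ` (vals \<sigma>' - vals \<sigma>) \<subseteq> set (stk \<sigma>')"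
    "set (stk \<sigma>) \<subseteq> set (stk \<sigma>')" "don \<sigma>' \<subseteq> cells d" "cfl \<sigma> \<Longrightarrow> cfl \<sigma>'"
    "pot n d \<sigma>' + (if hall_trigger n v l u \<sigma> then 100 * (n + 1) else 0) \<le> pot n d \<sigma>"
    "\<not> cfl \<sigma>' \<Longrightarrow> done_ok n \<sigma>'"
    "(R v l u, True) \<in> vals \<sigma> \<Longrightarrow> u - l < true_count n (vals \<sigma>) l u \<Longrightarrow> (l, u) \<in> don \<sigma>'"
    by blast+
qed

fun process_cost :: "nat \<Rightarrow> nat \<Rightarrow> atom \<Rightarrow> pstate \<Rightarrow> nat" where
  "process_cost n d (R v l u) \<sigma> =
     wt d (R v l u) + (if hall_trigger n v l u (check v l u \<sigma>) then 100 * (n + 1) else 0)"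
| "process_cost n d a \<sigma> = wt d a"

lemma good_order_cons:
  assumes "good n d C \<sigma>" "closed n d C" "v \<in> {1..n}" "i \<le> d"
  shows "set (order_cons d (vals \<sigma>) v i) \<subseteq> C" "fst ` set (order_cons d (vals \<sigma>) v i) \<subseteq> core_atoms n d"
proof -
  have "vals \<sigma> \<subseteq> C" using assms(1) by (simp add: good_def)
  then show "set (order_cons d (vals \<sigma>) v i) \<subseteq> C"
    "fst ` set (order_cons d (vals \<sigma>) v i) \<subseteq> core_atoms n d"
    using order_cons_der[OF assms(3,4)] der_mono closedD[OF assms(2)] der_core by blast+
qed

lemma process_B:
  assumes g: "good n d C \<sigma>" and C: "closed n d C" and v: "v \<in> {1..n}" "i \<le> d"
  defines "\<sigma>' \<equiv> process n d (B v i) \<sigma>"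
  shows "good n d C \<sigma>'" "extends n d \<sigma> \<sigma>'"
    "\<not> cfl \<sigma>' \<Longrightarrow> set (order_cons d (vals \<sigma>) v i) \<subseteq> vals \<sigma>'"
    "\<not> cfl \<sigma>' \<Longrightarrow> cell n d v l u \<Longrightarrow> i = l - 1 \<or> i = u \<Longrightarrow> set (cell_cons (vals \<sigma>) v l u) \<subseteq> vals \<sigma>'"
proof -
  define \<sigma>1 where "\<sigma>1 = fold enq (order_cons d (vals \<sigma>) v i) \<sigma>"
  define \<sigma>2 where "\<sigma>2 = fold (\<lambda>u. check v (Suc i) u) [Suc i..<Suc d] \<sigma>1"
  have \<sigma>': "\<sigma>' = fold (\<lambda>l. check v l i) [1..<Suc i] \<sigma>2"
    unfolding \<sigma>'_def \<sigma>1_def \<sigma>2_def by simp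
  have 1: "good n d C \<sigma>1 \<and> extends n d \<sigma> \<sigma>1 \<and>
    (\<not> cfl \<sigma>1 \<longrightarrow> set (order_cons d (vals \<sigma>) v i) \<subseteq> vals \<sigma>1)"
    unfolding \<sigma>1_def by (rule fold_enq[OF g good_order_cons[OF g C v]])
  have chk: "good n d C (check v l u \<tau>) \<and> extends n d \<tau> (check v l u \<tau>) \<and>
      (\<not> cfl (check v l u \<tau>) \<longrightarrow> set (cell_cons (vals \<sigma>) v l u) \<subseteq> vals (check v l u \<tau>))"
    if "cell n d v l u" "good n d C \<tau>" "extends n d \<sigma> \<tau>" for l u \<tau>
  proof -
    have "vals \<sigma> \<subseteq> vals \<tau>" using that(3) by (simp add: extends_def)
    then show ?thesis using check_good[OF that(2) C that(1)] cell_cons_subset[of "vals \<sigma>" v l u "vals \<tau>"] by blast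
  qed
  have 2: "good n d C \<sigma>2 \<and> extends n d \<sigma>1 \<sigma>2 \<and>
    (\<not> cfl \<sigma>2 \<longrightarrow> (\<forall>u\<in>set [Suc i..<Suc d]. set (cell_cons (vals \<sigma>) v (Suc i) u) \<subseteq> vals \<sigma>2))"
    unfolding \<sigma>2_def
  proof (rule fold_cover[where \<theta> = \<sigma>])
    fix u \<tau> assume "u \<in> set [Suc i..<Suc d]" and \<tau>: "good n d C \<tau>" "extends n d \<sigma> \<tau>"
    then have "cell n d v (Suc i) u" using v by (auto simp: cell_def)
    then show "good n d C (check v (Suc i) u \<tau>) \<and> extends n d \<tau> (check v (Suc i) u \<tau>) \<and>
      (\<not> cfl (check v (Suc i) u \<tau>) \<longrightarrow>
       set (cell_cons (vals \<sigma>) v (Suc i) u) \<subseteq> vals (check v (Suc i) u \<tau>))"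
      using chk \<tau> by blast
  qed (use 1 in auto)
  have e2: "extends n d \<sigma> \<sigma>2" using 1 2 ext_trans by blast
  have 3: "good n d C \<sigma>' \<and> extends n d \<sigma>2 \<sigma>' \<and>
    (\<not> cfl \<sigma>' \<longrightarrow> (\<forall>l\<in>set [1..<Suc i]. set (cell_cons (vals \<sigma>) v l i) \<subseteq> vals \<sigma>'))"
    unfolding \<sigma>'
  proof (rule fold_cover[where \<theta> = \<sigma>])
    fix l \<tau> assume "l \<in> set [1..<Suc i]" and \<tau>: "good n d C \<tau>" "extends n d \<sigma> \<tau>"
    then have "cell n d v l i" using v by (auto simp: cell_def)
    then show "good n d C (check v l i \<tau>) \<and> extends n d \<tau> (check v l i \<tau>) \<and>
      (\<not> cfl (check v l i \<tau>) \<longrightarrow> set (cell_cons (vals \<sigma>) v l i) \<subseteq> vals (check v l i \<tau>))"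
      using chk \<tau> by blast
  qed (use 2 e2 in auto)
  show "good n d C \<sigma>'" "extends n d \<sigma> \<sigma>'" using 3 e2 ext_trans by blast+
  assume nc: "\<not> cfl \<sigma>'"
  have e: "vals \<sigma>1 \<subseteq> vals \<sigma>2" "vals \<sigma>2 \<subseteq> vals \<sigma>'" "\<not> cfl \<sigma>2" "\<not> cfl \<sigma>1"
    using nc 2 3 by (auto simp: extends_def)
  show "set (order_cons d (vals \<sigma>) v i) \<subseteq> vals \<sigma>'" using 1 e by blast
  assume c: "cell n d v l u" and iu: "i = l - 1 \<or> i = u"
  from iu show "set (cell_cons (vals \<sigma>) v l u) \<subseteq> vals \<sigma>'"
  proof
    assume "i = l - 1"
    then have "l = Suc i" "u \<in> set [Suc i..<Suc d]" using c by (auto simp: cell_def)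
    then show ?thesis using 2 e by blast
  next
    assume "i = u"
    then have "l \<in> set [1..<Suc i]" using c by (auto simp: cell_def)
    then show ?thesis using 3 nc \<open>i = u\<close> by blast
  qed
qed

lemma pot_pop: "stk \<sigma> \<noteq> [] \<Longrightarrow> pot n d (pop \<sigma>) + wt d (last (stk \<sigma>)) = pot n d \<sigma>"
proof -
  assume "stk \<sigma> \<noteq> []"
  then obtain xs x where "stk \<sigma> = xs @ [x]" by (metis append_butlast_last_id)
  then show ?thesis by (simp add: pot_def pop_def)
qed

text \<open>Popping a adds its literals to the processed ones, and \<open>der_split\<close> lists
  the inferences that this enables. They were computed from the values at the moment of popping,
  which already contain all premises except, possibly, those counted for
  \<open>hall\<close>.\<close>

lemma process_inv:
  assumes inv: "prop_inv n d X \<sigma>" and ne: "stk \<sigma> \<noteq> []" and ncf: "\<not> cfl \<sigma>"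
  defines "a \<equiv> last (stk \<sigma>)"
  defines "\<sigma>' \<equiv> process n d a (pop \<sigma>)"
  shows "prop_inv n d X \<sigma>' \<and> pot n d \<sigma>' + process_cost n d a (pop \<sigma>) \<le> pot n d \<sigma>"
proof -
  let ?C = "cl n d X" and ?\<tau> = "pop \<sigma>"
  have C: "closed n d ?C" by (rule closed_cl)
  have set_stk: "set (stk \<sigma>) = insert a (set (butlast (stk \<sigma>)))"
    unfolding a_def using ne by (metis append_butlast_last_id list.set(2) list.simps(15) rotate1.simps(2) set_rotate1)
  have sg: "good n d ?C \<sigma>" and sdon: "don \<sigma> \<subseteq> cells d" and sX: "X \<subseteq> vals \<sigma>" and sok: "done_ok n \<sigma>"
    and sder: "\<And>e. der n d (pending_free \<sigma>) e \<Longrightarrow> e \<in> vals \<sigma>"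
    using inv ncf by (auto simp: prop_inv_def)
  have a: "a \<in> core_atoms n d" using sg set_stk by (auto simp: good_def)
  have g: "good n d ?C ?\<tau>" using sg set_stk by (auto simp: good_def pop_def)
  have ok: "done_ok n ?\<tau>" using sok by (simp add: done_ok_def pop_def)
  have vals: "vals ?\<tau> = vals \<sigma>" "don ?\<tau> = don \<sigma>" "cfl ?\<tau> = cfl \<sigma>" by (simp_all add: pop_def)
  let ?Y = "pending_free ?\<tau>"
  have Y: "?Y \<subseteq> pending_free \<sigma> \<union> {x. fst x = a}" "?Y \<subseteq> vals \<sigma>"
    using set_stk by (auto simp: pending_free_def pop_def)
  have pot: "pot n d ?\<tau> + wt d a = pot n d \<sigma>" unfolding a_def by (rule pot_pop[OF ne])
  consider v i where "a = B v i" "v \<in> {1..n}" "i \<le> d" | v l u where "a = R v l u" "cell n d v l u"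
    using a by (cases a) auto
  then show ?thesis
  proof cases
    case (1 v i)
    note p = process_B[OF g C 1(2,3), folded 1(1), folded \<sigma>'_def]
    have "e \<in> vals \<sigma>'" if nc: "\<not> cfl \<sigma>'" and e: "der n d (pending_free \<sigma>') e" for e
    proof -
      have sub: "vals \<sigma> \<subseteq> vals \<sigma>'" using p(2) vals by (simp add: extends_def)
      have "der n d ?Y e" using e pending_free_ext[OF p(2)] by (rule der_mono)
      then show ?thesis using Y(1)
      proof (cases rule: der_split)
        case 1
        then show ?thesis using sder sub by blast
      next
        case (2 v' l u)
        then have "v' = v" "i = l - 1 \<or> i = u" using 1 by auto
        then show ?thesis using p(4)[OF nc, of l u] 2 cell_cons_subset[of ?Y v l u "vals \<sigma>"] Y(2) vals by auto
      next
        case (3 v' i')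
        then show ?thesis using p(3)[OF nc] 1 order_cons_subset[of v i ?Y "vals \<sigma>" d] Y(2) vals by auto
      next
        case (4 v' l u w S)
        then show ?thesis using 1 by simp
      qed
    qed
    moreover have "X \<subseteq> vals \<sigma>'" "don \<sigma>' \<subseteq> cells d" using p(2) vals sX sdon by (auto simp: extends_def)
    moreover have "done_ok n \<sigma>'"
      using done_ok_ext[OF ok p(2)] p(1) by (simp add: good_def)
    moreover have "pot n d \<sigma>' + wt d a \<le> pot n d \<sigma>" using p(2) pot by (simp add: extends_def)
    ultimately show ?thesis using p(1) 1 by (simp add: prop_inv_def)
  next
    case (2 v l u)
    let ?\<rho> = "check v l u ?\<tau>"
    have \<sigma>': "\<sigma>' = hall_step n v l u ?\<rho>" by (simp add: \<sigma>'_def 2)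
    have k: "good n d ?C ?\<rho>" "extends n d ?\<tau> ?\<rho>"
      "\<not> cfl ?\<rho> \<Longrightarrow> set (cell_cons (vals \<sigma>) v l u) \<subseteq> vals ?\<rho>"
      using check_good[OF g C 2(2)] vals by auto
    have ok': "done_ok n ?\<rho>" using done_ok_ext[OF ok k(2)] k(1) by (simp add: good_def)
    have don': "don ?\<rho> \<subseteq> cells d" using k(2) vals sdon by (simp add: extends_def)
    note h = hall_step_good[OF k(1) C 2(2) ok' don', folded \<sigma>']
    have s1: "vals \<sigma> \<subseteq> vals ?\<rho>" using k(2) vals by (simp add: extends_def)
    have pf: "pending_free \<sigma>' \<subseteq> ?Y"
    proof -
      have "pending_free \<sigma>' \<subseteq> pending_free ?\<rho>" using h(3,4) by (force simp: pending_free_def)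
      then show ?thesis using pending_free_ext[OF k(2)] by blast
    qed
    have "e \<in> vals \<sigma>'" if nc: "\<not> cfl \<sigma>'" and e: "der n d (pending_free \<sigma>') e" for e
    proof -
      have nc': "\<not> cfl ?\<rho>" using nc h(6) by blast
      have "der n d ?Y e" using e pf by (rule der_mono)
      then show ?thesis using Y(1)
      proof (cases rule: der_split)
        case 1
        then show ?thesis using sder s1 h(2) by blast
      next
        case (2 v' l' u')
        then have "v' = v" "l' = l" "u' = u" using \<open>a = R v l u\<close> by auto
        then show ?thesis using k(3)[OF nc'] 2 cell_cons_subset[of ?Y v l u "vals \<sigma>"] Y(2) h(2) by blast
      next
        case (3 v' i')
        then show ?thesis using \<open>a = R v l u\<close> by simp
      next
        case (4 v' l' u' w S)
        then have [simp]: "v' = v" "l' = l" "u' = u" using \<open>a = R v l u\<close> by auto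
        have Rv: "(R v l u, True) \<in> vals ?\<rho>" using 4(2,3) Y(2) s1 by auto
        have S: "S \<subseteq> {w \<in> {1..n}. (R w l u, True) \<in> vals ?\<rho>}" using 4(6,8) Y(2) s1 by auto
        then have "card S \<le> true_count n (vals ?\<rho>) l u" unfolding true_count_def by (intro card_mono) auto
        \<comment> \<open>The u - l + 1 true atoms of S lift the counter above the threshold, so the
          interval has been scanned, now or earlier. Its atoms are then all assigned, and w, not
          being in S, would be one true atom too many.\<close>
        then have "(l, u) \<in> don \<sigma>'" using 4(7) by (intro h(9)[OF Rv]) simp
        then have d: "\<forall>w\<in>{1..n}. R w l u \<in> fst ` vals \<sigma>'" "true_count n (vals \<sigma>') l u \<le> Suc (u - l)"
          using h(8)[OF nc] by (auto simp: done_ok_def)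
        have "(R w l u, True) \<notin> vals \<sigma>'"
        proof
          assume "(R w l u, True) \<in> vals \<sigma>'"
          then have "insert w S \<subseteq> {w \<in> {1..n}. (R w l u, True) \<in> vals \<sigma>'}" using S h(2) 4(4) by auto
          then have "card (insert w S) \<le> true_count n (vals \<sigma>') l u"
            unfolding true_count_def by (intro card_mono) auto
          moreover have "w \<notin> S" "finite S" using 4(6) finite_subset by auto
          ultimately show False using d(2) 4(7) by simp
        qed
        moreover obtain b where "(R w l u, b) \<in> vals \<sigma>'" using d(1) 4(4) by force
        ultimately show ?thesis using 4(5) by (cases b) auto
      qed
    qed
    moreover have "X \<subseteq> vals \<sigma>'" using sX s1 h(2) by blast
    moreover have "pot n d ?\<rho> \<le> pot n d ?\<tau>" using k(2) by (simp add: extends_def)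
    then have "pot n d \<sigma>' + process_cost n d a ?\<tau> \<le> pot n d \<sigma>"
      using h(7) pot by (simp add: 2)
    ultimately show ?thesis using h(1,5,8) by (simp add: prop_inv_def)
  qed
qed

lemma inv_final:
  assumes "prop_inv n d X \<sigma>" "stk \<sigma> = []" "\<not> cfl \<sigma>"
  shows "vals \<sigma> = cl n d X" "consistent (cl n d X)"
proof -
  have "pending_free \<sigma> = vals \<sigma>" using assms(2) by (simp add: pending_free_def)
  then have "closed n d (vals \<sigma>)" "X \<subseteq> vals \<sigma>" using assms(1,3) by (auto simp: prop_inv_def closed_def)
  then have "cl n d X \<subseteq> vals \<sigma>" by (intro cl_least)
  moreover have "vals \<sigma> \<subseteq> cl n d X" "consistent (vals \<sigma>)" using assms(1) by (auto simp: prop_inv_def good_def)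
  ultimately show "vals \<sigma> = cl n d X" "consistent (cl n d X)" by auto
qed

lemma inv_conflict: "prop_inv n d X \<sigma> \<Longrightarrow> cfl \<sigma> \<Longrightarrow> \<not> consistent (cl n d X)"
  by (simp add: prop_inv_def good_def)

section \<open>Reasoning about the random access machine\<close>

definition run :: "com \<Rightarrow> store \<Rightarrow> nat \<Rightarrow> (store \<Rightarrow> bool) \<Rightarrow> bool" where
  "run c s T Q \<longleftrightarrow> (\<exists>t s'. exec c s t s' \<and> t \<le> T \<and> Q s')"

inductive_cases exec_SkipE: "exec Skip s t s'"
inductive_cases exec_PutE: "exec (Put x i e) s t s'"
inductive_cases exec_SeqE: "exec (Seq c c') s t s'"
inductive_cases exec_CondE: "exec (Cond b c c') s t s'"

lemma exec_Cond_iff: "exec (Cond b c c') s t s' \<longleftrightarrow>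
    (\<exists>t'. t = t' + 1 \<and> (if bval b s then exec c s t' s' else exec c' s t' s'))"
  using exec.CondTrue[of b s c _ s' c'] exec.CondFalse[of b s c' _ s' c]
  by (auto elim!: exec_CondE split: if_splits)

lemma exec_Put_iff: "exec (Put x i e) s t s' \<longleftrightarrow>
    t = 1 \<and> s' = s(x := (s x)(aval i s := aval e s))"
  by (auto intro: exec.Put[simplified] elim!: exec_PutE)

lemma exec_Skip_iff: "exec Skip s t s' \<longleftrightarrow> t = 1 \<and> s' = s"
  by (auto intro: exec.Skip[simplified] elim!: exec_SkipE)

lemma exec_Seq_iff: "exec (Seq c c') s t s'' \<longleftrightarrow>
    (\<exists>t1 s' t2. exec c s t1 s' \<and> exec c' s' t2 s'' \<and> t = t1 + t2)"
  by (auto intro: exec.Seq elim!: exec_SeqE)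

text \<open>This and the next equations let the simplifier execute straight-line code symbolically
  while T counts down; loops and subprograms are joined by \<open>run_Seq\<close>.\<close>

lemma run_Skip [simp]: "run Skip s T Q \<longleftrightarrow> 0 < T \<and> Q s"
  by (auto simp: run_def exec_Skip_iff)

lemma run_Put [simp]: "run (Put x i e) s T Q \<longleftrightarrow> 0 < T \<and> Q (s(x := (s x)(aval i s := aval e s)))"
  by (auto simp: run_def exec_Put_iff)

lemma run_Cond [simp]: "run (Cond b c c') s T Q \<longleftrightarrow>
    0 < T \<and> (if bval b s then run c s (T - 1) Q else run c' s (T - 1) Q)"
proof -
  have "t + 1 \<le> T \<longleftrightarrow> 0 < T \<and> t \<le> T - 1" for t by linarith
  then show ?thesis by (auto simp: run_def exec_Cond_iff)
qed

lemma run_Seq_Put [simp]: "run (Seq (Put x i e) c) s T Q \<longleftrightarrow>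
    0 < T \<and> run c (s(x := (s x)(aval i s := aval e s))) (T - 1) Q"
proof -
  have "1 + t \<le> T \<longleftrightarrow> 0 < T \<and> t \<le> T - 1" for t by linarith
  then show ?thesis by (auto simp: run_def exec_Seq_iff exec_Put_iff)
qed

lemma run_Seq_Seq [simp]: "run (Seq (Seq c1 c2) c3) s T Q \<longleftrightarrow> run (Seq c1 (Seq c2 c3)) s T Q"
  unfolding run_def exec_Seq_iff by (metis add.assoc)

lemma run_Seq_Cond [simp]: "run (Seq (Cond b c c') c'') s T Q \<longleftrightarrow>
    0 < T \<and> (if bval b s then run (Seq c c'') s (T - 1) Q else run (Seq c' c'') s (T - 1) Q)"
proof -
  let ?c = "if bval b s then c else c'"
  have iff: "exec (Seq (Cond b c c') c'') s t s2 \<longleftrightarrow> (\<exists>t'. t = Suc t' \<and> exec (Seq ?c c'') s t' s2)" for t s2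
  proof
    assume "exec (Seq (Cond b c c') c'') s t s2"
    then obtain t1 s1 t2 where 1: "exec (Cond b c c') s t1 s1" "exec c'' s1 t2 s2" "t = t1 + t2"
      unfolding exec_Seq_iff by blast
    then obtain t' where "t1 = Suc t'" "exec ?c s t' s1"
      unfolding exec_Cond_iff by (cases "bval b s") auto
    then show "\<exists>t'. t = Suc t' \<and> exec (Seq ?c c'') s t' s2"
      using 1(2,3) exec.Seq by (intro exI[of _ "t' + t2"]) simp
  next
    assume "\<exists>t'. t = Suc t' \<and> exec (Seq ?c c'') s t' s2"
    then obtain t1 s1 t2 where 1: "exec ?c s t1 s1" "exec c'' s1 t2 s2" "t = Suc (t1 + t2)"
      unfolding exec_Seq_iff by blast
    from 1(1) have "exec (Cond b c c') s (Suc t1) s1"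
      unfolding exec_Cond_iff by (cases "bval b s") simp_all
    from exec.Seq[OF this 1(2)] show "exec (Seq (Cond b c c') c'') s t s2" using 1(3) by simp
  qed
  define d where "d = Seq ?c c''"
  have "Suc t \<le> T \<longleftrightarrow> 0 < T \<and> t \<le> T - 1" for t by linarith
  then have "run (Seq (Cond b c c') c'') s T Q \<longleftrightarrow> 0 < T \<and> run (Seq ?c c'') s (T - 1) Q"
    unfolding run_def iff d_def[symmetric] by auto
  then show ?thesis by simp
qed

lemma run_Seq:
  assumes "run c s T1 Q0" "\<And>s'. Q0 s' \<Longrightarrow> run c' s' (T - T1) Q" "T1 \<le> T"
  shows "run (Seq c c') s T Q"
proof -
  obtain t s' where 1: "exec c s t s'" "t \<le> T1" "Q0 s'" using assms(1) by (auto simp: run_def)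
  obtain t' s'' where 2: "exec c' s' t' s''" "t' \<le> T - T1" "Q s''"
    using assms(2)[OF 1(3)] by (auto simp: run_def)
  have "t + t' \<le> T" using 1 2 assms(3) by linarith
  then show ?thesis using exec.Seq[OF 1(1) 2(1)] 2(3) unfolding run_def by blast
qed

lemma run_mono:
  assumes "run c s T Q" "T \<le> T'" "\<And>s'. Q s' \<Longrightarrow> Q' s'"
  shows "run c s T' Q'"
  using assms by (auto simp: run_def) (meson le_trans)

abbreviation reg :: "nat \<Rightarrow> aexp" where "reg k \<equiv> Get (Work 6) (Const k)"
abbreviation set_reg :: "nat \<Rightarrow> aexp \<Rightarrow> com" where "set_reg k e \<equiv> Put (Work 6) (Const k) e"
abbreviation seq_syntax (infixr ";;" 60) where "c ;; c' \<equiv> Seq c c'"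

definition for_loop :: "nat \<Rightarrow> aexp \<Rightarrow> com \<Rightarrow> com" where
  "for_loop r e c = While (Less (reg r) e) (c ;; set_reg r (Plus (reg r) (Const 1)))"

text \<open>Each round costs T for the body and 2 for test and increment; the final 1 is the failing
  test. The body must preserve the loop register, and P is restored after the increment.\<close>

lemma run_for_loop:
  assumes bound: "\<And>j s. P j s \<Longrightarrow> s (Work 6) r = j \<and> aval e s = hi"
    and body: "\<And>j s. lo \<le> j \<Longrightarrow> j < hi \<Longrightarrow> P j s \<Longrightarrow>
      run c s T (\<lambda>s'. s' (Work 6) r = j \<and> P (Suc j) (s'(Work 6 := (s' (Work 6))(r := Suc j))))"
    and lo: "lo \<le> hi" "P lo s"
  shows "run (for_loop r e c) s ((hi - lo) * (T + 2) + 1) (P hi)"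
proof -
  have "\<forall>s. P lo s \<longrightarrow> run (for_loop r e c) s ((hi - lo) * (T + 2) + 1) (P hi)"
    using lo(1)
  proof (induction rule: inc_induct)
    case base
    show ?case
    proof (intro allI impI)
      fix s assume "P hi s"
      then have "exec (for_loop r e c) s 1 s" using bound[of hi s]
        unfolding for_loop_def by (intro exec.WhileFalse) simp
      then show "run (for_loop r e c) s ((hi - hi) * (T + 2) + 1) (P hi)"
        using \<open>P hi s\<close> by (auto simp: run_def)
    qed
  next
    case (step j)
    show ?case
    proof (intro allI impI)
      fix s assume Pj: "P j s"
      obtain t s' where b: "exec c s t s'" "t \<le> T" "s' (Work 6) r = j"
        "P (Suc j) (s'(Work 6 := (s' (Work 6))(r := Suc j)))"
        using body[OF step(1,2) Pj] by (auto simp: run_def)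
      let ?s = "s'(Work 6 := (s' (Work 6))(r := Suc j))"
      have "exec (set_reg r (Plus (reg r) (Const 1))) s' 1 ?s"
        using exec.Put[of "Work 6" "Const r" "Plus (reg r) (Const 1)" s'] b(3) by simp
      then have c: "exec (c ;; set_reg r (Plus (reg r) (Const 1))) s (t + 1) ?s"
        using b(1) by (rule exec.Seq[rotated])
      obtain t' s'' where r: "exec (for_loop r e c) ?s t' s''" "t' \<le> (hi - Suc j) * (T + 2) + 1" "P hi s''"
        using step(3) b(4) unfolding run_def by blast
      have "exec (for_loop r e c) s (t + 1 + t' + 1) s''"
        using bound[OF Pj] step(2) c r(1) unfolding for_loop_def by (intro exec.WhileTrue) auto
      moreover have "t + 1 + t' + 1 \<le> (hi - j) * (T + 2) + 1"
      proof -
        have "hi - j = Suc (hi - Suc j)" using step(2) by simp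
        then have "(hi - j) * (T + 2) = (T + 2) + (hi - Suc j) * (T + 2)" by simp
        then show ?thesis using b(2) r(2) by linarith
      qed
      ultimately show "run (for_loop r e c) s ((hi - j) * (T + 2) + 1) (P hi)"
        using r(3) unfolding run_def by blast
    qed
  qed
  then show ?thesis using lo(2) by blast
qed

text \<open>The potential k pays for body and test of each round. It thereby decreases strictly,
  which also proves termination; the extra 1 is the failing test.\<close>

lemma exec_While_potential:
  assumes step: "\<And>k s. I k s \<Longrightarrow> bval b s \<Longrightarrow> \<exists>t s' k'. exec c s t s' \<and> I k' s' \<and> t + 1 + k' \<le> k"
    and "I k s"
  shows "\<exists>t s' k'. exec (While b c) s t s' \<and> I k' s' \<and> \<not> bval b s' \<and> t + k' \<le> k + 1"
  using assms(2)
proof (induction k arbitrary: s rule: less_induct)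
  case (less k)
  show ?case
  proof (cases "bval b s")
    case True
    obtain t s' k' where 1: "exec c s t s'" "I k' s'" "t + 1 + k' \<le> k"
      using step[OF less.prems True] by blast
    obtain t' s'' k'' where 2: "exec (While b c) s' t' s''" "I k'' s''" "\<not> bval b s''" "t' + k'' \<le> k' + 1"
      using less.IH[of k' s'] 1 by auto
    have "exec (While b c) s (t + t' + 1) s''" using True 1(1) 2(1) by (rule exec.WhileTrue)
    moreover have "t + t' + 1 + k'' \<le> k + 1" using 1(3) 2(4) by linarith
    ultimately show ?thesis using 2 by blast
  next
    case False
    then show ?thesis using exec.WhileFalse[OF False] less.prems by (metis add.commute le_refl)
  qed
qed

section \<open>Data representation\<close>

lemma index2_inj: "i \<le> d \<Longrightarrow> i' \<le> d \<Longrightarrow> index2 d v i = index2 d v' i' \<longleftrightarrow> v = v' \<and> i = i'"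
proof -
  assume i: "i \<le> d" "i' \<le> d"
  have 1: "(v * (d + 1) + i) div (d + 1) = v" "(v * (d + 1) + i) mod (d + 1) = i" if "i \<le> d" for v i
    using that by (simp_all add: div_mult_self3 del: mult_Suc_right)
  show ?thesis using 1[OF i(1), of v] 1[OF i(2), of v'] unfolding index2_def by metis
qed

lemma index3_index2: "index3 d v l u = index2 d (index2 d v l) u"
  by (simp add: index2_def index3_def)

lemma index3_inj: "l \<le> d \<Longrightarrow> l' \<le> d \<Longrightarrow> u \<le> d \<Longrightarrow> u' \<le> d \<Longrightarrow>
    index3 d v l u = index3 d v' l' u' \<longleftrightarrow> v = v' \<and> l = l' \<and> u = u'"
  by (simp add: index3_index2 index2_inj)

lemma index2_less: "v \<le> n \<Longrightarrow> i \<le> d \<Longrightarrow> index2 d v i < (n + 1) * (d + 1)"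
proof -
  assume "v \<le> n" "i \<le> d"
  then have "v * (d + 1) \<le> n * (d + 1)" by (intro mult_right_mono) auto
  then show ?thesis using \<open>i \<le> d\<close> unfolding index2_def by simp
qed

lemma index3_less: "v \<le> n \<Longrightarrow> l \<le> d \<Longrightarrow> u \<le> d \<Longrightarrow> index3 d v l u < (n + 1) * (d + 1) * (d + 1)"
proof -
  assume a: "v \<le> n" "l \<le> d" "u \<le> d"
  have "Suc (index2 d v l) * (d + 1) \<le> (n + 1) * (d + 1) * (d + 1)"
    using index2_less[OF a(1,2)] by (intro mult_right_mono) auto
  then show ?thesis using a(3) unfolding index3_index2 index2_def[of d "index2 d v l"] by simp
qed

definition tc :: "bool \<Rightarrow> nat" where
  "tc b = (if b then 1 else 2)"

lemma tc_simps [simp]: "tc True = 1" "tc False = 2" "tc b \<noteq> 0" "0 \<noteq> tc b"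
  by (auto simp: tc_def)

definition vc :: "(atom \<times> bool) set \<Rightarrow> atom \<Rightarrow> nat" where
  "vc X a = (if (a, True) \<in> X then 1 else if (a, False) \<in> X then 2 else 0)"

lemma vc_iff:
  assumes "consistent X"
  shows "vc X a = 0 \<longleftrightarrow> (a, True) \<notin> X \<and> (a, False) \<notin> X"
    "vc X a = 1 \<longleftrightarrow> (a, True) \<in> X" "vc X a = 2 \<longleftrightarrow> (a, False) \<in> X"
  using assms by (auto simp: vc_def consistent_def)

lemma vc_insert:
  assumes "(a, True) \<notin> X" "(a, False) \<notin> X"
  shows "vc (insert (a, b) X) x = (if x = a then tc b else vc X x)"
  using assms by (cases b) (auto simp: vc_def)

text \<open>The machine cannot multiply. The table reaches up to \<open>(n + 1) * (d + 1)\<close>,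
  since a three-dimensional index multiplies a two-dimensional one by d + 1.\<close>

definition tables :: "nat \<Rightarrow> nat \<Rightarrow> (nat \<Rightarrow> nat) \<Rightarrow> (nat \<Rightarrow> nat) \<Rightarrow> bool" where
  "tables n d sz m \<longleftrightarrow> sz 0 = n \<and> sz 1 = d \<and> (\<forall>x\<le>(n + 1) * (d + 1). m x = x * (d + 1))"

definition consts_repr :: "(nat \<Rightarrow> nat) \<Rightarrow> bool" where
  "consts_repr f \<longleftrightarrow> f 0 = 2 \<and> f 1 = 1 \<and> f 2 = 2 \<and> f 3 = 1 \<and> f 4 = 1 \<and> f 5 = 2"

text \<open>For arrays that only hold constantly false bodies: they are filled once, gaps between
  the slots included.\<close>

definition all_false :: "nat \<Rightarrow> nat \<Rightarrow> (nat \<Rightarrow> nat) \<Rightarrow> bool" where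
  "all_false n d f \<longleftrightarrow> (\<forall>j<(n + 1) * (d + 1) * (d + 1). f j = 2)"

definition B_repr :: "nat \<Rightarrow> nat \<Rightarrow> (nat \<Rightarrow> nat) \<Rightarrow> (atom \<times> bool) set \<Rightarrow> bool" where
  "B_repr n d f X \<longleftrightarrow> (\<forall>v\<in>{1..n}. \<forall>i\<le>d. f (index2 d v i) = vc X (B v i))"

definition R_repr :: "nat \<Rightarrow> nat \<Rightarrow> (nat \<Rightarrow> nat) \<Rightarrow> (atom \<times> bool) set \<Rightarrow> bool" where
  "R_repr n d f X \<longleftrightarrow> (\<forall>v l u. cell n d v l u \<longrightarrow> f (index3 d v l u) = vc X (R v l u))"

definition stack_repr :: "(nat \<Rightarrow> nat) \<Rightarrow> (nat \<Rightarrow> nat) \<Rightarrow> (nat \<Rightarrow> nat) \<Rightarrow> (nat \<Rightarrow> nat) \<Rightarrow> nat \<Rightarrow> atom list \<Rightarrow> bool" where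
  "stack_repr f1 f2 f3 f4 m xs \<longleftrightarrow> m = length xs \<and>
     (\<forall>j<m. atom_code (xs ! j) = [f1 j, f2 j, f3 j, f4 j])"

definition count_repr :: "nat \<Rightarrow> nat \<Rightarrow> (nat \<Rightarrow> nat) \<Rightarrow> (atom \<times> bool) set \<Rightarrow> bool" where
  "count_repr n d f X \<longleftrightarrow> (\<forall>(l, u)\<in>cells d. f (index2 d l u) = true_count n X l u)"

definition done_repr :: "nat \<Rightarrow> (nat \<Rightarrow> nat) \<Rightarrow> (nat \<times> nat) set \<Rightarrow> bool" where
  "done_repr d f D \<longleftrightarrow> (\<forall>(l, u)\<in>cells d. f (index2 d l u) = of_bool ((l, u) \<in> D))"

text \<open>
  \<open>Work 0\<close> holds the multiples of \<open>d + 1\<close>, \<open>Work 1\<close> to \<open>Work 4\<close> the stack of atoms in the encoding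
  \<open>atom_code\<close>, \<open>Work 5\<close> the stack pointer, \<open>Work 6\<close> the registers, \<open>Work 7\<close> the counters and \<open>Work 8\<close> the
  flags of the scanned intervals. \<open>Value 1\<close> at index \<open>index2 d v 0\<close>, which is not a slot, holds the
  sentinel \<open>b(v,0)\<close>.
\<close>

definition rel :: "nat \<Rightarrow> nat \<Rightarrow> store \<Rightarrow> pstate \<Rightarrow> bool" where
  "rel n d s \<sigma> \<longleftrightarrow>
     tables n d (s Size) (s (Work 0)) \<and> consts_repr (s (Value 0)) \<and>
     all_false n d (s (Value 3)) \<and> all_false n d (s (Value 4)) \<and> all_false n d (s (Value 5)) \<and>
     all_false n d (s (Value 7)) \<and> all_false n d (s (Value 8)) \<and>
     B_repr n d (s (Value 1)) (vals \<sigma>) \<and>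
     R_repr n d (s (Value 2)) (vals \<sigma>) \<and> R_repr n d (s (Value 6)) (vals \<sigma>) \<and>
     stack_repr (s (Work 1)) (s (Work 2)) (s (Work 3)) (s (Work 4)) (s (Work 5) 0) (stk \<sigma>) \<and>
     count_repr n d (s (Work 7)) (vals \<sigma>) \<and> done_repr d (s (Work 8)) (don \<sigma>) \<and>
     s Conflict 0 = of_bool (cfl \<sigma>) \<and> consistent (vals \<sigma>)"

lemma rel_reg [simp]: "rel n d (s(Work 6 := f)) \<sigma> \<longleftrightarrow> rel n d s \<sigma>"
  by (simp add: rel_def)

definition frame :: "nat set \<Rightarrow> store \<Rightarrow> store \<Rightarrow> bool" where
  "frame K s s' \<longleftrightarrow> (\<forall>k. k \<notin> K \<longrightarrow> s' (Work 6) k = s (Work 6) k) \<and> s' Lower = s Lower \<and> s' Upper = s Upper"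

lemma frame_refl [simp]: "frame K s s"
  by (simp add: frame_def)

lemma B_repr_insert:
  assumes "B_repr n d f X" "v \<in> {1..n}" "i \<le> d" "(B v i, True) \<notin> X" "(B v i, False) \<notin> X"
  shows "B_repr n d (f(index2 d v i := tc b)) (insert (B v i, b) X)"
  using assms unfolding B_repr_def by (auto simp: vc_insert index2_inj)

lemma R_repr_insert:
  assumes "R_repr n d f X" "cell n d v l u" "(R v l u, True) \<notin> X" "(R v l u, False) \<notin> X"
  shows "R_repr n d (f(index3 d v l u := tc b)) (insert (R v l u, b) X)"
proof -
  have "index3 d v' l' u' = index3 d v l u \<longleftrightarrow> v' = v \<and> l' = l \<and> u' = u" if "cell n d v' l' u'" for v' l' u'
    using that assms(2) by (intro index3_inj) (auto simp: cell_def)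
  then show ?thesis using assms unfolding R_repr_def by (auto simp: vc_insert)
qed

lemma B_repr_insert_R [simp]: "B_repr n d f (insert (R v l u, b) X) \<longleftrightarrow> B_repr n d f X"
  by (simp add: B_repr_def vc_def)

lemma R_repr_insert_B [simp]: "R_repr n d f (insert (B v i, b) X) \<longleftrightarrow> R_repr n d f X"
  by (simp add: R_repr_def vc_def)

lemma count_repr_insert_B [simp]: "count_repr n d f (insert (B v i, b) X) \<longleftrightarrow> count_repr n d f X"
  by (simp add: count_repr_def true_count_def)

lemma count_repr_insert_False [simp]: "count_repr n d f (insert (a, False) X) \<longleftrightarrow> count_repr n d f X"
  by (simp add: count_repr_def true_count_def)

lemma count_repr_insert_R:
  assumes f: "count_repr n d f X" and c: "cell n d v l u" and new: "(R v l u, True) \<notin> X"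
  shows "count_repr n d (f(index2 d l u := Suc (f (index2 d l u)))) (insert (R v l u, True) X)"
  unfolding count_repr_def
proof (intro ballI, clarify)
  fix l' u' assume lu': "(l', u') \<in> cells d"
  have inj: "index2 d l' u' = index2 d l u \<longleftrightarrow> l' = l \<and> u' = u"
    using lu' c by (intro index2_inj) (auto simp: cells_def cell_def)
  have old: "f (index2 d l' u') = true_count n X l' u'" using f lu' by (auto simp: count_repr_def)
  show "(f(index2 d l u := Suc (f (index2 d l u)))) (index2 d l' u') =
      true_count n (insert (R v l u, True) X) l' u'"
  proof (cases "l' = l \<and> u' = u")
    case True
    have "{w \<in> {1..n}. (R w l u, True) \<in> insert (R v l u, True) X} =
        insert v {w \<in> {1..n}. (R w l u, True) \<in> X}"
      using c by (auto simp: cell_def)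
    moreover have "card (insert v {w \<in> {1..n}. (R w l u, True) \<in> X}) =
        Suc (card {w \<in> {1..n}. (R w l u, True) \<in> X})"
      using new by (intro card_insert_disjoint) auto
    ultimately have "true_count n (insert (R v l u, True) X) l u = Suc (true_count n X l u)"
      unfolding true_count_def by simp
    then show ?thesis using True old by simp
  next
    case False
    then have "{w \<in> {1..n}. (R w l' u', True) \<in> insert (R v l u, True) X} =
        {w \<in> {1..n}. (R w l' u', True) \<in> X}" by auto
    then have "true_count n (insert (R v l u, True) X) l' u' = true_count n X l' u'"
      unfolding true_count_def by (rule arg_cong)
    moreover have "index2 d l' u' \<noteq> index2 d l u" using inj False by blast
    ultimately show ?thesis using old by simp
  qed
qed

lemma stack_repr_push:
  assumes "stack_repr f1 f2 f3 f4 m xs" "atom_code a = [k, v, l, u]"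
  shows "stack_repr (f1(m := k)) (f2(m := v)) (f3(m := l)) (f4(m := u)) (Suc m) (xs @ [a])"
  using assms by (auto simp: stack_repr_def nth_append less_Suc_eq)

section \<open>The machine program\<close>

definition idx2 :: "aexp \<Rightarrow> aexp \<Rightarrow> aexp" where
  "idx2 e f = Plus (Get (Work 0) e) f"

definition idx3 :: "aexp \<Rightarrow> aexp \<Rightarrow> aexp \<Rightarrow> aexp" where
  "idx3 e f g = idx2 (idx2 e f) g"

lemma aval_idx2 [simp]: "rel n d s \<sigma> \<Longrightarrow> aval e s \<le> (n + 1) * (d + 1) \<Longrightarrow>
    aval (idx2 e f) s = index2 d (aval e s) (aval f s)"
  by (simp add: idx2_def index2_def rel_def tables_def)

lemma aval_idx3 [simp]:
  assumes "rel n d s \<sigma>" "aval e s \<le> n" "aval f s \<le> d"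
  shows "aval (idx3 e f g) s = index3 d (aval e s) (aval f s) (aval g s)"
proof -
  have le: "aval e s \<le> (n + 1) * (d + 1)" using assms(2) by simp
  have "index2 d (aval e s) (aval f s) \<le> (n + 1) * (d + 1)"
    using index2_less[OF assms(2,3)] by simp
  then show ?thesis using assms le by (simp add: idx3_def index3_index2)
qed

abbreviation sp :: aexp where "sp \<equiv> Get (Work 5) (Const 0)"

definition push :: "aexp \<Rightarrow> aexp \<Rightarrow> aexp \<Rightarrow> aexp \<Rightarrow> com" where
  "push k v l u =
     Put (Work 1) sp k ;; Put (Work 2) sp v ;; Put (Work 3) sp l ;; Put (Work 4) sp u ;;
     Put (Work 5) (Const 0) (Plus sp (Const 1))"

text \<open>Register conventions during propagation: 0 to 2 hold v, l, u, 3 the truth value to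
  assign, 4 a computed index, 5 the index i of \<open>b(v,i)\<close>, 6 to 8 values read for a
  check, and 9 to 11 the kind and the arguments of the popped atom.\<close>

definition enq_B :: com where
  "enq_B =
     set_reg 4 (idx2 (reg 0) (reg 5)) ;;
     Cond (Equal (Get (Value 1) (reg 4)) (Const 0))
       (Put (Value 1) (reg 4) (reg 3) ;; push (Const 0) (reg 0) (reg 5) (Const 0))
       (Cond (Equal (Get (Value 1) (reg 4)) (reg 3)) Skip (Put Conflict (Const 0) (Const 1)))"

text \<open>The r-body always shares the value of its atom, so \<open>Value 6\<close> is written
  along with \<open>Value 2\<close> at the same index.\<close>

definition enq_R :: com where
  "enq_R =
     set_reg 4 (idx3 (reg 0) (reg 1) (reg 2)) ;;
     Cond (Equal (Get (Value 2) (reg 4)) (Const 0))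
       (Put (Value 2) (reg 4) (reg 3) ;; Put (Value 6) (reg 4) (reg 3) ;;
        push (Const 1) (reg 0) (reg 1) (reg 2) ;;
        set_reg 4 (idx2 (reg 1) (reg 2)) ;;
        Cond (Equal (reg 3) (Const 1)) (Put (Work 7) (reg 4) (Plus (Get (Work 7) (reg 4)) (Const 1))) Skip)
       (Cond (Equal (Get (Value 2) (reg 4)) (reg 3)) Skip (Put Conflict (Const 0) (Const 1)))"

lemma enq_assigned_iff:
  assumes "consistent X"
  shows "vc X a = 0 \<longleftrightarrow> \<not> ((a, True) \<in> X \<or> (a, False) \<in> X)"
    "vc X a \<noteq> 0 \<Longrightarrow> vc X a = tc b \<longleftrightarrow> (a, \<not> b) \<notin> X"
proof -
  show "vc X a = 0 \<longleftrightarrow> \<not> ((a, True) \<in> X \<or> (a, False) \<in> X)" by (simp add: vc_def)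
  have "\<not> ((a, True) \<in> X \<and> (a, False) \<in> X)" using assms unfolding consistent_def by blast
  then show "vc X a \<noteq> 0 \<Longrightarrow> vc X a = tc b \<longleftrightarrow> (a, \<not> b) \<notin> X"
    by (cases b) (auto simp: vc_def split: if_splits)
qed

lemma run_enq_B:
  assumes s: "rel n d s \<sigma>" and v: "v \<in> {1..n}" "i \<le> d"
    and regs: "s (Work 6) 0 = v" "s (Work 6) 5 = i" "s (Work 6) 3 = tc b"
  shows "run enq_B s 10 (\<lambda>s'. rel n d s' (enq (B v i, b) \<sigma>) \<and> frame {4} s s')"
proof -
  have idx: "aval (idx2 (reg 0) (reg 5)) s = index2 d v i"
    using aval_idx2[OF s, of "reg 0"] v regs by simp
  have con: "consistent (vals \<sigma>)" and val: "s (Value 1) (index2 d v i) = vc (vals \<sigma>) (B v i)"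
    using s v by (auto simp: rel_def B_repr_def)
  show ?thesis
  proof (cases "vc (vals \<sigma>) (B v i) = 0")
    case True
    then have new: "(B v i, True) \<notin> vals \<sigma>" "(B v i, False) \<notin> vals \<sigma>" using enq_assigned_iff(1)[OF con] by auto
    show ?thesis
      using s v new regs idx val True
        B_repr_insert[of n d "s (Value 1)" "vals \<sigma>" v i b]
        stack_repr_push[of "s (Work 1)" "s (Work 2)" "s (Work 3)" "s (Work 4)" "s (Work 5) 0" "stk \<sigma>" "B v i" 0 v i 0]
        consistent_insert[OF con new, of b]
      by (simp add: enq_B_def push_def enq.simps rel_def frame_def)
  next
    case False
    then have old: "(B v i, True) \<in> vals \<sigma> \<or> (B v i, False) \<in> vals \<sigma>" using enq_assigned_iff(1)[OF con] by auto
    show ?thesis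
      using s old regs idx val False enq_assigned_iff(2)[OF con False, of b]
      by (auto simp add: enq_B_def enq.simps rel_def frame_def)
  qed
qed

lemma run_enq_R:
  assumes s: "rel n d s \<sigma>" and c: "cell n d v l u"
    and regs: "s (Work 6) 0 = v" "s (Work 6) 1 = l" "s (Work 6) 2 = u" "s (Work 6) 3 = tc b"
  shows "run enq_R s 13 (\<lambda>s'. rel n d s' (enq (R v l u, b) \<sigma>) \<and> frame {4} s s')"
proof -
  have rng: "v \<le> n" "l \<le> d" "u \<le> d" "l \<le> (n + 1) * (d + 1)" using c by (auto simp: cell_def)
  have idx: "aval (idx3 (reg 0) (reg 1) (reg 2)) s = index3 d v l u"
    using aval_idx3[OF s, of "reg 0" "reg 1"] rng regs by simp
  have m: "s (Work 0) l = l * (d + 1)" using s rng by (simp add: rel_def tables_def)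
  have con: "consistent (vals \<sigma>)" and val: "s (Value 2) (index3 d v l u) = vc (vals \<sigma>) (R v l u)"
    using s c by (auto simp: rel_def R_repr_def)
  show ?thesis
  proof (cases "vc (vals \<sigma>) (R v l u) = 0")
    case True
    then have new: "(R v l u, True) \<notin> vals \<sigma>" "(R v l u, False) \<notin> vals \<sigma>" using enq_assigned_iff(1)[OF con] by auto
    show ?thesis
      using s c new regs idx val True m
        R_repr_insert[of n d "s (Value 2)" "vals \<sigma>" v l u b]
        R_repr_insert[of n d "s (Value 6)" "vals \<sigma>" v l u b]
        count_repr_insert_R[of n d "s (Work 7)" "vals \<sigma>" v l u]
        stack_repr_push[of "s (Work 1)" "s (Work 2)" "s (Work 3)" "s (Work 4)" "s (Work 5) 0" "stk \<sigma>" "R v l u" 1 v l u]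
        consistent_insert[OF con new, of b]
      by (cases b) (simp_all add: enq_R_def push_def enq.simps rel_def frame_def idx2_def index2_def)
  next
    case False
    then have old: "(R v l u, True) \<in> vals \<sigma> \<or> (R v l u, False) \<in> vals \<sigma>" using enq_assigned_iff(1)[OF con] by auto
    show ?thesis
      using s old regs idx val False enq_assigned_iff(2)[OF con False, of b]
      by (auto simp add: enq_R_def enq.simps rel_def frame_def)
  qed
qed

definition put_B :: "bool \<Rightarrow> aexp \<Rightarrow> com" where
  "put_B b e = (set_reg 3 (Const (tc b)) ;; set_reg 5 e ;; enq_B)"

definition put_R :: "bool \<Rightarrow> com" where
  "put_R b = (set_reg 3 (Const (tc b)) ;; enq_R)"

lemma run_put_B:
  assumes s: "rel n d s \<sigma>" and v: "s (Work 6) 0 = v" "v \<in> {1..n}" "i \<le> d"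
    and e: "aval e (s(Work 6 := (s (Work 6))(3 := tc b))) = i"
  shows "run (put_B b e) s 12 (\<lambda>s'. rel n d s' (enq (B v i, b) \<sigma>) \<and> frame {3, 4, 5} s s')"
proof -
  let ?s = "s(Work 6 := (s (Work 6))(3 := tc b, 5 := i))"
  have "run enq_B ?s 10 (\<lambda>s'. rel n d s' (enq (B v i, b) \<sigma>) \<and> frame {4} ?s s')"
    by (rule run_enq_B) (use s v in auto)
  then have "run enq_B ?s 10 (\<lambda>s'. rel n d s' (enq (B v i, b) \<sigma>) \<and> frame {3, 4, 5} s s')"
    by (rule run_mono) (auto simp: frame_def)
  then show ?thesis using e by (simp add: put_B_def)
qed

lemma run_put_R:
  assumes s: "rel n d s \<sigma>" and c: "cell n d v l u"
    and regs: "s (Work 6) 0 = v" "s (Work 6) 1 = l" "s (Work 6) 2 = u"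
  shows "run (put_R b) s 14 (\<lambda>s'. rel n d s' (enq (R v l u, b) \<sigma>) \<and> frame {3, 4, 5} s s')"
proof -
  let ?s = "s(Work 6 := (s (Work 6))(3 := tc b))"
  have "run enq_R ?s 13 (\<lambda>s'. rel n d s' (enq (R v l u, b) \<sigma>) \<and> frame {4} ?s s')"
    by (rule run_enq_R) (use s c regs in auto)
  then have "run enq_R ?s 13 (\<lambda>s'. rel n d s' (enq (R v l u, b) \<sigma>) \<and> frame {3, 4, 5} s s')"
    by (rule run_mono) (auto simp: frame_def)
  then show ?thesis by (simp add: put_R_def)
qed

text \<open>Refers to a fixed initial store and state, so that consecutive calls compose by
  appending to the list \<open>es\<close>, and registers loaded at the beginning remain
  readable.\<close>

definition enqueued :: "nat \<Rightarrow> nat \<Rightarrow> store \<Rightarrow> pstate \<Rightarrow> (atom \<times> bool) list \<Rightarrow> store \<Rightarrow> bool" where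
  "enqueued n d s \<sigma> es s' \<longleftrightarrow> rel n d s' (fold enq es \<sigma>) \<and> frame {3, 4, 5} s s'"

lemma enqueued_Nil: "rel n d s \<sigma> \<Longrightarrow> enqueued n d s \<sigma> [] s"
  by (simp add: enqueued_def)

lemma enqueued_reg: "enqueued n d s \<sigma> es s' \<Longrightarrow> k \<notin> {3, 4, 5} \<Longrightarrow> s' (Work 6) k = s (Work 6) k"
  by (simp add: enqueued_def frame_def)

lemma run_enqueued_B:
  assumes "enqueued n d s \<sigma> es s'" "s (Work 6) 0 = v" "v \<in> {1..n}" "i \<le> d"
    "aval e (s'(Work 6 := (s' (Work 6))(3 := tc b))) = i"
  shows "run (put_B b e) s' 12 (enqueued n d s \<sigma> (es @ [(B v i, b)]))"
proof -
  have "run (put_B b e) s' 12 (\<lambda>s''. rel n d s'' (enq (B v i, b) (fold enq es \<sigma>)) \<and> frame {3, 4, 5} s' s'')"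
    by (rule run_put_B) (use assms in \<open>auto simp: enqueued_def frame_def\<close>)
  then show ?thesis
    by (rule run_mono) (use assms(1) in \<open>auto simp: enqueued_def frame_def\<close>)
qed

lemma run_enqueued_R:
  assumes "enqueued n d s \<sigma> es s'" "cell n d v l u"
    "s (Work 6) 0 = v" "s (Work 6) 1 = l" "s (Work 6) 2 = u"
  shows "run (put_R b) s' 14 (enqueued n d s \<sigma> (es @ [(R v l u, b)]))"
proof -
  have "run (put_R b) s' 14 (\<lambda>s''. rel n d s'' (enq (R v l u, b) (fold enq es \<sigma>)) \<and> frame {3, 4, 5} s' s'')"
    by (rule run_put_R) (use assms in \<open>auto simp: enqueued_def frame_def\<close>)
  then show ?thesis
    by (rule run_mono) (use assms(1) in \<open>auto simp: enqueued_def frame_def\<close>)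
qed

lemma run_enqueued_when:
  assumes "enqueued n d s \<sigma> es s'" "bval b s' \<longleftrightarrow> C"
    "C \<Longrightarrow> run c s' T (enqueued n d s \<sigma> (es @ fs))" "T' = T + 1" "0 < T"
  shows "run (Cond b c Skip) s' T' (enqueued n d s \<sigma> (es @ (if C then fs else [])))"
  using assms by (cases C) auto

definition check_code :: com where
  "check_code =
     set_reg 6 (Get (Value 1) (idx2 (reg 0) (Minus (reg 1) (Const 1)))) ;;
     set_reg 7 (Get (Value 1) (idx2 (reg 0) (reg 2))) ;;
     set_reg 8 (Get (Value 2) (idx3 (reg 0) (reg 1) (reg 2))) ;;
     Cond (Equal (reg 6) (Const 1)) (put_R False) Skip ;;
     Cond (Equal (reg 7) (Const 2)) (put_R False) Skip ;;
     Cond (BAnd (Equal (reg 6) (Const 2)) (Equal (reg 7) (Const 1))) (put_R True) Skip ;;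
     Cond (Equal (reg 8) (Const 1)) (put_B False (Minus (reg 1) (Const 1)) ;; put_B True (reg 2)) Skip ;;
     Cond (BAnd (Equal (reg 8) (Const 2)) (Equal (reg 6) (Const 2))) (put_B False (reg 2)) Skip ;;
     Cond (BAnd (Equal (reg 8) (Const 2)) (Equal (reg 7) (Const 1)))
       (put_B True (Minus (reg 1) (Const 1))) Skip"

lemma rel_B: "rel n d s \<sigma> \<Longrightarrow> v \<in> {1..n} \<Longrightarrow> i \<le> d \<Longrightarrow> s (Value 1) (index2 d v i) = vc (vals \<sigma>) (B v i)"
  by (simp add: rel_def B_repr_def)

lemma rel_R: "rel n d s \<sigma> \<Longrightarrow> cell n d v l u \<Longrightarrow> s (Value 2) (index3 d v l u) = vc (vals \<sigma>) (R v l u)"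
  by (simp add: rel_def R_repr_def)

lemma run_check:
  assumes s: "rel n d s \<sigma>" and c: "cell n d v l u"
    and regs: "s (Work 6) 0 = v" "s (Work 6) 1 = l" "s (Work 6) 2 = u"
  shows "run check_code s 110 (\<lambda>s'. rel n d s' (check v l u \<sigma>) \<and> frame {3..8} s s')"
proof -
  have rng: "v \<in> {1..n}" "v \<le> n" "l \<le> d" "l - 1 \<le> d" "u \<le> d" "v \<le> (n + 1) * (d + 1)"
    using c by (auto simp: cell_def)
  have con: "consistent (vals \<sigma>)" using s by (simp add: rel_def)
  let ?X = "vals \<sigma>"
  let ?x = "vc ?X (B v (l - 1))" and ?y = "vc ?X (B v u)" and ?z = "vc ?X (R v l u)"
  let ?s = "s(Work 6 := (s (Work 6))(6 := ?x, 7 := ?y, 8 := ?z))"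
  let ?P = "enqueued n d ?s \<sigma>"
  note vc = vc_iff(2,3)[OF con]
  have s': "rel n d ?s \<sigma>" using s by simp
  have regs': "?s (Work 6) 0 = v" "?s (Work 6) 1 = l" "?s (Work 6) 2 = u"
    "?s (Work 6) 6 = ?x" "?s (Work 6) 7 = ?y" "?s (Work 6) 8 = ?z"
    using regs by auto
  note r = enqueued_reg[where s = ?s and \<sigma> = \<sigma> and n = n and d = d]
  let ?E1 = "if (B v (l - 1), True) \<in> ?X then [(R v l u, False)] else []"
  let ?E2 = "if (B v u, False) \<in> ?X then [(R v l u, False)] else []"
  let ?E3 = "if (B v (l - 1), False) \<in> ?X \<and> (B v u, True) \<in> ?X then [(R v l u, True)] else []"
  let ?E4 = "if (R v l u, True) \<in> ?X then [(B v (l - 1), False), (B v u, True)] else []"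
  let ?E5 = "if (R v l u, False) \<in> ?X \<and> (B v (l - 1), False) \<in> ?X then [(B v u, False)] else []"
  let ?E6 = "if (R v l u, False) \<in> ?X \<and> (B v u, True) \<in> ?X then [(B v (l - 1), True)] else []"
  let ?c1 = "Cond (Equal (reg 6) (Const 1)) (put_R False) Skip"
  let ?c2 = "Cond (Equal (reg 7) (Const 2)) (put_R False) Skip"
  let ?c3 = "Cond (BAnd (Equal (reg 6) (Const 2)) (Equal (reg 7) (Const 1))) (put_R True) Skip"
  let ?c4 = "Cond (Equal (reg 8) (Const 1))
    (put_B False (Minus (reg 1) (Const 1)) ;; put_B True (reg 2)) Skip"
  let ?c5 = "Cond (BAnd (Equal (reg 8) (Const 2)) (Equal (reg 6) (Const 2))) (put_B False (reg 2)) Skip"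
  let ?c6 = "Cond (BAnd (Equal (reg 8) (Const 2)) (Equal (reg 7) (Const 1)))
    (put_B True (Minus (reg 1) (Const 1))) Skip"
  have 1: "run ?c1 s1 15 (?P (E @ ?E1))" if "?P E s1" for E s1
    by (rule run_enqueued_when[OF that _ run_enqueued_R[OF that c]]) (use r[OF that] regs' vc in simp_all)
  have 2: "run ?c2 s1 15 (?P (E @ ?E2))" if "?P E s1" for E s1
    by (rule run_enqueued_when[OF that _ run_enqueued_R[OF that c]]) (use r[OF that] regs' vc in simp_all)
  have 3: "run ?c3 s1 15 (?P (E @ ?E3))" if "?P E s1" for E s1
    by (rule run_enqueued_when[OF that _ run_enqueued_R[OF that c]]) (use r[OF that] regs' vc in simp_all)
  have 4: "run ?c4 s1 25 (?P (E @ ?E4))" if "?P E s1" for E s1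
  proof -
    have "run (put_B False (Minus (reg 1) (Const 1)) ;; put_B True (reg 2)) s1 24
        (?P ((E @ [(B v (l - 1), False)]) @ [(B v u, True)]))"
    proof (rule run_Seq)
      show "run (put_B False (Minus (reg 1) (Const 1))) s1 12 (?P (E @ [(B v (l - 1), False)]))"
        by (rule run_enqueued_B[OF that]) (use r[OF that] regs' rng in simp_all)
      fix s2 assume s2: "?P (E @ [(B v (l - 1), False)]) s2"
      show "run (put_B True (reg 2)) s2 (24 - 12) (?P ((E @ [(B v (l - 1), False)]) @ [(B v u, True)]))"
        using run_enqueued_B[OF s2, of v u "reg 2" True] r[OF s2] regs' rng by simp
    qed simp
    then show ?thesis
      by (intro run_enqueued_when[OF that, where T = 24]) (use r[OF that] regs' vc in simp_all)
  qed
  have 5: "run ?c5 s1 13 (?P (E @ ?E5))" if "?P E s1" for E s1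
    by (rule run_enqueued_when[OF that _ run_enqueued_B[OF that]]) (use r[OF that] regs' vc rng in simp_all)
  have 6: "run ?c6 s1 13 (?P (E @ ?E6))" if "?P E s1" for E s1
    by (rule run_enqueued_when[OF that _ run_enqueued_B[OF that]]) (use r[OF that] regs' vc rng in simp_all)
  have cons: "(((([] @ ?E1) @ ?E2) @ ?E3) @ ?E4) @ ?E5 @ ?E6 = cell_cons ?X v l u"
    unfolding cell_cons_def by (simp only: append_assoc append_Nil)
  \<comment> \<open>The six conditionals take at most 15 + 15 + 15 + 25 + 13 + 13 = 96 steps; with
    slack this is 107, and the three loads before them make it 110.\<close>
  have "run (?c1 ;; ?c2 ;; ?c3 ;; ?c4 ;; ?c5 ;; ?c6) ?s 107
      (?P ((((([] @ ?E1) @ ?E2) @ ?E3) @ ?E4) @ ?E5 @ ?E6))"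
    apply (rule run_Seq[OF 1[OF enqueued_Nil[OF s']]])
    apply (rule run_Seq[OF 2], assumption)
    apply (rule run_Seq[OF 3], assumption)
    apply (rule run_Seq[OF 4], assumption)
    apply (rule run_Seq[OF 5], assumption)
    apply (rule run_mono[OF 6], assumption)
    apply (simp_all del: append_Nil)
    done
  then have main: "run (?c1 ;; ?c2 ;; ?c3 ;; ?c4 ;; ?c5 ;; ?c6) ?s 107
     (\<lambda>s'. rel n d s' (check v l u \<sigma>) \<and> frame {3..8} s s')"
    unfolding cons
    by (rule run_mono) (auto simp: enqueued_def check_def frame_def)
  have a1: "aval (idx2 (reg 0) (Minus (reg 1) (Const 1))) s = index2 d v (l - 1)"
    using aval_idx2[OF s, of "reg 0"] rng regs by simp
  let ?t = "s(Work 6 := (s (Work 6))(6 := ?x))"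
  have "rel n d ?t \<sigma>" using s by simp
  then have a2: "aval (idx2 (reg 0) (reg 2)) ?t = index2 d v u"
    using aval_idx2[of n d ?t \<sigma> "reg 0"] rng regs by simp
  let ?w = "s(Work 6 := (s (Work 6))(6 := ?x, 7 := ?y))"
  have "rel n d ?w \<sigma>" using s by simp
  then have a3: "aval (idx3 (reg 0) (reg 1) (reg 2)) ?w = index3 d v l u"
    using aval_idx3[of n d ?w \<sigma> "reg 0" "reg 1"] rng regs by simp
  show ?thesis
    unfolding check_code_def run_Seq_Put
    using main a1 a2 a3 rel_B[OF s rng(1,4)] rel_B[OF s rng(1,5)] rel_R[OF s c]
    by simp
qed

definition proc_B :: com where
  "proc_B =
     set_reg 6 (Get (Value 1) (idx2 (reg 0) (reg 10))) ;;
     Cond (BAnd (Equal (reg 6) (Const 1)) (Less (reg 10) (Get Size (Const 1))))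
       (put_B True (Plus (reg 10) (Const 1))) Skip ;;
     Cond (BAnd (Equal (reg 6) (Const 2)) (Less (Const 0) (reg 10)))
       (put_B False (Minus (reg 10) (Const 1))) Skip ;;
     set_reg 1 (Plus (reg 10) (Const 1)) ;; set_reg 2 (Plus (reg 10) (Const 1)) ;;
     for_loop 2 (Plus (Get Size (Const 1)) (Const 1)) check_code ;;
     set_reg 2 (reg 10) ;; set_reg 1 (Const 1) ;;
     for_loop 1 (Plus (reg 10) (Const 1)) check_code"

lemma rel_Size: "rel n d s \<sigma> \<Longrightarrow> s Size 0 = n \<and> s Size (Suc 0) = d"
  by (simp add: rel_def tables_def)

lemma run_proc_B:
  assumes s: "rel n d s \<sigma>" and v: "v \<in> {1..n}" "i \<le> d"
    and regs: "s (Work 6) 0 = v" "s (Work 6) 10 = i"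
  shows "run proc_B s (112 * d + 50) (\<lambda>s'. rel n d s' (process n d (B v i) \<sigma>))"
proof -
  let ?X = "vals \<sigma>"
  have con: "consistent ?X" using s by (simp add: rel_def)
  note vc = vc_iff(2,3)[OF con]
  let ?x = "vc ?X (B v i)"
  let ?s = "s(Work 6 := (s (Work 6))(6 := ?x))"
  let ?P = "enqueued n d ?s \<sigma>"
  have s': "rel n d ?s \<sigma>" using s by simp
  have regs': "?s (Work 6) 0 = v" "?s (Work 6) 10 = i" "?s (Work 6) 6 = ?x" using regs by auto
  note r = enqueued_reg[where s = ?s and \<sigma> = \<sigma> and n = n and d = d]
  have size: "s1 Size 0 = n" "s1 Size (Suc 0) = d" if "?P E s1" for E s1
    using that rel_Size unfolding enqueued_def by blast+
  let ?E1 = "if (B v i, True) \<in> ?X \<and> i < d then [(B v (Suc i), True)] else []"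
  let ?E2 = "if (B v i, False) \<in> ?X \<and> 0 < i then [(B v (i - 1), False)] else []"
  let ?c1 = "Cond (BAnd (Equal (reg 6) (Const 1)) (Less (reg 10) (Get Size (Const 1))))
       (put_B True (Plus (reg 10) (Const 1))) Skip"
  let ?c2 = "Cond (BAnd (Equal (reg 6) (Const 2)) (Less (Const 0) (reg 10)))
       (put_B False (Minus (reg 10) (Const 1))) Skip"
  let ?f2 = "for_loop 2 (Plus (Get Size (Const 1)) (Const 1)) check_code"
  let ?f1 = "for_loop 1 (Plus (reg 10) (Const 1)) check_code"
  have 1: "run ?c1 s1 13 (?P (E @ ?E1))" if "?P E s1" for E s1
  proof (cases "i < d")
    case True
    show ?thesis
      by (rule run_enqueued_when[OF that _ run_enqueued_B[OF that]])
        (use r[OF that] regs' vc v True size[OF that] in simp_all)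
  next
    case False
    then show ?thesis using that r[OF that] regs' size[OF that] by simp
  qed
  have 2: "run ?c2 s1 13 (?P (E @ ?E2))" if "?P E s1" for E s1
    by (rule run_enqueued_when[OF that _ run_enqueued_B[OF that]]) (use r[OF that] regs' vc v in simp_all)
  let ?\<sigma>1 = "fold enq (order_cons d ?X v i) \<sigma>"
  let ?\<sigma>2 = "fold (\<lambda>u. check v (Suc i) u) [Suc i..<Suc d] ?\<sigma>1"
  let ?P2 = "\<lambda>j s'. rel n d s' (fold (\<lambda>u. check v (Suc i) u) [Suc i..<j] ?\<sigma>1) \<and>
    s' (Work 6) 0 = v \<and> s' (Work 6) 10 = i \<and> s' (Work 6) 1 = Suc i \<and> s' (Work 6) 2 = j"
  let ?P3 = "\<lambda>j s'. rel n d s' (fold (\<lambda>l. check v l i) [1..<j] ?\<sigma>2) \<and>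
    s' (Work 6) 0 = v \<and> s' (Work 6) 10 = i \<and> s' (Work 6) 2 = i \<and> s' (Work 6) 1 = j"
  have loop2: "run (?f2) s1
      ((Suc d - Suc i) * (110 + 2) + 1) (?P2 (Suc d))" if "?P2 (Suc i) s1" for s1
  proof (rule run_for_loop[where P = ?P2 and lo = "Suc i" and s = s1])
    fix j s2 assume j: "Suc i \<le> j" "j < Suc d" and s2: "?P2 j s2"
    then have "cell n d v (Suc i) j" using v by (auto simp: cell_def)
    then have "run check_code s2 110 (\<lambda>s'. rel n d s' (check v (Suc i) j
        (fold (\<lambda>u. check v (Suc i) u) [Suc i..<j] ?\<sigma>1)) \<and> frame {3..8} s2 s')"
      using s2 by (intro run_check) auto
    then show "run check_code s2 110 (\<lambda>s'. s' (Work 6) 2 = j \<and>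
        ?P2 (Suc j) (s'(Work 6 := (s' (Work 6))(2 := Suc j))))"
      by (rule run_mono) (use s2 j in \<open>auto simp: frame_def\<close>)
  qed (use v that rel_Size in auto)
  have loop3: "run (?f1) s1
      ((Suc i - 1) * (110 + 2) + 1) (?P3 (Suc i))" if "?P3 1 s1" for s1
  proof (rule run_for_loop[where P = ?P3 and lo = 1 and s = s1])
    fix j s2 assume j: "1 \<le> j" "j < Suc i" and s2: "?P3 j s2"
    then have "cell n d v j i" using v by (auto simp: cell_def)
    then have "run check_code s2 110 (\<lambda>s'. rel n d s' (check v j i
        (fold (\<lambda>l. check v l i) [1..<j] ?\<sigma>2)) \<and> frame {3..8} s2 s')"
      using s2 by (intro run_check) auto
    then show "run check_code s2 110 (\<lambda>s'. s' (Work 6) 1 = j \<and>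
        ?P3 (Suc j) (s'(Work 6 := (s' (Work 6))(1 := Suc j))))"
      by (rule run_mono) (use s2 j in \<open>auto simp: frame_def\<close>)
  qed (use v that in auto)
  \<comment> \<open>The loops visit d - i and i cells, together d, at 110 steps for the check and 2
    for the loop overhead.\<close>
  have time: "(Suc d - Suc i) * (110 + 2) + (Suc i - 1) * (110 + 2) = 112 * d"
    using v(2) by (simp add: algebra_simps)
  have a: "aval (idx2 (reg 0) (reg 10)) s = index2 d v i"
    using aval_idx2[OF s, of "reg 0"] v regs by simp
  define Q where "Q = (\<lambda>s'. rel n d s' (process n d (B v i) \<sigma>))"
  have L3: "run (set_reg 2 (reg 10) ;; set_reg 1 (Const 1) ;; ?f1) s1 ((Suc i - 1) * (110 + 2) + 3)
     Q" if s1: "?P2 (Suc d) s1" for s1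
  proof -
    let ?t = "s1(Work 6 := (s1 (Work 6))(2 := i, 1 := 1))"
    have "?P3 1 ?t" using s1 by auto
    from loop3[OF this] have "run (?f1) ?t
      ((Suc i - 1) * (110 + 2) + 1) Q"
      by (rule run_mono) (auto simp: Q_def)
    then show ?thesis using s1 by simp
  qed
  have L2: "run (set_reg 1 (Plus (reg 10) (Const 1)) ;; set_reg 2 (Plus (reg 10) (Const 1)) ;; ?f2 ;; set_reg 2 (reg 10) ;; set_reg 1 (Const 1) ;; ?f1) s1 (112 * d + 10)
     Q" if s1: "?P (([] @ ?E1) @ ?E2) s1" for s1
  proof -
    let ?t = "s1(Work 6 := (s1 (Work 6))(1 := Suc i, 2 := Suc i))"
    have "?P2 (Suc i) ?t"
      using s1 r[OF s1] regs' by (simp add: enqueued_def order_cons_def)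
    from loop2[OF this] have "run (?f2 ;; set_reg 2 (reg 10) ;; set_reg 1 (Const 1) ;; ?f1) ?t (8 + 112 * d)
     Q"
    proof (rule run_Seq)
      fix s2 assume "?P2 (Suc d) s2"
      from L3[OF this] show "run (set_reg 2 (reg 10) ;; set_reg 1 (Const 1) ;; ?f1) s2
        (8 + 112 * d - ((Suc d - Suc i) * (110 + 2) + 1)) Q"
        by (rule run_mono) (use time in linarith)+
    qed (use time in linarith)
    then show ?thesis using r[OF s1] regs' by simp
  qed
  have "run (?c1 ;; ?c2 ;; set_reg 1 (Plus (reg 10) (Const 1)) ;; set_reg 2 (Plus (reg 10) (Const 1)) ;; ?f2 ;; set_reg 2 (reg 10) ;; set_reg 1 (Const 1) ;; ?f1) ?s (49 + 112 * d)
     Q"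
    apply (rule run_Seq[OF 1[OF enqueued_Nil[OF s']]])
     apply (rule run_Seq[OF 2], assumption)
      apply (rule run_mono[OF L2], assumption)
       apply simp_all
    done
  then show ?thesis
    unfolding proc_B_def run_Seq_Put Q_def[symmetric] using a rel_B[OF s v] by simp
qed

text \<open>Tests have no disjunction, hence the negated conjunction.\<close>

definition exclude_code :: com where
  "exclude_code =
     Cond (BNot (BAnd (Equal (Get (Value 2) (idx3 (reg 0) (reg 1) (reg 2))) (Const 1))
       (BNot (Less (Plus (Minus (reg 2) (reg 1)) (Const 1)) (Get (Work 7) (idx2 (reg 1) (reg 2)))))))
       (put_R False) Skip"

lemma rel_count: "rel n d s \<sigma> \<Longrightarrow> cell n d v l u \<Longrightarrow>
    s (Work 7) (index2 d l u) = true_count n (vals \<sigma>) l u"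
  by (auto simp: rel_def count_repr_def cells_def cell_def)

lemma rel_done: "rel n d s \<sigma> \<Longrightarrow> cell n d v l u \<Longrightarrow>
    s (Work 8) (index2 d l u) = of_bool ((l, u) \<in> don \<sigma>)"
  by (auto simp: rel_def done_repr_def cells_def cell_def)

lemma cell_aval:
  assumes s: "rel n d s \<sigma>" and c: "cell n d v l u"
    and regs: "s (Work 6) 0 = v" "s (Work 6) 1 = l" "s (Work 6) 2 = u"
  shows "aval (idx3 (reg 0) (reg 1) (reg 2)) s = index3 d v l u"
    "aval (idx2 (reg 1) (reg 2)) s = index2 d l u"
proof -
  have rng: "v \<le> n" "l \<le> d" "l \<le> (n + 1) * (d + 1)" using c by (auto simp: cell_def)
  show "aval (idx3 (reg 0) (reg 1) (reg 2)) s = index3 d v l u"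
    using aval_idx3[OF s, of "reg 0" "reg 1"] rng regs by simp
  show "aval (idx2 (reg 1) (reg 2)) s = index2 d l u"
    using aval_idx2[OF s, of "reg 1"] rng regs by simp
qed

lemma run_exclude:
  assumes s: "rel n d s \<sigma>" and c: "cell n d w l u"
    and regs: "s (Work 6) 0 = w" "s (Work 6) 1 = l" "s (Work 6) 2 = u"
  shows "run exclude_code s 15 (\<lambda>s'. rel n d s' (exclude n l u w \<sigma>) \<and> frame {3, 4, 5} s s')"
proof -
  note a = cell_aval[OF s c regs]
  have con: "consistent (vals \<sigma>)" using s by (simp add: rel_def)
  have lu: "l \<le> u" using c by (simp add: cell_def)
  define e3 where "e3 = idx3 (reg 0) (reg 1) (reg 2)"
  define e2 where "e2 = idx2 (reg 1) (reg 2)"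
  have b: "bval (BNot (BAnd (Equal (Get (Value 2) e3) (Const 1))
      (BNot (Less (Plus (Minus (reg 2) (reg 1)) (Const 1)) (Get (Work 7) e2))))) s \<longleftrightarrow>
      (R w l u, True) \<notin> vals \<sigma> \<or> Suc (u - l) < true_count n (vals \<sigma>) l u"
    using a regs rel_R[OF s c] rel_count[OF s c] vc_iff(2)[OF con] by (simp add: e3_def e2_def)
  show ?thesis
    using run_put_R[OF s c regs, of False] s b
    unfolding exclude_code_def e3_def[symmetric] e2_def[symmetric] run_Cond
    by (simp add: exclude_def)
qed

definition proc_R :: com where
  "proc_R =
     set_reg 1 (reg 10) ;; set_reg 2 (reg 11) ;; check_code ;;
     set_reg 4 (idx2 (reg 1) (reg 2)) ;;
     Cond (BAnd (Equal (Get (Value 2) (idx3 (reg 0) (reg 1) (reg 2))) (Const 1))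
         (BAnd (Equal (Get (Work 8) (reg 4)) (Const 0))
           (Less (Minus (reg 2) (reg 1)) (Get (Work 7) (reg 4)))))
       (Put (Work 8) (reg 4) (Const 1) ;; set_reg 0 (Const 1) ;;
        for_loop 0 (Plus (Get Size (Const 0)) (Const 1)) exclude_code)
       Skip"

lemma done_repr_insert:
  assumes "done_repr d f D" "(l, u) \<in> cells d"
  shows "done_repr d (f(index2 d l u := 1)) (insert (l, u) D)"
  unfolding done_repr_def
proof (intro ballI, clarify)
  fix l' u' assume c: "(l', u') \<in> cells d"
  have "index2 d l' u' = index2 d l u \<longleftrightarrow> l' = l \<and> u' = u"
    using c assms(2) by (intro index2_inj) (auto simp: cells_def)
  then show "(f(index2 d l u := 1)) (index2 d l' u') = of_bool ((l', u') \<in> insert (l, u) D)"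
    using assms(1) c by (auto simp: done_repr_def)
qed

lemma run_hall:
  assumes s: "rel n d s \<sigma>" and c: "cell n d v l u"
    and regs: "s (Work 6) 0 = v" "s (Work 6) 1 = l" "s (Work 6) 2 = u"
  shows "run (set_reg 4 (idx2 (reg 1) (reg 2)) ;;
     Cond (BAnd (Equal (Get (Value 2) (idx3 (reg 0) (reg 1) (reg 2))) (Const 1))
         (BAnd (Equal (Get (Work 8) (reg 4)) (Const 0))
           (Less (Minus (reg 2) (reg 1)) (Get (Work 7) (reg 4)))))
       (Put (Work 8) (reg 4) (Const 1) ;; set_reg 0 (Const 1) ;;
        for_loop 0 (Plus (Get Size (Const 0)) (Const 1)) exclude_code)
       Skip) s (10 + (if hall_trigger n v l u \<sigma> then 20 * n else 0))
     (\<lambda>s'. rel n d s' (hall_step n v l u \<sigma>))"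
proof -
  note a = cell_aval[OF s c regs]
  have con: "consistent (vals \<sigma>)" using s by (simp add: rel_def)
  have lu: "(l, u) \<in> cells d" using c by (auto simp: cell_def cells_def)
  let ?s = "s(Work 6 := (s (Work 6))(4 := index2 d l u))"
  have s1: "rel n d ?s \<sigma>" using s by simp
  define e3 where "e3 = idx3 (reg 0) (reg 1) (reg 2)"
  define e2 where "e2 = idx2 (reg 1) (reg 2)"
  have a': "aval e3 ?s = index3 d v l u" "aval e2 s = index2 d l u"
    using cell_aval[OF s1 c] regs a by (simp_all add: e3_def e2_def)
  define bb where "bb = BAnd (Equal (Get (Value 2) e3) (Const 1))
         (BAnd (Equal (Get (Work 8) (reg 4)) (Const 0))
           (Less (Minus (reg 2) (reg 1)) (Get (Work 7) (reg 4))))"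
  have b: "bval bb ?s \<longleftrightarrow> hall_trigger n v l u \<sigma>"
    using a' regs rel_R[OF s c] rel_count[OF s c] rel_done[OF s c] vc_iff(2)[OF con]
    by (simp add: hall_trigger_def bb_def)
  define Q where "Q = (\<lambda>s'. rel n d s' (hall_step n v l u \<sigma>))"
  have "run (Cond bb
       (Put (Work 8) (reg 4) (Const 1) ;; set_reg 0 (Const 1) ;;
        for_loop 0 (Plus (Get Size (Const 0)) (Const 1)) exclude_code)
       Skip) ?s (9 + (if hall_trigger n v l u \<sigma> then 20 * n else 0)) Q"
  proof (cases "hall_trigger n v l u \<sigma>")
    case False
    then show ?thesis using b s1 by (simp add: hall_step_def Q_def)
  next
    case True
    let ?\<tau> = "\<sigma>\<lparr>don := insert (l, u) (don \<sigma>)\<rparr>"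
    let ?t = "?s(Work 8 := (s (Work 8))(index2 d l u := 1), Work 6 := (s (Work 6))(4 := index2 d l u, 0 := 1))"
    let ?P = "\<lambda>j s'. rel n d s' (fold (exclude n l u) [1..<j] ?\<tau>) \<and>
      s' (Work 6) 0 = j \<and> s' (Work 6) 1 = l \<and> s' (Work 6) 2 = u"
    have "rel n d ?t ?\<tau>"
      using s done_repr_insert[OF _ lu, of "s (Work 8)" "don \<sigma>"] by (simp add: rel_def)
    then have t: "?P 1 ?t" using regs by simp
    have "run (for_loop 0 (Plus (Get Size (Const 0)) (Const 1)) exclude_code) ?t
        ((Suc n - 1) * (15 + 2) + 1) (?P (Suc n))"
    proof (rule run_for_loop[where P = ?P and lo = 1 and s = ?t])
      fix j s2 assume j: "1 \<le> j" "j < Suc n" and s2: "?P j s2"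
      then have "cell n d j l u" using c by (auto simp: cell_def)
      then have "run exclude_code s2 15 (\<lambda>s'. rel n d s' (exclude n l u j
          (fold (exclude n l u) [1..<j] ?\<tau>)) \<and> frame {3, 4, 5} s2 s')"
        using s2 by (intro run_exclude) auto
      then show "run exclude_code s2 15 (\<lambda>s'. s' (Work 6) 0 = j \<and>
          ?P (Suc j) (s'(Work 6 := (s' (Work 6))(0 := Suc j))))"
        by (rule run_mono) (use s2 j in \<open>auto simp: frame_def\<close>)
    qed (use t rel_Size in auto)
    then have loop: "run (for_loop 0 (Plus (Get Size (Const 0)) (Const 1)) exclude_code) ?t (6 + 20 * n) Q"
      by (rule run_mono) (use True in \<open>auto simp: Q_def hall_step_def\<close>)
    have "?s(Work 8 := (?s (Work 8))(index2 d l u := 1), Work 6 := (?s (Work 6))(0 := 1)) = ?t"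
      by (auto simp: fun_upd_def)
    then show ?thesis using loop b True by simp
  qed
  then show ?thesis
    unfolding Q_def[symmetric] e3_def[symmetric] e2_def[symmetric] bb_def[symmetric] run_Seq_Put using a' by simp
qed

lemma run_proc_R:
  assumes s: "rel n d s \<sigma>" and c: "cell n d v l u"
    and regs: "s (Work 6) 0 = v" "s (Work 6) 10 = l" "s (Work 6) 11 = u"
  shows "run proc_R s (130 + (if hall_trigger n v l u (check v l u \<sigma>) then 20 * n else 0))
    (\<lambda>s'. rel n d s' (process n d (R v l u) \<sigma>))"
proof -
  let ?s = "s(Work 6 := (s (Work 6))(1 := l, 2 := u))"
  let ?h = "if hall_trigger n v l u (check v l u \<sigma>) then 20 * n else 0"
  define Q where "Q = (\<lambda>s'. rel n d s' (process n d (R v l u) \<sigma>))"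
  define hc where "hc = (set_reg 4 (idx2 (reg 1) (reg 2)) ;;
     Cond (BAnd (Equal (Get (Value 2) (idx3 (reg 0) (reg 1) (reg 2))) (Const 1))
         (BAnd (Equal (Get (Work 8) (reg 4)) (Const 0))
           (Less (Minus (reg 2) (reg 1)) (Get (Work 7) (reg 4)))))
       (Put (Work 8) (reg 4) (Const 1) ;; set_reg 0 (Const 1) ;;
        for_loop 0 (Plus (Get Size (Const 0)) (Const 1)) exclude_code)
       Skip)"
  have "run check_code ?s 110 (\<lambda>s'. rel n d s' (check v l u \<sigma>) \<and> frame {3..8} ?s s')"
    by (rule run_check) (use s c regs in auto)
  then have "run (check_code ;; hc) ?s (128 + ?h) Q"
  proof (rule run_Seq)
    fix s' assume s': "rel n d s' (check v l u \<sigma>) \<and> frame {3..8} ?s s'"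
    have "run hc s' (10 + ?h) Q"
      unfolding hc_def Q_def process.simps
      by (rule run_hall[OF _ c]) (use s' regs in \<open>auto simp: frame_def\<close>)
    then show "run hc s' (128 + ?h - 110) Q" by (rule run_mono) auto
  qed simp
  then have "run (check_code ;; hc) ?s (130 + ?h - 1 - 1) Q" by (rule run_mono) auto
  moreover have "(130 + ?h - 1) > 0" "130 + ?h > 0" by auto
  ultimately show ?thesis
    unfolding proc_R_def hc_def[symmetric] Q_def[symmetric] run_Seq_Put using regs by simp
qed

section \<open>The main loop and its amortised cost\<close>

definition main_loop :: com where
  "main_loop = While (BAnd (Equal (Get Conflict (Const 0)) (Const 0)) (Less (Const 0) sp))
     (Put (Work 5) (Const 0) (Minus sp (Const 1)) ;;
      set_reg 9 (Get (Work 1) sp) ;; set_reg 0 (Get (Work 2) sp) ;;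
      set_reg 10 (Get (Work 3) sp) ;; set_reg 11 (Get (Work 4) sp) ;;
      Cond (Equal (reg 9) (Const 0)) proc_B proc_R)"

lemma rel_pop:
  assumes s: "rel n d s \<sigma>" and ne: "stk \<sigma> \<noteq> []"
  defines "m \<equiv> s (Work 5) 0 - 1"
  shows "atom_code (last (stk \<sigma>)) = [s (Work 1) m, s (Work 2) m, s (Work 3) m, s (Work 4) m]"
    "rel n d (s(Work 5 := (s (Work 5))(0 := m), Work 6 := f)) (pop \<sigma>)"
proof -
  have st: "stack_repr (s (Work 1)) (s (Work 2)) (s (Work 3)) (s (Work 4)) (s (Work 5) 0) (stk \<sigma>)"
    using s by (simp add: rel_def)
  then have m: "m = length (stk \<sigma>) - 1" "m < s (Work 5) 0" using ne by (auto simp: stack_repr_def m_def)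
  have "last (stk \<sigma>) = stk \<sigma> ! m" using ne m by (simp add: last_conv_nth)
  then show "atom_code (last (stk \<sigma>)) = [s (Work 1) m, s (Work 2) m, s (Work 3) m, s (Work 4) m]"
    using st m by (simp add: stack_repr_def)
  have "stack_repr (s (Work 1)) (s (Work 2)) (s (Work 3)) (s (Work 4)) m (butlast (stk \<sigma>))"
    using st m by (auto simp: stack_repr_def nth_butlast)
  then show "rel n d (s(Work 5 := (s (Work 5))(0 := m), Work 6 := f)) (pop \<sigma>)"
    using s by (simp add: rel_def pop_def)
qed

text \<open>The weights suffice because 112 d + 50 and 130 + 20 n, plus the few steps for popping,
  stay below \<open>400 * (d + 1)\<close> and 400 + \<open>100 * (n + 1)\<close>, respectively. The
  unit subtracted here is left for the test of the loop.\<close>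

lemma run_body:
  assumes s: "rel n d s \<sigma>" and ne: "stk \<sigma> \<noteq> []" and a: "last (stk \<sigma>) \<in> core_atoms n d"
  shows "run (Put (Work 5) (Const 0) (Minus sp (Const 1)) ;;
      set_reg 9 (Get (Work 1) sp) ;; set_reg 0 (Get (Work 2) sp) ;;
      set_reg 10 (Get (Work 3) sp) ;; set_reg 11 (Get (Work 4) sp) ;;
      Cond (Equal (reg 9) (Const 0)) proc_B proc_R) s (process_cost n d (last (stk \<sigma>)) (pop \<sigma>) - 1)
    (\<lambda>s'. rel n d s' (process n d (last (stk \<sigma>)) (pop \<sigma>)))"
proof -
  define m where "m = s (Work 5) 0 - 1"
  let ?t = "s(Work 5 := (s (Work 5))(0 := m), Work 6 := (s (Work 6))
    (9 := s (Work 1) m, 0 := s (Work 2) m, 10 := s (Work 3) m, 11 := s (Work 4) m))"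
  note p = rel_pop[OF s ne, folded m_def]
  define Q where "Q = (\<lambda>s'. rel n d s' (process n d (last (stk \<sigma>)) (pop \<sigma>)))"
  define T where "T = process_cost n d (last (stk \<sigma>)) (pop \<sigma>) - 10"
  have T: "process_cost n d (last (stk \<sigma>)) (pop \<sigma>) = T + 10"
    unfolding T_def by (cases "last (stk \<sigma>)") auto
  have "run (Cond (Equal (reg 9) (Const 0)) proc_B proc_R) ?t (T + 1) Q"
  proof (cases "last (stk \<sigma>)")
    case (B v i)
    have "run proc_B ?t (112 * d + 50) (\<lambda>s'. rel n d s' (process n d (B v i) (pop \<sigma>)))"
      by (rule run_proc_B[OF p(2)]) (use p(1) a B in auto)
    then have "run proc_B ?t T Q"
      by (rule run_mono) (use T B in \<open>auto simp: Q_def\<close>)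
    then show ?thesis using p(1) B by simp
  next
    case (R v l u)
    have "run proc_R ?t (130 + (if hall_trigger n v l u (check v l u (pop \<sigma>)) then 20 * n else 0))
        (\<lambda>s'. rel n d s' (process n d (R v l u) (pop \<sigma>)))"
      by (rule run_proc_R[OF p(2)]) (use p(1) a R in auto)
    then have "run proc_R ?t T Q"
      by (rule run_mono) (use T R in \<open>auto simp: Q_def split: if_splits\<close>)
    then show ?thesis using p(1) R by simp
  qed (use a in auto)
  then have run: "run (Cond (Equal (reg 9) (Const 0)) proc_B proc_R) ?t (4 + T) Q"
    by (rule run_mono) auto
  define c where "c = Cond (Equal (reg 9) (Const 0)) proc_B proc_R"
  show ?thesis
    using run unfolding T c_def[symmetric] Q_def[symmetric] by (simp add: m_def)
qed

lemma main_loop_correct: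
  assumes "rel n d s \<sigma>" "prop_inv n d X \<sigma>"
  shows "\<exists>t s' \<sigma>'. exec main_loop s t s' \<and> rel n d s' \<sigma>' \<and> prop_inv n d X \<sigma>' \<and>
    (cfl \<sigma>' \<or> stk \<sigma>' = []) \<and> t + pot n d \<sigma>' \<le> pot n d \<sigma> + 1"
proof -
  let ?I = "\<lambda>k s. \<exists>\<sigma>. rel n d s \<sigma> \<and> prop_inv n d X \<sigma> \<and> pot n d \<sigma> = k"
  let ?b = "BAnd (Equal (Get Conflict (Const 0)) (Const 0)) (Less (Const 0) sp)"
  have b: "bval ?b s \<longleftrightarrow> \<not> cfl \<sigma> \<and> stk \<sigma> \<noteq> []" if "rel n d s \<sigma>" for s \<sigma>
    using that by (auto simp: rel_def stack_repr_def)
  have "\<exists>t s' k'. exec main_loop s t s' \<and> ?I k' s' \<and> \<not> bval ?b s' \<and> t + k' \<le> pot n d \<sigma> + 1"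
    unfolding main_loop_def
  proof (rule exec_While_potential[where I = ?I])
    fix k s assume "?I k s" and bv: "bval ?b s"
    then obtain \<sigma> where \<sigma>: "rel n d s \<sigma>" "prop_inv n d X \<sigma>" "pot n d \<sigma> = k" by blast
    have ne: "stk \<sigma> \<noteq> []" and nc: "\<not> cfl \<sigma>" using b[OF \<sigma>(1)] bv by auto
    have core: "last (stk \<sigma>) \<in> core_atoms n d"
      using \<sigma>(2) last_in_set[OF ne] by (auto simp: prop_inv_def good_def)
    note p = process_inv[OF \<sigma>(2) ne nc]
    have pos: "process_cost n d (last (stk \<sigma>)) (pop \<sigma>) > 0"
      by (cases "last (stk \<sigma>)") auto
    show "\<exists>t s' k'. exec (Put (Work 5) (Const 0) (Minus sp (Const 1)) ;;
      set_reg 9 (Get (Work 1) sp) ;; set_reg 0 (Get (Work 2) sp) ;;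
      set_reg 10 (Get (Work 3) sp) ;; set_reg 11 (Get (Work 4) sp) ;;
      Cond (Equal (reg 9) (Const 0)) proc_B proc_R) s t s' \<and> ?I k' s' \<and> t + 1 + k' \<le> k"
    proof -
      obtain t s' where 1: "exec (Put (Work 5) (Const 0) (Minus sp (Const 1)) ;;
        set_reg 9 (Get (Work 1) sp) ;; set_reg 0 (Get (Work 2) sp) ;;
        set_reg 10 (Get (Work 3) sp) ;; set_reg 11 (Get (Work 4) sp) ;;
        Cond (Equal (reg 9) (Const 0)) proc_B proc_R) s t s'"
        "t \<le> process_cost n d (last (stk \<sigma>)) (pop \<sigma>) - 1"
        "rel n d s' (process n d (last (stk \<sigma>)) (pop \<sigma>))"
        using run_body[OF \<sigma>(1) ne core] unfolding run_def by blast
      let ?\<sigma>' = "process n d (last (stk \<sigma>)) (pop \<sigma>)"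
      have "t + 1 + pot n d ?\<sigma>' \<le> k" using 1(2) p pos \<sigma>(3) by linarith
      then show ?thesis using 1(1,3) p by blast
    qed
  next
    show "?I (pot n d \<sigma>) s" using assms by blast
  qed
  then show ?thesis using b by blast
qed

section \<open>Initialisation\<close>

definition table_code :: com where
  "table_code =
     set_reg 1 (Const 0) ;; set_reg 0 (Const 0) ;;
     for_loop 1 (Plus (Get Size (Const 0)) (Const 1))
       (set_reg 0 (Plus (reg 0) (Plus (Get Size (Const 1)) (Const 1)))) ;;
     set_reg 1 (Const 0) ;;
     for_loop 1 (reg 0)
       (Put (Work 0) (Plus (reg 1) (Const 1))
         (Plus (Get (Work 0) (reg 1)) (Plus (Get Size (Const 1)) (Const 1)))) ;;
     set_reg 2 (Get (Work 0) (reg 0)) ;; set_reg 1 (Const 0) ;;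
     for_loop 1 (reg 2)
       (Put (Value 3) (reg 1) (Const 2) ;; Put (Value 4) (reg 1) (Const 2) ;;
        Put (Value 5) (reg 1) (Const 2) ;; Put (Value 7) (reg 1) (Const 2) ;;
        Put (Value 8) (reg 1) (Const 2))"

definition consts_code :: com where
  "consts_code =
     Put (Value 0) (Const 0) (Const 2) ;; Put (Value 0) (Const 1) (Const 1) ;;
     Put (Value 0) (Const 2) (Const 2) ;; Put (Value 0) (Const 3) (Const 1) ;;
     Put (Value 0) (Const 4) (Const 1) ;; Put (Value 0) (Const 5) (Const 2)"

definition domains_code :: com where
  "domains_code =
     set_reg 0 (Const 1) ;;
     for_loop 0 (Plus (Get Size (Const 0)) (Const 1))
       (put_B False (Const 0) ;; put_B True (Get Size (Const 1)) ;;
        put_B False (Minus (Get Lower (reg 0)) (Const 1)) ;; put_B True (Get Upper (reg 0)))"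

definition start_code :: com where
  "start_code = (table_code ;; consts_code ;; domains_code ;; main_loop)"

definition decision_code :: com where
  "decision_code =
     set_reg 0 (Get Decision (Const 1)) ;;
     Cond (Equal (Get Decision (Const 4)) (Const 1)) (set_reg 3 (Const 1)) (set_reg 3 (Const 2)) ;;
     Cond (Equal (Get Decision (Const 0)) (Const 0))
       (set_reg 5 (Get Decision (Const 2)) ;; enq_B)
       (set_reg 1 (Get Decision (Const 2)) ;; set_reg 2 (Get Decision (Const 3)) ;; enq_R)"

definition step_code :: com where
  "step_code = (decision_code ;; main_loop)"

text \<open>N is obtained by n + 1 additions of d + 1. The last entry of the table is
  \<open>N * (d + 1)\<close>, which is the length of the arrays to be filled.\<close>

lemma run_table_code:
  fixes n d :: nat and s :: store
  defines "N \<equiv> (n + 1) * (d + 1)"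
  assumes s: "s Size 0 = n" "s Size 1 = d" "s (Work 0) 0 = 0"
  shows "run table_code s (10 * (N * (d + 1)) + 10 * N + 10 * n + 20)
    (\<lambda>s'. tables n d (s' Size) (s' (Work 0)) \<and>
      (\<forall>x\<in>{Value 3, Value 4, Value 5, Value 7, Value 8}. all_false n d (s' x)) \<and>
      (\<forall>x. x \<notin> {Work 0, Work 6, Value 3, Value 4, Value 5, Value 7, Value 8} \<longrightarrow> s' x = s x))"
    (is "run _ _ _ ?Q")
proof -
  define Q where "Q = ?Q"
  define P1 where "P1 j s' \<longleftrightarrow> s' (Work 6) 1 = j \<and> s' (Work 6) 0 = j * (d + 1) \<and>
    (\<forall>x. x \<noteq> Work 6 \<longrightarrow> s' x = s x)" for j and s' :: store
  define P2 where "P2 j s' \<longleftrightarrow> s' (Work 6) 1 = j \<and> s' (Work 6) 0 = N \<and>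
    (\<forall>x\<le>j. s' (Work 0) x = x * (d + 1)) \<and>
    (\<forall>x. x \<notin> {Work 0, Work 6} \<longrightarrow> s' x = s x)" for j and s' :: store
  define P3 where "P3 j s' \<longleftrightarrow> s' (Work 6) 1 = j \<and> s' (Work 6) 2 = N * (d + 1) \<and>
    tables n d (s' Size) (s' (Work 0)) \<and>
    (\<forall>x\<in>{Value 3, Value 4, Value 5, Value 7, Value 8}. \<forall>y<j. s' x y = 2) \<and>
    (\<forall>x. x \<notin> {Work 0, Work 6, Value 3, Value 4, Value 5, Value 7, Value 8} \<longrightarrow> s' x = s x)"
    for j and s' :: store
  let ?c1 = "set_reg 0 (Plus (reg 0) (Plus (Get Size (Const 1)) (Const 1)))"
  let ?c2 = "Put (Work 0) (Plus (reg 1) (Const 1))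
         (Plus (Get (Work 0) (reg 1)) (Plus (Get Size (Const 1)) (Const 1)))"
  let ?c3 = "Put (Value 3) (reg 1) (Const 2) ;; Put (Value 4) (reg 1) (Const 2) ;;
        Put (Value 5) (reg 1) (Const 2) ;; Put (Value 7) (reg 1) (Const 2) ;;
        Put (Value 8) (reg 1) (Const 2)"
  have 1: "run (for_loop 1 (Plus (Get Size (Const 0)) (Const 1)) ?c1) s1 ((Suc n - 0) * (1 + 2) + 1) (P1 (Suc n))"
    if "P1 0 s1" for s1
    by (rule run_for_loop[where lo = 0]) (use that s in \<open>auto simp: P1_def\<close>)
  have 2: "run (for_loop 1 (reg 0) ?c2) s1 ((N - 0) * (1 + 2) + 1) (P2 N)" if "P2 0 s1" for s1
    by (rule run_for_loop[where lo = 0]) (use that s in \<open>auto simp: P2_def le_Suc_eq\<close>)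
  have 3: "run (for_loop 1 (reg 2) ?c3) s1 ((N * (d + 1) - 0) * (5 + 2) + 1) (P3 (N * (d + 1)))" if "P3 0 s1" for s1
    by (rule run_for_loop[where lo = 0]) (use that in \<open>auto simp: P3_def less_Suc_eq\<close>)
  have L3: "run (set_reg 2 (Get (Work 0) (reg 0)) ;; set_reg 1 (Const 0) ;; for_loop 1 (reg 2) ?c3) s1
      (7 * (N * (d + 1)) + 3) Q" if s1: "P2 N s1" for s1
  proof -
    let ?t = "s1(Work 6 := (s1 (Work 6))(2 := N * (d + 1), 1 := 0))"
    have "P3 0 ?t" using s1 s by (auto simp: P3_def P2_def tables_def N_def)
    from 3[OF this] have "run (for_loop 1 (reg 2) ?c3) ?t (1 + 7 * (N * (d + 1))) Q"
      by (rule run_mono) (auto simp: P3_def all_false_def N_def Q_def)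
    moreover have "s1 (Work 0) (s1 (Work 6) 0) = N * (d + 1)" using s1 by (simp add: P2_def)
    ultimately show ?thesis unfolding run_Seq_Put by (simp add: add.commute)
  qed
  have L2: "run (set_reg 1 (Const 0) ;; for_loop 1 (reg 0) ?c2 ;;
      set_reg 2 (Get (Work 0) (reg 0)) ;; set_reg 1 (Const 0) ;; for_loop 1 (reg 2) ?c3) s1
      (7 * (N * (d + 1)) + 3 * N + 5) Q" if s1: "P1 (Suc n) s1" for s1
  proof -
    let ?t = "s1(Work 6 := (s1 (Work 6))(1 := 0))"
    have "P2 0 ?t" using s1 s by (auto simp: P1_def P2_def N_def)
    from 2[OF this] have "run (for_loop 1 (reg 0) ?c2 ;;
      set_reg 2 (Get (Work 0) (reg 0)) ;; set_reg 1 (Const 0) ;; for_loop 1 (reg 2) ?c3) ?t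
      (7 * (N * (d + 1)) + 3 * N + 4) Q"
      by (rule run_Seq) (erule run_mono[OF L3], simp_all)
    then show ?thesis unfolding run_Seq_Put by (simp add: ac_simps)
  qed
  let ?t = "s(Work 6 := (s (Work 6))(1 := 0, 0 := 0))"
  have "P1 0 ?t" by (simp add: P1_def)
  from 1[OF this] have "run (for_loop 1 (Plus (Get Size (Const 0)) (Const 1)) ?c1 ;;
     set_reg 1 (Const 0) ;; for_loop 1 (reg 0) ?c2 ;;
     set_reg 2 (Get (Work 0) (reg 0)) ;; set_reg 1 (Const 0) ;; for_loop 1 (reg 2) ?c3) ?t
     (7 * (N * (d + 1)) + 3 * N + 3 * n + 10) Q"
    by (rule run_Seq) (erule run_mono[OF L2], simp_all)
  then have "run table_code s (7 * (N * (d + 1)) + 3 * N + 3 * n + 12) Q"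
    unfolding table_code_def run_Seq_Put by (simp add: ac_simps)
  then show ?thesis unfolding Q_def by (rule run_mono) (simp, assumption)
qed

definition empty_state :: pstate where
  "empty_state = \<lparr>vals = {}, stk = [], don = {}, cfl = False\<rparr>"

definition domain_lits :: "nat \<Rightarrow> (nat \<Rightarrow> nat) \<Rightarrow> (nat \<Rightarrow> nat) \<Rightarrow> nat \<Rightarrow> (atom \<times> bool) list" where
  "domain_lits d p q v = [(B v 0, False), (B v d, True), (B v (p v - 1), False), (B v (q v), True)]"

definition start_state :: "nat \<Rightarrow> nat \<Rightarrow> (nat \<Rightarrow> nat) \<Rightarrow> (nat \<Rightarrow> nat) \<Rightarrow> pstate" where
  "start_state n d p q = fold (\<lambda>v. fold enq (domain_lits d p q v)) [1..<Suc n] empty_state"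

lemma run_domains_code:
  assumes s: "rel n d s empty_state" and pq: "init_domains n d p q"
    and LU: "\<And>v. v \<in> {1..n} \<Longrightarrow> s Lower v = p v \<and> s Upper v = q v"
  shows "run domains_code s (50 * n + 2) (\<lambda>s'. rel n d s' (start_state n d p q))"
proof -
  let ?c = "put_B False (Const 0) ;; put_B True (Get Size (Const 1)) ;;
        put_B False (Minus (Get Lower (reg 0)) (Const 1)) ;; put_B True (Get Upper (reg 0))"
  let ?f = "\<lambda>v. fold enq (domain_lits d p q v)"
  define P where "P j s' \<longleftrightarrow> rel n d s' (fold ?f [1..<j] empty_state) \<and> s' (Work 6) 0 = j \<and>
    s' Lower = s Lower \<and> s' Upper = s Upper" for j s'
  have body: "run ?c s1 48 (enqueued n d s1 \<sigma> (domain_lits d p q v))"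
    if s1: "rel n d s1 \<sigma>" "s1 (Work 6) 0 = v" "s1 Lower = s Lower" "s1 Upper = s Upper" and v: "v \<in> {1..n}"
    for s1 \<sigma> v
  proof -
    have pq': "p v - 1 \<le> d" "q v \<le> d" using bspec[OF pq[unfolded init_domains_def] v] by linarith+
    let ?P = "enqueued n d s1 \<sigma>"
    have LU': "s2 Lower v = p v" "s2 Upper v = q v" "s2 Size 0 = n" "s2 Size (Suc 0) = d" "s2 (Work 6) 0 = v"
      if "?P E s2" for E s2
      using that s1 LU[OF v] rel_Size unfolding enqueued_def frame_def by auto
    have 1: "run (put_B False (Const 0)) s2 12 (?P ([] @ [(B v 0, False)]))" if "?P [] s2" for s2
      using run_enqueued_B[OF that s1(2) v] by simp
    have 2: "run (put_B True (Get Size (Const 1))) s2 12 (?P (E @ [(B v d, True)]))" if "?P E s2" for E s2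
      using run_enqueued_B[OF that s1(2) v] LU'[OF that] by simp
    have 3: "run (put_B False (Minus (Get Lower (reg 0)) (Const 1))) s2 12 (?P (E @ [(B v (p v - 1), False)]))"
      if "?P E s2" for E s2
      using run_enqueued_B[OF that s1(2) v] LU'[OF that] pq' by simp
    have 4: "run (put_B True (Get Upper (reg 0))) s2 12 (?P (E @ [(B v (q v), True)]))" if "?P E s2" for E s2
      using run_enqueued_B[OF that s1(2) v] LU'[OF that] pq' by simp
    have "run ?c s1 48 (?P ((([] @ [(B v 0, False)]) @ [(B v d, True)]) @ [(B v (p v - 1), False)] @ [(B v (q v), True)]))"
      apply (rule run_Seq[OF 1[OF enqueued_Nil[OF s1(1)]]])
       apply (rule run_Seq[OF 2], assumption)
        apply (rule run_Seq[OF 3], assumption)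
         apply (rule run_mono[OF 4], assumption)
          apply simp_all
      done
    then show ?thesis by (simp add: domain_lits_def)
  qed
  let ?t = "s(Work 6 := (s (Work 6))(0 := 1))"
  have t: "P 1 ?t" using s by (simp add: P_def)
  have "run (for_loop 0 (Plus (Get Size (Const 0)) (Const 1)) ?c) ?t ((Suc n - 1) * (48 + 2) + 1) (P (Suc n))"
  proof (rule run_for_loop[where P = P and lo = 1 and s = ?t])
    fix j s1 assume j: "1 \<le> j" "j < Suc n" and s1: "P j s1"
    have "run ?c s1 48 (enqueued n d s1 (fold ?f [1..<j] empty_state) (domain_lits d p q j))"
      using s1 j by (intro body) (auto simp: P_def)
    then show "run ?c s1 48 (\<lambda>s'. s' (Work 6) 0 = j \<and> P (Suc j) (s'(Work 6 := (s' (Work 6))(0 := Suc j))))"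
      by (rule run_mono) (use s1 j in \<open>auto simp: P_def enqueued_def frame_def\<close>)
  next
    show "P 1 ?t" by (rule t)
  qed (use rel_Size in \<open>auto simp: P_def\<close>)
  then have "run (for_loop 0 (Plus (Get Size (Const 0)) (Const 1)) ?c) ?t (50 * n + 1) (\<lambda>s'. rel n d s' (start_state n d p q))"
    by (rule run_mono) (auto simp: P_def start_state_def)
  then show ?thesis unfolding domains_code_def run_Seq_Put by (simp add: ac_simps)
qed

lemma not_der_empty: "\<not> der n d {} e"
proof
  assume "der n d {} e"
  then show False
  proof cases
    case (hall v l u S)
    then have "S = {}" by auto
    then show False using hall(4) by simp
  qed auto
qed

text \<open>All initial literals are still on the stack, so there are no processed premises, and
  without premises no rule applies.\<close>

lemma start_state_inv:
  assumes "init_domains n d p q"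
  shows "prop_inv n d (start_core n d p q) (start_state n d p q)"
    "pot n d (start_state n d p q) \<le> pot n d empty_state"
proof -
  let ?X = "start_core n d p q" and ?f = "\<lambda>v. fold enq (domain_lits d p q v)"
  let ?C = "cl n d ?X"
  have X: "set (domain_lits d p q v) \<subseteq> ?X" if "v \<in> set [1..<Suc n]" for v
    using that unfolding start_core_def domain_lits_def by auto
  have *: "good n d ?C (start_state n d p q) \<and> extends n d empty_state (start_state n d p q) \<and>
    (\<not> cfl (start_state n d p q) \<longrightarrow>
      (\<forall>v\<in>set [1..<Suc n]. set (domain_lits d p q v) \<subseteq> vals (start_state n d p q)))"
    unfolding start_state_def
  proof (rule fold_cover[where \<theta> = empty_state])
    fix v \<tau> assume v: "v \<in> set [1..<Suc n]" and "good n d ?C \<tau>"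
    then show "good n d ?C (?f v \<tau>) \<and> extends n d \<tau> (?f v \<tau>) \<and>
        (\<not> cfl (?f v \<tau>) \<longrightarrow> set (domain_lits d p q v) \<subseteq> vals (?f v \<tau>))"
      using X[OF v] subset_cl[of ?X n d] start_core_atoms[OF assms]
      by (intro fold_enq) blast+
  qed (auto simp: good_def empty_state_def consistent_def)
  then show "pot n d (start_state n d p q) \<le> pot n d empty_state" by (simp add: extends_def)
  have "pending_free (start_state n d p q) \<subseteq> pending_free empty_state"
    using * pending_free_ext by blast
  then have "pending_free (start_state n d p q) = {}" by (simp add: pending_free_def empty_state_def)
  moreover have "don (start_state n d p q) = {}" using * by (simp add: extends_def empty_state_def)
  moreover have "?X \<subseteq> vals (start_state n d p q)" if "\<not> cfl (start_state n d p q)"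
  proof -
    have "?X \<subseteq> (\<Union>v\<in>set [1..<Suc n]. set (domain_lits d p q v))"
      by (auto simp: start_core_def domain_lits_def)
    then show ?thesis using * that by blast
  qed
  ultimately show "prop_inv n d ?X (start_state n d p q)"
    using * not_der_empty by (simp add: prop_inv_def done_ok_def)
qed

section \<open>Correctness and total time of whole branches\<close>

lemma rel_represents:
  assumes s: "rel n d s \<sigma>" and core: "fst ` vals \<sigma> \<subseteq> core_atoms n d" and x: "(k, i, x) \<in> slots n d"
  shows "s (Value k) i = value_code (full n d (vals \<sigma>)) x"
proof -
  let ?F = "full n d (vals \<sigma>)"
  have con: "consistent (vals \<sigma>)" using s by (simp add: rel_def)
  note cF = consistent_full[OF con core]
  have f: "value_code ?F y = 2" if "y \<in> fixed_false n d" for y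
    using full_fixed(2)[OF that, of "vals \<sigma>"] cF by (auto simp: value_code_def consistent_def)
  have t: "value_code ?F y = 1" if "y \<in> fixed_true" for y
    using full_fixed(1)[OF that, of n d "vals \<sigma>"] by (auto simp: value_code_def)
  have c0: "consts_repr (s (Value 0))" using s by (simp add: rel_def)
  have af: "s (Value k) j = 2" if "k \<in> {3, 4, 5, 7, 8}" "j < (n + 1) * (d + 1) * (d + 1)" for k j
    using s that by (auto simp: rel_def all_false_def)
  have small: "index2 d v i < (n + 1) * (d + 1) * (d + 1)" if "v \<le> (n + 1) * (d + 1) - 1" "i \<le> d" for v i
    using index2_less[of v "(n + 1) * (d + 1) - 1" i d] that by simp
  consider
      "k = 0" "i = 0" "x = Atom Bot" | "k = 0" "i = 1" "x = Atom Sat" | "k = 0" "i = 2" "x = Atom Violate"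
    | "k = 0" "i = 3" "x = Body (Conj {})" | "k = 0" "i = 4" "x = Body (Conj {Neg Violate})"
    | "k = 0" "i = 5" "x = Body (Conj {Neg Sat})"
    | v j where "k = 1" "i = index2 d v j" "x = Atom (B v j)" "v \<in> {1..n}" "j \<in> {1..d}"
    | v l u where "k = 2" "i = index3 d v l u" "x = Atom (R v l u)" "cell n d v l u"
    | l u where "k = 3" "i = index2 d l u" "x = Body (hall_body n l u)" "1 \<le> l" "l \<le> u" "u \<le> d"
    | v j where "k = 4" "i = index2 d v j" "x = Body (order_body v j)" "v \<in> {1..n}" "1 \<le> j" "j < d"
    | v where "k = 5" "i = v" "x = Body (top_body d v)" "v \<in> {1..n}"
    | v l u where "k = 6" "i = index3 d v l u" "x = Body (r_body v l u)" "cell n d v l u"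
    | v l u where "k = 7" "i = index3 d v l u" "x = Body (lower_body v l u)" "cell n d v l u" "1 < l"
    | v l u where "k = 8" "i = index3 d v l u" "x = Body (upper_body v l u)" "cell n d v l u"
  proof -
    from x show ?thesis
      unfolding slots_def
      apply (elim UnE)
      subgoal using that(1-6) by auto
      subgoal using that(7) by blast
      subgoal using that(8) unfolding cell_def by blast
      subgoal using that(9) by blast
      subgoal using that(10) by blast
      subgoal using that(11) by blast
      subgoal using that(12) unfolding cell_def by blast
      subgoal using that(13) unfolding cell_def by (auto simp: less_imp_le)
      subgoal using that(14) unfolding cell_def by blast
      done
  qed
  then show ?thesis
  proof cases
    case 1
    then show ?thesis using f[of x] c0 by (simp add: fixed_false_def consts_repr_def)
  next
    case 2
    then show ?thesis using t[of x] c0 by (simp add: fixed_true_def consts_repr_def)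
  next
    case 3
    then show ?thesis using f[of x] c0 by (simp add: fixed_false_def consts_repr_def)
  next
    case 4
    then show ?thesis using t[of x] c0 by (simp add: fixed_true_def consts_repr_def)
  next
    case 5
    then show ?thesis using t[of x] c0 by (simp add: fixed_true_def consts_repr_def)
  next
    case 6
    then show ?thesis using f[of x] c0 by (simp add: fixed_false_def consts_repr_def)
  next
    case (7 v j)
    then have "value_code ?F x = vc (vals \<sigma>) (B v j)"
      by (auto simp: value_code_def vc_def full_Atom[OF core])
    then show ?thesis using 7 rel_B[OF s 7(4), of j] by simp
  next
    case (8 v l u)
    then have "value_code ?F x = vc (vals \<sigma>) (R v l u)"
      by (auto simp: value_code_def vc_def full_Atom[OF core])
    then show ?thesis using 8 rel_R[OF s] by simp
  next
    case (9 l u)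
    have "l \<le> (n + 1) * (d + 1) - 1" using 9 by simp
    then have "index2 d l u < (n + 1) * (d + 1) * (d + 1)" using 9 by (intro small) auto
    moreover have "x \<in> fixed_false n d" using 9 by (auto simp: fixed_false_def)
    ultimately show ?thesis using 9(1,2) af f by simp
  next
    case (10 v j)
    have "v \<le> (n + 1) * (d + 1) - 1" using 10 by simp
    then have "index2 d v j < (n + 1) * (d + 1) * (d + 1)" using 10 by (intro small) auto
    moreover have "x \<in> fixed_false n d" using 10 by (auto simp: fixed_false_def)
    ultimately show ?thesis using 10(1,2) af f by simp
  next
    case (11 v)
    have "v < (n + 1) * (d + 1) * (d + 1)" using 11 by (simp add: algebra_simps)
    moreover have "x \<in> fixed_false n d" using 11 by (auto simp: fixed_false_def)
    ultimately show ?thesis using 11(1,2) af f by simp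
  next
    case (12 v l u)
    then have "value_code ?F x = vc (vals \<sigma>) (R v l u)"
      by (simp add: value_code_def vc_def full_r_body)
    moreover have "s (Value 6) i = vc (vals \<sigma>) (R v l u)"
      using s 12 by (auto simp: rel_def R_repr_def)
    ultimately show ?thesis using 12(1) by simp
  next
    case (13 v l u)
    then have "index3 d v l u < (n + 1) * (d + 1) * (d + 1)" by (intro index3_less) (auto simp: cell_def)
    moreover have "x \<in> fixed_false n d" using 13 by (auto simp: fixed_false_def)
    ultimately show ?thesis using 13(1,2) af f by simp
  next
    case (14 v l u)
    then have "index3 d v l u < (n + 1) * (d + 1) * (d + 1)" by (intro index3_less) (auto simp: cell_def)
    moreover have "x \<in> fixed_false n d" using 14 by (auto simp: fixed_false_def)
    ultimately show ?thesis using 14(1,2) af f by simp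
  qed
qed

text \<open>The fixpoint before the decision is itself the extension of a closed set; adding the
  decided literal on both sides gives an instance of \<open>up_core\<close>.\<close>

lemma up_core_step:
  fixes b :: bool
  assumes nd: "1 \<le> n" "1 \<le> d" and X: "closed n d X" "consistent X" "fst ` X \<subseteq> core_atoms n d"
    and XB: "\<And>v. v \<in> {1..n} \<Longrightarrow> (B v 0, False) \<in> X \<and> (B v d, True) \<in> X"
    and a: "a \<in> core_atoms n d" "\<forall>v. a \<noteq> B v 0" "(a, True) \<notin> X" "(a, False) \<notin> X"
  defines "P \<equiv> alldiff_program n d" and "C \<equiv> cl n d (insert (a, b) X)"
  defines "U \<equiv> up (nogoods P) (insert (Atom a, b) (full n d X))"
  shows "conflict (nogoods P) U \<longleftrightarrow> \<not> consistent C" "consistent C \<Longrightarrow> U = full n d C"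
proof -
  let ?X = "insert (a, b) X" and ?A = "insert (Atom a, b) (full n d X)"
  have X': "fst ` ?X \<subseteq> core_atoms n d" using X(3) a(1) by auto
  have sub: "?X \<subseteq> C" unfolding C_def by (rule subset_cl)
  then have "full n d X \<subseteq> full n d C" unfolding full_def by blast
  moreover have "(Atom a, b) \<in> full n d C" using sub a(2) unfolding full_def by blast
  ultimately have 1: "?A \<subseteq> full n d C" by blast
  have "a \<noteq> Sat" "a \<noteq> Bot" "a \<noteq> Violate" using a(1) by auto
  then have "(Atom a, b') \<notin> full n d X" for b'
    using a(3,4) by (cases b') (auto simp: full_Atom[OF X(3)])
  then have 2: "consistent ?A" using consistent_full[OF X(2,3)] by (intro consistent_insert)
  have 3: "(Atom Violate, False) \<in> ?A" by (simp add: full_fixed fixed_false_def)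
  have 4: "?X \<subseteq> core_of n (up (nogoods P) ?A)"
  proof
    fix x assume x: "x \<in> ?X"
    obtain a' b' where ab: "x = (a', b')" by (cases x)
    show "x \<in> core_of n (up (nogoods P) ?A)"
    proof (cases "\<exists>v. a' = B v 0")
      case True
      then obtain v where v: "a' = B v 0" by blast
      then have "(B v 0, b') \<in> X" using x ab a(2) by auto
      moreover from this have "v \<in> {1..n}" using X(3) by force
      ultimately have "v \<in> {1..n}" "\<not> b'" using XB[of v] X(2) by (auto simp: consistent_def)
      then show ?thesis using ab v by (simp add: core_of_B)
    next
      case False
      then have "(Atom a', b') \<in> ?A" using x ab by (auto simp: full_Atom[OF X(3)])
      then have "(Atom a', b') \<in> up (nogoods P) ?A" by (rule up.start)
      then show ?thesis using False ab by (simp add: core_of_def)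
    qed
  qed
  have XB': "(B v 0, False) \<in> ?X \<and> (B v d, True) \<in> ?X" if "v \<in> {1..n}" for v
    using XB[OF that] by blast
  note up = up_core[OF nd X' XB' 1[unfolded C_def] 2 3 4[unfolded P_def]]
  show "conflict (nogoods P) U \<longleftrightarrow> \<not> consistent C"
    using up(1) unfolding U_def P_def C_def by blast
  show "consistent C \<Longrightarrow> U = full n d C"
    using up(2) unfolding U_def P_def C_def by blast
qed

lemma represents_final:
  assumes s: "rel n d s \<sigma>" "prop_inv n d X \<sigma>" "cfl \<sigma> \<or> stk \<sigma> = []"
    and U: "conflict N U \<longleftrightarrow> \<not> consistent (cl n d X)" "consistent (cl n d X) \<Longrightarrow> U = full n d (cl n d X)"
  shows "represents n d N s U" "\<not> conflict N U \<Longrightarrow> \<not> cfl \<sigma>"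
proof -
  have c: "s Conflict 0 = of_bool (cfl \<sigma>)" using s(1) by (simp add: rel_def)
  have "represents n d N s U \<and> (\<not> conflict N U \<longrightarrow> \<not> cfl \<sigma>)"
  proof (cases "cfl \<sigma>")
    case True
    then have "conflict N U" using inv_conflict[OF s(2)] U(1) by blast
    then show ?thesis using c True by (simp add: represents_def)
  next
    case False
    then have st: "stk \<sigma> = []" using s(3) by blast
    note f = inv_final[OF s(2) st False]
    have core: "fst ` vals \<sigma> \<subseteq> core_atoms n d" using s(2) by (simp add: prop_inv_def good_def)
    have "U = full n d (vals \<sigma>)" using U(2)[OF f(2)] f(1) by simp
    then show ?thesis
      using U(1) f(2) c False rel_represents[OF s(1) core] unfolding represents_def by auto
  qed
  then show "represents n d N s U" "\<not> conflict N U \<Longrightarrow> \<not> cfl \<sigma>" by blast+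
qed

definition propagated :: "nat \<Rightarrow> nat \<Rightarrow> (atom \<times> bool) set \<Rightarrow> pstate \<Rightarrow> bool" where
  "propagated n d X \<sigma> \<longleftrightarrow> prop_inv n d X \<sigma> \<and> (cfl \<sigma> \<or> stk \<sigma> = []) \<and>
     (\<forall>v\<in>{1..n}. (B v 0, False) \<in> X \<and> (B v d, True) \<in> X)"

text \<open>Of the 100 units that \<open>pot_insert\<close> releases, 50 cover the reading of the
  decision and 1 the failing test of the main loop.\<close>

lemma step_correct:
  fixes b :: bool
  assumes nd: "1 \<le> n" "1 \<le> d" and s: "rel n d s \<sigma>" "prop_inv n d X \<sigma>" "stk \<sigma> = []" "\<not> cfl \<sigma>"
    and a: "a \<in> core_atoms n d" "(a, True) \<notin> vals \<sigma>" "(a, False) \<notin> vals \<sigma>"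
  defines "X' \<equiv> insert (a, b) (vals \<sigma>)"
  shows "\<exists>t s' \<sigma>'. exec step_code (write_decision a b s) t s' \<and> rel n d s' \<sigma>' \<and> prop_inv n d X' \<sigma>' \<and>
    (cfl \<sigma>' \<or> stk \<sigma>' = []) \<and> t + pot n d \<sigma>' \<le> pot n d \<sigma>"
proof -
  let ?\<tau> = "enq (a, b) \<sigma>"
  have \<tau>: "?\<tau> = \<sigma>\<lparr>vals := X', stk := [a]\<rparr>" using a s(3) by (simp add: enq.simps X'_def)
  have g: "good n d (cl n d X) \<sigma>" "don \<sigma> \<subseteq> cells d" "done_ok n \<sigma>" using s(2,4) by (auto simp: prop_inv_def)
  have con: "consistent X'" using g(1) a unfolding X'_def by (intro consistent_insert) (auto simp: good_def)
  have core: "fst ` X' \<subseteq> core_atoms n d" using g(1) a by (auto simp: good_def X'_def)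
  have a': "a \<notin> fst ` vals \<sigma>"
  proof
    assume "a \<in> fst ` vals \<sigma>"
    then obtain b' where "(a, b') \<in> vals \<sigma>" by auto
    then show False using a(2,3) by (cases b') auto
  qed
  have pot: "pot n d ?\<tau> + 100 = pot n d \<sigma>" using pot_insert[OF a(1) a', of b] \<tau> s(3) by (simp add: X'_def)
  \<comment> \<open>The literals known before the decision become generators of the new closure.
    Since a is on the stack, the processed literals have not changed, and their consequences are
    present already.\<close>
  have inv: "prop_inv n d X' ?\<tau>"
  proof -
    have "good n d (cl n d X') ?\<tau>"
      using subset_cl[of X' n d] con core a(1) s(4) by (simp add: good_def \<tau>)
    moreover have "extends n d \<sigma> ?\<tau>" using pot s(3) by (auto simp: extends_def \<tau> X'_def)
    then have "done_ok n ?\<tau>" by (rule done_ok_ext[OF g(3)]) (simp add: \<tau> con)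
    moreover have "e \<in> X'" if "der n d (pending_free ?\<tau>) e" for e
    proof -
      have "pending_free ?\<tau> \<subseteq> pending_free \<sigma>" by (rule pending_free_ext) fact
      then have "der n d (pending_free \<sigma>) e" using that der_mono by blast
      then show ?thesis using s(2,4) unfolding prop_inv_def X'_def by blast
    qed
    ultimately show ?thesis using g(2) by (auto simp: prop_inv_def \<tau>)
  qed
  let ?w = "write_decision a b s"
  have w: "rel n d (?w(Work 6 := f)) \<sigma>" for f using s(1) by (simp add: write_decision_def rel_def)
  have "run decision_code ?w 50
     (\<lambda>s'. rel n d s' ?\<tau>)"
  proof (cases a)
    case (B v i)
    let ?t = "?w(Work 6 := (s (Work 6))(0 := v, 3 := tc b, 5 := i))"
    have "run enq_B ?t 10 (\<lambda>s'. rel n d s' (enq (B v i, b) \<sigma>) \<and> frame {4} ?t s')"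
      by (rule run_enq_B[OF w]) (use a(1) B in auto)
    then have "run enq_B ?t 45 (\<lambda>s'. rel n d s' ?\<tau>)" by (rule run_mono) (auto simp: B)
    then show ?thesis using B by (cases b) (simp_all add: decision_code_def write_decision_def)
  next
    case (R v l u)
    let ?t = "?w(Work 6 := (s (Work 6))(0 := v, 3 := tc b, 1 := l, 2 := u))"
    have "run enq_R ?t 13 (\<lambda>s'. rel n d s' (enq (R v l u, b) \<sigma>) \<and> frame {4} ?t s')"
      by (rule run_enq_R[OF w]) (use a(1) R in auto)
    then have "run enq_R ?t 44 (\<lambda>s'. rel n d s' ?\<tau>)" by (rule run_mono) (auto simp: R)
    then show ?thesis using R by (cases b) (simp_all add: decision_code_def write_decision_def)
  qed (use a(1) in auto)
  then obtain t1 s1 where 1: "exec decision_code ?w t1 s1"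
    "t1 \<le> 50" "rel n d s1 ?\<tau>" unfolding run_def by blast
  obtain t2 s2 \<sigma>' where 2: "exec main_loop s1 t2 s2" "rel n d s2 \<sigma>'" "prop_inv n d X' \<sigma>'"
    "cfl \<sigma>' \<or> stk \<sigma>' = []" "t2 + pot n d \<sigma>' \<le> pot n d ?\<tau> + 1"
    using main_loop_correct[OF 1(3) inv] by blast
  have "exec step_code ?w (t1 + t2) s2"
    using exec.Seq[OF 1(1) 2(1)] unfolding step_code_def .
  moreover have "t1 + t2 + pot n d \<sigma>' \<le> pot n d \<sigma>" using 1(2) 2(5) pot by linarith
  ultimately show ?thesis using 2 by blast
qed

text \<open>Each step takes no longer than the potential drops, so the times telescope. X varies in
  the induction because each decision yields new generators.\<close>

lemma runs_correct:
  assumes nd: "1 \<le> n" "1 \<le> d"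
  defines "P \<equiv> alldiff_program n d"
  shows "rel n d s \<sigma> \<Longrightarrow> propagated n d X \<sigma> \<Longrightarrow>
    (conflict (nogoods P) A \<longleftrightarrow> \<not> consistent (cl n d X)) \<Longrightarrow>
    (consistent (cl n d X) \<Longrightarrow> A = full n d (cl n d X)) \<Longrightarrow>
    branch P A ds \<Longrightarrow> \<exists>t. runs n d P step_code A s ds t \<and> t \<le> pot n d \<sigma>"
proof (induction ds arbitrary: s \<sigma> X A)
  case Nil
  then have "represents n d (nogoods P) s A"
    using represents_final(1)[of n d s \<sigma> X "nogoods P" A] by (simp add: propagated_def)
  then show ?case by simp
next
  case (Cons x ds)
  obtain a b where x: "x = (a, b)" by (cases x)
  let ?U = "up (nogoods P) (insert (Atom a, b) A)"
  have br: "\<not> conflict (nogoods P) A" "a \<in> atoms P" "(Atom a, True) \<notin> A" "(Atom a, False) \<notin> A"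
    "branch P ?U ds" using Cons.prems(5) x by auto
  have st: "prop_inv n d X \<sigma>" "cfl \<sigma> \<or> stk \<sigma> = []"
    and XB: "\<And>v. v \<in> {1..n} \<Longrightarrow> (B v 0, False) \<in> X \<and> (B v d, True) \<in> X"
    using Cons.prems(2) by (auto simp: propagated_def)
  note rep = represents_final[OF Cons.prems(1) st Cons.prems(3,4)]
  have nc: "\<not> cfl \<sigma>" using rep(2) br(1) by blast
  then have emp: "stk \<sigma> = []" using st(2) by blast
  note f = inv_final[OF st(1) emp nc]
  have A: "A = full n d (vals \<sigma>)" using Cons.prems(4) f by simp
  have V: "closed n d (vals \<sigma>)" "consistent (vals \<sigma>)" "fst ` vals \<sigma> \<subseteq> core_atoms n d"
    using f closed_cl st(1) by (auto simp: prop_inv_def good_def)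
  have VB: "(B v 0, False) \<in> vals \<sigma> \<and> (B v d, True) \<in> vals \<sigma>" if "v \<in> {1..n}" for v
    using XB[OF that] subset_cl[of X n d] f(1) by blast
  have a: "a \<in> core_atoms n d" "\<forall>v. a \<noteq> B v 0" "(a, True) \<notin> vals \<sigma>" "(a, False) \<notin> vals \<sigma>"
  proof -
    \<comment> \<open>These atoms are assigned at every fixpoint, whereas decisions concern
      unassigned atoms.\<close>
    have "a \<notin> {Bot, Sat, Violate}"
      using br(3,4) unfolding A full_Atom[OF V(3)] by auto
    then show core: "a \<in> core_atoms n d" "\<forall>v. a \<noteq> B v 0"
      using atoms_alldiff[OF br(2)[unfolded P_def] nd(2)] by blast+
    show "(a, True) \<notin> vals \<sigma>" "(a, False) \<notin> vals \<sigma>"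
      using br(3,4) core(2) unfolding A full_Atom[OF V(3)] by blast+
  qed
  let ?X = "insert (a, b) (vals \<sigma>)"
  obtain t s' \<sigma>' where 1: "exec step_code (write_decision a b s) t s'" "rel n d s' \<sigma>'" "prop_inv n d ?X \<sigma>'"
    "cfl \<sigma>' \<or> stk \<sigma>' = []" "t + pot n d \<sigma>' \<le> pot n d \<sigma>"
    using step_correct[OF nd Cons.prems(1) st(1) emp nc a(1,3,4)] by blast
  have "propagated n d ?X \<sigma>'" using 1 VB by (simp add: propagated_def)
  note U = up_core_step[OF nd V VB a, of b, folded P_def A]
  obtain t' where 2: "runs n d P step_code ?U s' ds t'" "t' \<le> pot n d \<sigma>'"
    using Cons.IH[OF 1(2) \<open>propagated n d ?X \<sigma>'\<close> U br(5)] by blast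
  have "runs n d P step_code A s (x # ds) (t + t')"
    using rep(1) 1(1) 2(1) unfolding x runs.simps by blast
  moreover have "t + t' \<le> pot n d \<sigma>" using 1(5) 2(2) by linarith
  ultimately show ?case by blast
qed

text \<open>At most 2 n d atoms \<open>B v i\<close>, sentinels included, contribute up to 900 d
  each, at most n d^2 atoms \<open>R v l u\<close> contribute 500 each, and at most d^2 intervals
  contribute up to 200 n each: 1800 + 500 + 200 = 2500.\<close>

lemma pot_empty_state:
  assumes "1 \<le> n" "1 \<le> d"
  shows "pot n d empty_state \<le> 2500 * (n * d ^ 2)"
proof -
  let ?Bs = "(\<lambda>(v, i). B v i) ` ({1..n} \<times> {0..d})"
  let ?Rs = "(\<lambda>(v, l, u). R v l u) ` ({1..n} \<times> {1..d} \<times> {1..d})"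
  let ?m = "n * d ^ 2"
  have sub: "core_atoms n d \<subseteq> ?Bs \<union> ?Rs"
  proof
    fix a assume "a \<in> core_atoms n d"
    then consider v i where "a = B v i" "(v, i) \<in> {1..n} \<times> {0..d}"
      | v l u where "a = R v l u" "(v, l, u) \<in> {1..n} \<times> {1..d} \<times> {1..d}"
      by (cases a) (auto simp: cell_def)
    then show "a \<in> ?Bs \<union> ?Rs"
    proof cases
      case (1 v i)
      then have "a \<in> ?Bs" by (intro image_eqI[of _ _ "(v, i)"]) auto
      then show ?thesis ..
    next
      case (2 v l u)
      then have "a \<in> ?Rs" by (intro image_eqI[of _ _ "(v, l, u)"]) auto
      then show ?thesis ..
    qed
  qed
  have "card ?Bs \<le> card ({1..n} \<times> {0..d})" by (rule card_image_le) simp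
  also have "\<dots> = n * (d + 1)" by (simp add: card_cartesian_product)
  also have "\<dots> \<le> n * (2 * d)" using assms by (intro mult_le_mono) auto
  finally have cB: "card ?Bs \<le> 2 * (n * d)" by simp
  have "card ?Rs \<le> card ({1..n} \<times> {1..d} \<times> {1..d})" by (rule card_image_le) simp
  then have cR: "card ?Rs \<le> ?m" by (simp add: card_cartesian_product power2_eq_square)
  have sB: "(\<Sum>a\<in>?Bs. wt d a + 100) = (\<Sum>a\<in>?Bs. 400 * (d + 1) + 100)"
    by (rule sum.cong) auto
  have sR: "(\<Sum>a\<in>?Rs. wt d a + 100) = (\<Sum>a\<in>?Rs. 500)"
    by (rule sum.cong) auto
  have "(\<Sum>a\<in>core_atoms n d. wt d a + 100) \<le> (\<Sum>a\<in>?Bs \<union> ?Rs. wt d a + 100)"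
    using sub by (intro sum_mono2) auto
  also have "\<dots> \<le> (\<Sum>a\<in>?Bs. wt d a + 100) + (\<Sum>a\<in>?Rs. wt d a + 100)"
    by (subst sum.union_disjoint) auto
  also have "(\<Sum>a\<in>?Bs. wt d a + 100) = card ?Bs * (400 * (d + 1) + 100)"
    unfolding sB by simp
  also have "(\<Sum>a\<in>?Rs. wt d a + 100) = card ?Rs * 500"
    unfolding sR by simp
  also have "card ?Bs * (400 * (d + 1) + 100) \<le> (2 * (n * d)) * (900 * d)"
    using cB assms by (intro mult_le_mono) auto
  also have "\<dots> = 1800 * ?m" by (simp add: power2_eq_square)
  also have "card ?Rs * 500 \<le> 500 * ?m" using cR by simp
  finally have 1: "(\<Sum>a\<in>core_atoms n d. wt d a + 100) \<le> 2300 * ?m" by simp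
  have "card (cells d) \<le> card ({1..d} \<times> {1..d})"
    by (rule card_mono) (auto simp: cells_def)
  then have "card (cells d) \<le> d ^ 2" by (simp add: card_cartesian_product power2_eq_square)
  then have "100 * (n + 1) * card (cells d) \<le> 100 * (2 * n) * d ^ 2"
    using assms by (intro mult_le_mono) auto
  then have 2: "100 * (n + 1) * card (cells d) \<le> 200 * ?m" by simp
  show ?thesis using 1 2 by (simp add: pot_def empty_state_def)
qed

lemma start_correct:
  assumes nd: "1 \<le> n" "1 \<le> d" and pq: "init_domains n d p q"
  shows "\<exists>t s \<sigma>. exec start_code (input_store n d p q) t s \<and> rel n d s \<sigma> \<and>
    propagated n d (start_core n d p q) \<sigma> \<and> t + pot n d \<sigma> \<le> 3000 * (n * d ^ 2)"
proof -
  let ?i = "input_store n d p q" and ?N = "(n + 1) * (d + 1)" and ?m = "n * d ^ 2"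
  obtain t1 s1 where 1: "exec table_code ?i t1 s1" "t1 \<le> 10 * (?N * (d + 1)) + 10 * ?N + 10 * n + 20"
    "tables n d (s1 Size) (s1 (Work 0))"
    "\<forall>x\<in>{Value 3, Value 4, Value 5, Value 7, Value 8}. all_false n d (s1 x)"
    "\<forall>x. x \<notin> {Work 0, Work 6, Value 3, Value 4, Value 5, Value 7, Value 8} \<longrightarrow> s1 x = ?i x"
    using run_table_code[of ?i n d] unfolding run_def by (auto simp: input_store_def)
  have "run consts_code s1 6 (\<lambda>s2. rel n d s2 empty_state \<and> s2 Lower = ?i Lower \<and> s2 Upper = ?i Upper)"
    using 1(3-5)
    by (simp add: consts_code_def rel_def consts_repr_def B_repr_def R_repr_def stack_repr_def
        count_repr_def done_repr_def empty_state_def input_store_def vc_def true_count_def consistent_def)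
  then obtain t2 s2 where 2: "exec consts_code s1 t2 s2" "t2 \<le> 6" "rel n d s2 empty_state"
    "s2 Lower = ?i Lower" "s2 Upper = ?i Upper" unfolding run_def by blast
  have "s2 Lower v = p v \<and> s2 Upper v = q v" if "v \<in> {1..n}" for v
    using that 2(4,5) by (simp add: input_store_def)
  from run_domains_code[OF 2(3) pq this]
  obtain t3 s3 where 3: "exec domains_code s2 t3 s3" "t3 \<le> 50 * n + 2" "rel n d s3 (start_state n d p q)"
    unfolding run_def by blast
  note inv = start_state_inv[OF pq]
  obtain t4 s4 \<sigma> where 4: "exec main_loop s3 t4 s4" "rel n d s4 \<sigma>" "prop_inv n d (start_core n d p q) \<sigma>"
    "cfl \<sigma> \<or> stk \<sigma> = []" "t4 + pot n d \<sigma> \<le> pot n d (start_state n d p q) + 1"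
    using main_loop_correct[OF 3(3) inv(1)] by blast
  have "exec start_code ?i (t1 + (t2 + (t3 + t4))) s4"
    unfolding start_code_def using exec.Seq[OF 1(1) exec.Seq[OF 2(1) exec.Seq[OF 3(1) 4(1)]]] .
  moreover have "propagated n d (start_core n d p q) \<sigma>"
    using 4(3,4) start_coreI by (simp add: propagated_def)
  moreover have "t1 + (t2 + (t3 + t4)) + pot n d \<sigma> \<le> 3000 * ?m"
  proof -
    have n: "n \<le> ?m" "1 \<le> ?m" using nd by auto
    have "?N \<le> (2 * n) * (2 * d)" using nd by (intro mult_le_mono) auto
    also have "\<dots> \<le> 4 * ?m" using nd by (simp add: power2_eq_square)
    finally have N: "?N \<le> 4 * ?m" .
    have "?N * (d + 1) \<le> (2 * n) * (2 * d) * (2 * d)" using nd by (intro mult_le_mono) auto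
    then have N': "?N * (d + 1) \<le> 8 * ?m" by (simp add: power2_eq_square)
    \<comment> \<open>80 for filling the arrays, 40 for the table of multiples, 10 for the additions
      and 20 for the constant. With 100 for the remaining initialisation and 2500 for the potential,
      the sum stays below 3000.\<close>
    have "t1 \<le> 150 * ?m" using 1(2) N N' n by linarith
    moreover have "t2 + t3 + 1 \<le> 100 * ?m" using 2(2) 3(2) n by linarith
    ultimately show ?thesis using 4(5) inv(2) pot_empty_state[OF nd] by linarith
  qed
  ultimately show ?thesis using 4(2) by blast
qed

theorem alldiff_time: "up_time_down_branch alldiff_program (\<lambda>n d. n * d ^ 2)"
  unfolding up_time_down_branch_def
proof (rule exI[of _ start_code], rule exI[of _ step_code], rule exI[of _ 3000], intro allI impI)
  fix n d p q ds
  let ?P = "alldiff_program n d"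
  assume nd: "1 \<le> n" "1 \<le> d" and pq: "init_domains n d p q" and br: "branch ?P (root n ?P p q) ds"
  obtain t0 s \<sigma> where 1: "exec start_code (input_store n d p q) t0 s" "rel n d s \<sigma>"
    "propagated n d (start_core n d p q) \<sigma>" "t0 + pot n d \<sigma> \<le> 3000 * (n * d ^ 2)"
    using start_correct[OF nd pq] by blast
  obtain t where 2: "runs n d ?P step_code (root n ?P p q) s ds t" "t \<le> pot n d \<sigma>"
    using runs_correct[OF nd 1(2,3) root_conflict[OF nd pq] root_full[OF nd pq] br] by blast
  have "t0 + t \<le> 3000 * (n * d ^ 2)" using 1(4) 2(2) by linarith
  then show "\<exists>s t0 t. exec start_code (input_store n d p q) t0 s \<and>
      runs n d ?P step_code (root n ?P p q) s ds t \<and> t0 + t \<le> 3000 * (n * d ^ 2)"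
    using 1(1) 2(1) by blast
qed

theorem corollary3:
  shows "(\<forall>n d. 1 \<le> n \<longrightarrow> 1 \<le> d \<longrightarrow>
            up_enforces_bc n d (alldiff_program n d) (alldifferent n d)) \<and>
         up_time_down_branch alldiff_program (\<lambda>n d. n * d ^ 2)"
  using alldiff_enforces_bc alldiff_time by blast

end
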